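(* In the language of second-order arithmetic, let $\exists X\,\forall Y\,\Psi(X,Y)$ be a $\Sigma^1_2$ sentence such that $\Psi(X,Y)$ is a $\Pi^0_3$ formula. If $\mathrm{RCA}_0 + \mathrm{B}\Sigma^0_2 + \exists X\,\forall Y\,\Psi(X,Y)$ is consistent, then $\mathrm{RCA}_0 + \mathrm{B}\Sigma^0_2 + \exists X\,\forall Y\,\Psi(X,Y)$ does not prove $\mathrm{I}\Sigma^0_2$.
   Context: $\mathrm{RCA}_0$ is the standard base system of reverse mathematics (basic arithmetic axioms, $\Delta^0_1$ comprehension, and $\Sigma^0_1$ induction). For a $\Sigma^0_k$ formula $\Phi$ (possibly with free number and set variables), $\mathrm{I}\Sigma^0_k$ is the scheme of universal closures of $(\Phi(0)\land\forall i\,(\Phi(i)\Rightarrow\Phi(i+1)))\Rightarrow\forall i\,\Phi(i)$, and $\mathrm{B}\Sigma^0_k$ is the scheme of universal closures of $(\forall i\,\exists j\,\Phi(i,j))\Rightarrow\forall m\,\exists n\,(\forall i<m)\,(\exists j<n)\,\Phi(i,j)$. *)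

theory Defs
  imports Main
begin

text \<open>
  The two-sorted language of second-order arithmetic, with de Bruijn indices. Number variables
  and set variables are indexed separately, so a number quantifier does not affect set indices and
  vice versa. Equality is primitive on numbers only; the other connectives and the existential
  quantifiers are the usual classical abbreviations.
\<close>

datatype tm = Var nat | Zero | One | Add tm tm | Mul tm tm

datatype fm =
    Eq tm tm
  | Less tm tm
  | Mem tm nat
  | Fls
  | Imp fm fm
  | All fm
  | AllS fm

abbreviation Neg :: "fm \<Rightarrow> fm" where
  "Neg \<phi> \<equiv> Imp \<phi> Fls"

abbreviation Or :: "fm \<Rightarrow> fm \<Rightarrow> fm" where
  "Or \<phi> \<psi> \<equiv> Imp (Neg \<phi>) \<psi>"

abbreviation And :: "fm \<Rightarrow> fm \<Rightarrow> fm" where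
  "And \<phi> \<psi> \<equiv> Neg (Imp \<phi> (Neg \<psi>))"

abbreviation Iff :: "fm \<Rightarrow> fm \<Rightarrow> fm" where
  "Iff \<phi> \<psi> \<equiv> And (Imp \<phi> \<psi>) (Imp \<psi> \<phi>)"

abbreviation Ex :: "fm \<Rightarrow> fm" where
  "Ex \<phi> \<equiv> Neg (All (Neg \<phi>))"

abbreviation ExS :: "fm \<Rightarrow> fm" where
  "ExS \<phi> \<equiv> Neg (AllS (Neg \<phi>))"


subsection \<open>Substitution\<close>

primrec sub_tm :: "(nat \<Rightarrow> tm) \<Rightarrow> tm \<Rightarrow> tm" where
  "sub_tm \<sigma> (Var n) = \<sigma> n"
| "sub_tm \<sigma> Zero = Zero"
| "sub_tm \<sigma> One = One"
| "sub_tm \<sigma> (Add s t) = Add (sub_tm \<sigma> s) (sub_tm \<sigma> t)"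
| "sub_tm \<sigma> (Mul s t) = Mul (sub_tm \<sigma> s) (sub_tm \<sigma> t)"

definition shift :: "nat \<Rightarrow> tm" where
  "shift n = Var (Suc n)"

definition up :: "(nat \<Rightarrow> tm) \<Rightarrow> nat \<Rightarrow> tm" where
  "up \<sigma> = case_nat (Var 0) (\<lambda>n. sub_tm shift (\<sigma> n))"

definition upS :: "(nat \<Rightarrow> nat) \<Rightarrow> nat \<Rightarrow> nat" where
  "upS \<rho> = case_nat 0 (\<lambda>n. Suc (\<rho> n))"

text \<open>
  Simultaneous capture-avoiding substitution of terms for number variables and of set variables
  (the only set terms) for set variables.
\<close>

primrec sub :: "(nat \<Rightarrow> tm) \<Rightarrow> (nat \<Rightarrow> nat) \<Rightarrow> fm \<Rightarrow> fm" where
  "sub \<sigma> \<rho> (Eq s t) = Eq (sub_tm \<sigma> s) (sub_tm \<sigma> t)"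
| "sub \<sigma> \<rho> (Less s t) = Less (sub_tm \<sigma> s) (sub_tm \<sigma> t)"
| "sub \<sigma> \<rho> (Mem t X) = Mem (sub_tm \<sigma> t) (\<rho> X)"
| "sub \<sigma> \<rho> Fls = Fls"
| "sub \<sigma> \<rho> (Imp \<phi> \<psi>) = Imp (sub \<sigma> \<rho> \<phi>) (sub \<sigma> \<rho> \<psi>)"
| "sub \<sigma> \<rho> (All \<phi>) = All (sub (up \<sigma>) \<rho> \<phi>)"
| "sub \<sigma> \<rho> (AllS \<phi>) = AllS (sub \<sigma> (upS \<rho>) \<phi>)"

definition lift :: "fm \<Rightarrow> fm" where
  "lift = sub shift id"

definition liftS :: "fm \<Rightarrow> fm" where
  "liftS = sub Var Suc"

definition inst :: "fm \<Rightarrow> tm \<Rightarrow> fm" where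
  "inst \<phi> t = sub (case_nat t Var) id \<phi>"

definition instS :: "fm \<Rightarrow> nat \<Rightarrow> fm" where
  "instS \<phi> X = sub Var (case_nat X id) \<phi>"


subsection \<open>Sentences and universal closures\<close>

text \<open>All free number (set) variables of \<open>\<phi>\<close> have index below \<open>nbound \<phi>\<close> (\<open>sbound \<phi>\<close>).\<close>

primrec tbound :: "tm \<Rightarrow> nat" where
  "tbound (Var n) = Suc n"
| "tbound Zero = 0"
| "tbound One = 0"
| "tbound (Add s t) = max (tbound s) (tbound t)"
| "tbound (Mul s t) = max (tbound s) (tbound t)"

primrec nbound :: "fm \<Rightarrow> nat" where
  "nbound (Eq s t) = max (tbound s) (tbound t)"
| "nbound (Less s t) = max (tbound s) (tbound t)"
| "nbound (Mem t X) = tbound t"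
| "nbound Fls = 0"
| "nbound (Imp \<phi> \<psi>) = max (nbound \<phi>) (nbound \<psi>)"
| "nbound (All \<phi>) = nbound \<phi> - 1"
| "nbound (AllS \<phi>) = nbound \<phi>"

primrec sbound :: "fm \<Rightarrow> nat" where
  "sbound (Eq s t) = 0"
| "sbound (Less s t) = 0"
| "sbound (Mem t X) = Suc X"
| "sbound Fls = 0"
| "sbound (Imp \<phi> \<psi>) = max (sbound \<phi>) (sbound \<psi>)"
| "sbound (All \<phi>) = sbound \<phi>"
| "sbound (AllS \<phi>) = sbound \<phi> - 1"

definition sentence :: "fm \<Rightarrow> bool" where
  "sentence \<phi> \<longleftrightarrow> nbound \<phi> = 0 \<and> sbound \<phi> = 0"

definition univ_closure :: "fm \<Rightarrow> fm" where
  "univ_closure \<phi> = (AllS ^^ sbound \<phi>) ((All ^^ nbound \<phi>) \<phi>)"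


subsection \<open>Provability\<close>

text \<open>Classical natural deduction for two-sorted first-order logic with equality on numbers.\<close>

inductive proves :: "fm set \<Rightarrow> fm \<Rightarrow> bool" (infix \<open>\<turnstile>\<close> 50) where
  Assm: "\<phi> \<in> \<Gamma> \<Longrightarrow> \<Gamma> \<turnstile> \<phi>"
| ImpI: "insert \<phi> \<Gamma> \<turnstile> \<psi> \<Longrightarrow> \<Gamma> \<turnstile> Imp \<phi> \<psi>"
| ImpE: "\<Gamma> \<turnstile> Imp \<phi> \<psi> \<Longrightarrow> \<Gamma> \<turnstile> \<phi> \<Longrightarrow> \<Gamma> \<turnstile> \<psi>"
| Raa: "insert (Neg \<phi>) \<Gamma> \<turnstile> Fls \<Longrightarrow> \<Gamma> \<turnstile> \<phi>"
| AllI: "lift ` \<Gamma> \<turnstile> \<phi> \<Longrightarrow> \<Gamma> \<turnstile> All \<phi>"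
| AllE: "\<Gamma> \<turnstile> All \<phi> \<Longrightarrow> \<Gamma> \<turnstile> inst \<phi> t"
| AllSI: "liftS ` \<Gamma> \<turnstile> \<phi> \<Longrightarrow> \<Gamma> \<turnstile> AllS \<phi>"
| AllSE: "\<Gamma> \<turnstile> AllS \<phi> \<Longrightarrow> \<Gamma> \<turnstile> instS \<phi> X"
| EqRefl: "\<Gamma> \<turnstile> Eq t t"
| EqSubst: "\<Gamma> \<turnstile> Eq s t \<Longrightarrow> \<Gamma> \<turnstile> inst \<phi> s \<Longrightarrow> \<Gamma> \<turnstile> inst \<phi> t"

definition consistent :: "fm set \<Rightarrow> bool" where
  "consistent T \<longleftrightarrow> \<not> T \<turnstile> Fls"


subsection \<open>The arithmetical hierarchy\<close>

abbreviation AllB :: "tm \<Rightarrow> fm \<Rightarrow> fm" where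
  "AllB t \<phi> \<equiv> All (Imp (Less (Var 0) (sub_tm shift t)) \<phi>)"

abbreviation ExB :: "tm \<Rightarrow> fm \<Rightarrow> fm" where
  "ExB t \<phi> \<equiv> Ex (And (Less (Var 0) (sub_tm shift t)) \<phi>)"

inductive bounded :: "fm \<Rightarrow> bool" where
  "bounded (Eq s t)"
| "bounded (Less s t)"
| "bounded (Mem t X)"
| "bounded Fls"
| "bounded \<phi> \<Longrightarrow> bounded \<psi> \<Longrightarrow> bounded (Imp \<phi> \<psi>)"
| "bounded \<phi> \<Longrightarrow> bounded (AllB t \<phi>)"
| "bounded \<phi> \<Longrightarrow> bounded (ExB t \<phi>)"

text \<open>
  The classes \<open>\<Sigma>\<^sup>0\<^sub>k\<close> and \<open>\<Pi>\<^sup>0\<^sub>k\<close>, with set parameters allowed. Blocks of like quantifiers are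
  permitted and the classes are cumulative.
\<close>

inductive Sigma0 :: "nat \<Rightarrow> fm \<Rightarrow> bool" and Pi0 :: "nat \<Rightarrow> fm \<Rightarrow> bool" where
  "bounded \<phi> \<Longrightarrow> Sigma0 0 \<phi>"
| "bounded \<phi> \<Longrightarrow> Pi0 0 \<phi>"
| "Pi0 k \<phi> \<Longrightarrow> Sigma0 (Suc k) \<phi>"
| "Sigma0 (Suc k) \<phi> \<Longrightarrow> Sigma0 (Suc k) (Ex \<phi>)"
| "Sigma0 k \<phi> \<Longrightarrow> Pi0 (Suc k) \<phi>"
| "Pi0 (Suc k) \<phi> \<Longrightarrow> Pi0 (Suc k) (All \<phi>)"


subsection \<open>Axiom systems\<close>

definition basic_axioms :: "fm set" where
  "basic_axioms = univ_closure `
    {Neg (Eq (Add (Var 0) One) Zero),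
     Imp (Eq (Add (Var 0) One) (Add (Var 1) One)) (Eq (Var 0) (Var 1)),
     Eq (Add (Var 0) Zero) (Var 0),
     Eq (Add (Var 0) (Add (Var 1) One)) (Add (Add (Var 0) (Var 1)) One),
     Eq (Mul (Var 0) Zero) Zero,
     Eq (Mul (Var 0) (Add (Var 1) One)) (Add (Mul (Var 0) (Var 1)) (Var 0)),
     Neg (Less (Var 0) Zero),
     Iff (Less (Var 0) (Add (Var 1) One)) (Or (Less (Var 0) (Var 1)) (Eq (Var 0) (Var 1)))}"

text \<open>
  In \<open>\<phi>(i)\<close> the variable \<open>i\<close> has index 0 and the remaining indices are parameters; the second
  conjunct uses \<open>\<phi>(i+1)\<close>.
\<close>

definition ind_inst :: "fm \<Rightarrow> fm" where
  "ind_inst \<phi> =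
    Imp (And (inst \<phi> Zero)
             (All (Imp \<phi> (sub (case_nat (Add (Var 0) One) shift) id \<phi>))))
        (All \<phi>)"

definition ISigma :: "nat \<Rightarrow> fm set" where
  "ISigma k = {univ_closure (ind_inst \<phi>) | \<phi>. Sigma0 k \<phi>}"

text \<open>
  In \<open>\<phi>(i, j)\<close> the variable \<open>j\<close> has index 0, \<open>i\<close> has index 1, and the remaining indices are
  parameters. In the conclusion the order of the bound variables, innermost first, is
  \<open>j, i, n, m\<close>, so the parameters of \<open>\<phi>\<close> move up by two.
\<close>

definition bnd_inst :: "fm \<Rightarrow> fm" where
  "bnd_inst \<phi> =
    Imp (All (Ex \<phi>))
        (All (Ex (AllB (Var 1) (ExB (Var 1)
          (sub (\<lambda>k. if k < 2 then Var k else Var (k + 2)) id \<phi>)))))"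

definition BSigma :: "nat \<Rightarrow> fm set" where
  "BSigma k = {univ_closure (bnd_inst \<phi>) | \<phi>. Sigma0 k \<phi>}"

text \<open>The set variable introduced by comprehension does not occur in \<open>liftS \<phi>\<close>.\<close>

definition comp_inst :: "fm \<Rightarrow> fm \<Rightarrow> fm" where
  "comp_inst \<phi> \<psi> =
    Imp (All (Iff \<phi> \<psi>)) (ExS (All (Iff (Mem (Var 0) 0) (liftS \<phi>))))"

definition Delta1_CA :: "fm set" where
  "Delta1_CA = {univ_closure (comp_inst \<phi> \<psi>) | \<phi> \<psi>. Sigma0 1 \<phi> \<and> Pi0 1 \<psi>}"

definition RCA0 :: "fm set" where
  "RCA0 = basic_axioms \<union> Delta1_CA \<union> ISigma 1"

end

theory Submission
  imports Defs "HOL-Library.Countable_Set"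
begin

text \<open>
  By completeness take a model \<open>M\<^sub>0\<close> of the theory with a witness \<open>A\<close> for the set quantifier. Let \<open>c 0 < c 1 < \<dots>\<close>
  be a sequence in an extension \<open>M\<close>, starting above all standard numbers and bounded by some \<open>d\<close>, such that
  \<open>c (n + 1)\<close> bounds a witness \<open>y\<close> of every true statement \<open>\<forall>x \<exists>y \<forall>z \<theta>\<close> for all \<open>x \<le> c n\<close>, where \<open>\<theta>\<close> is bounded.
  The cut \<open>I = {x. \<exists>n. x \<le> c n}\<close> is then \<open>\<Sigma>\<^sub>1\<close>-elementary in \<open>M\<close>, hence satisfies \<open>\<Sigma>\<^sub>2\<close> collection, and it keeps
  the \<open>\<Pi>\<^sub>3\<close> statements. To make \<open>\<Sigma>\<^sub>2\<close> induction fail one adds a set \<open>P\<close> of pairs whose \<open>n\<close>-th row has no element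
  above \<open>c n\<close> for standard \<open>n\<close> and contains every \<open>c k\<close> with standard \<open>k\<close>, \<open>0 < k \<le> n\<close>: in the cut, row \<open>n\<close> is bounded exactly for standard \<open>n\<close>.
  The statements \<open>\<theta>\<close> may mention \<open>P\<close> itself. For finitely many \<open>\<theta>\<close> such a \<open>P\<close> exists in \<open>M\<^sub>0\<close>, by recursion: a new
  element enters row \<open>n + 1\<close> whenever the current last element is refuted as a bound for row \<open>n\<close>, and \<open>\<Sigma>\<^sub>2\<close> collection
  makes every row stabilise. Compactness then yields \<open>M\<close>. The sets of the final model are those that are
  \<open>\<Delta>\<^sub>1\<close> in \<open>A\<close> and \<open>P\<close> over the cut.
\<close>

text \<open>The model at the start may satisfy Sigma_2 induction, so its failure has to be planted
  by a set parameter that makes the standard numbers Sigma_2-definable in the cut. Rows of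
  \<open>P\<close> with nonstandard index need never settle, and the standard ones are treated one
  after another in the metatheory; this is why Sigma_2 collection suffices and Sigma_2 induction is
  not called upon. As \<open>P\<close> changes with the finite part of the theory under
  consideration, only those statements can be carried over that hold in the first model for every
  set in the place of \<open>P\<close>. The other obstacle is the universal set quantifier. The cut
  acquires new Delta_1 sets \<open>Y\<close>, which need not come from sets of the first model or of
  its extension. Truth for all of them is again expressed by statements forall x exists y forall z
  about \<open>P\<close>, through the formula \<open>XI\<close>, which stays true when the two
  definitions of a set fail to be complementary. The extension itself keeps only bounded induction
  and bounded collection for \<open>P\<close> and \<open>A\<close>, besides the witness
  bounds.\<close>

abbreviation scons :: "'a \<Rightarrow> (nat \<Rightarrow> 'a) \<Rightarrow> nat \<Rightarrow> 'a" (infixr \<open>##\<close> 65) where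
  "x ## e \<equiv> case_nat x e"

section \<open>Substitution\<close>

lemma up_simps [simp]: "up \<sigma> 0 = Var 0" "up \<sigma> (Suc n) = sub_tm shift (\<sigma> n)"
  by (auto simp: up_def)

lemma upS_simps [simp]: "upS \<rho> 0 = 0" "upS \<rho> (Suc n) = Suc (\<rho> n)"
  by (auto simp: upS_def)

lemma sub_tm_sub_tm: "sub_tm \<sigma> (sub_tm \<tau> t) = sub_tm (\<lambda>n. sub_tm \<sigma> (\<tau> n)) t"
  by (induction t) auto

lemma sub_tm_Var [simp]: "sub_tm Var t = t"
  by (induction t) auto

lemma up_shift: "sub_tm (up \<sigma>) (sub_tm shift t) = sub_tm shift (sub_tm \<sigma> t)"
  by (simp add: sub_tm_sub_tm shift_def)

lemma up_comp: "(\<lambda>n. sub_tm (up \<sigma>) (up \<tau> n)) = up (\<lambda>n. sub_tm \<sigma> (\<tau> n))"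
proof
  fix n show "sub_tm (up \<sigma>) (up \<tau> n) = up (\<lambda>n. sub_tm \<sigma> (\<tau> n)) n"
    by (cases n) (auto simp: up_shift)
qed

lemma upS_comp: "upS \<rho> \<circ> upS \<pi> = upS (\<rho> \<circ> \<pi>)"
proof
  fix n show "(upS \<rho> \<circ> upS \<pi>) n = upS (\<rho> \<circ> \<pi>) n"
    by (cases n) auto
qed

lemma up_Var [simp]: "up Var = Var"
proof
  fix n show "up Var n = Var n" by (cases n) (auto simp: shift_def)
qed

lemma upS_id [simp]: "upS id = id" 
proof
  fix n show "upS id n = id n" by (cases n) auto
qed

lemma upS_ident [simp]: "upS (\<lambda>n. n) = (\<lambda>n. n)"
  using upS_id by (simp add: id_def)

lemma sub_sub: "sub \<sigma> \<rho> (sub \<tau> \<pi> \<phi>) = sub (\<lambda>n. sub_tm \<sigma> (\<tau> n)) (\<rho> \<circ> \<pi>) \<phi>"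
  by (induction \<phi> arbitrary: \<sigma> \<tau> \<rho> \<pi>) (auto simp: sub_tm_sub_tm up_comp upS_comp)

lemma sub_Var_id [simp]: "sub Var id \<phi> = \<phi>"
  by (induction \<phi>) auto

lemma sub_lift: "sub (up \<sigma>) \<rho> (lift \<phi>) = lift (sub \<sigma> \<rho> \<phi>)"
  unfolding lift_def sub_sub by (rule arg_cong2[where f="\<lambda>a b. sub a b \<phi>"]) (auto simp: shift_def fun_eq_iff)

lemma sub_liftS: "sub \<sigma> (upS \<rho>) (liftS \<phi>) = liftS (sub \<sigma> \<rho> \<phi>)"
  unfolding liftS_def sub_sub by (rule arg_cong2[where f="\<lambda>a b. sub a b \<phi>"]) auto

lemma sub_inst: "sub \<sigma> \<rho> (inst \<phi> t) = inst (sub (up \<sigma>) \<rho> \<phi>) (sub_tm \<sigma> t)"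
  unfolding inst_def sub_sub
  by (rule arg_cong2[where f="\<lambda>a b. sub a b \<phi>"])
    (auto simp: fun_eq_iff sub_tm_sub_tm shift_def split: nat.split)

lemma sub_instS: "sub \<sigma> \<rho> (instS \<phi> X) = instS (sub \<sigma> (upS \<rho>) \<phi>) (\<rho> X)"
  unfolding instS_def sub_sub
  by (rule arg_cong2[where f="\<lambda>a b. sub a b \<phi>"])
    (auto simp: fun_eq_iff split: nat.split)

lemma inst_sub: "inst (sub (up \<sigma>) \<rho> \<phi>) t = sub (t ## \<sigma>) \<rho> \<phi>"
  unfolding inst_def sub_sub
  by (rule arg_cong2[where f="\<lambda>a b. sub a b \<phi>"])
    (auto simp: fun_eq_iff sub_tm_sub_tm shift_def split: nat.split)

lemma instS_sub: "instS (sub \<sigma> (upS \<rho>) \<phi>) X = sub \<sigma> (X ## \<rho>) \<phi>"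
  unfolding instS_def sub_sub
  by (rule arg_cong2[where f="\<lambda>a b. sub a b \<phi>"])
    (auto simp: fun_eq_iff split: nat.split)

section \<open>Free variables\<close>

primrec fvt :: "tm \<Rightarrow> nat set" where
  "fvt (Var n) = {n}"
| "fvt Zero = {}"
| "fvt One = {}"
| "fvt (Add s t) = fvt s \<union> fvt t"
| "fvt (Mul s t) = fvt s \<union> fvt t"

primrec fvn :: "fm \<Rightarrow> nat set" where
  "fvn (Eq s t) = fvt s \<union> fvt t"
| "fvn (Less s t) = fvt s \<union> fvt t"
| "fvn (Mem t X) = fvt t"
| "fvn Fls = {}"
| "fvn (Imp \<phi> \<psi>) = fvn \<phi> \<union> fvn \<psi>"
| "fvn (All \<phi>) = Suc -` fvn \<phi>"
| "fvn (AllS \<phi>) = fvn \<phi>"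

primrec fvs :: "fm \<Rightarrow> nat set" where
  "fvs (Eq s t) = {}"
| "fvs (Less s t) = {}"
| "fvs (Mem t X) = {X}"
| "fvs Fls = {}"
| "fvs (Imp \<phi> \<psi>) = fvs \<phi> \<union> fvs \<psi>"
| "fvs (All \<phi>) = fvs \<phi>"
| "fvs (AllS \<phi>) = Suc -` fvs \<phi>"

lemma finite_fvt [simp]: "finite (fvt t)"
  by (induction t) auto

lemma finite_fvn [simp]: "finite (fvn \<phi>)"
  by (induction \<phi>) (auto intro: finite_vimageI)

lemma finite_fvs [simp]: "finite (fvs \<phi>)"
  by (induction \<phi>) (auto intro: finite_vimageI)

lemma fvt_tbound: "n \<in> fvt t \<Longrightarrow> n < tbound t"
  by (induction t) auto

lemma fvn_nbound: "n \<in> fvn \<phi> \<Longrightarrow> n < nbound \<phi>"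
  by (induction \<phi> arbitrary: n) (fastforce dest: fvt_tbound)+

lemma fvs_sbound: "X \<in> fvs \<phi> \<Longrightarrow> X < sbound \<phi>"
  by (induction \<phi> arbitrary: X) fastforce+

lemma sub_tm_cong: "(\<And>n. n \<in> fvt t \<Longrightarrow> \<sigma> n = \<tau> n) \<Longrightarrow> sub_tm \<sigma> t = sub_tm \<tau> t"
  by (induction t) auto

lemma sub_cong:
  "(\<And>n. n \<in> fvn \<phi> \<Longrightarrow> \<sigma> n = \<tau> n) \<Longrightarrow> (\<And>X. X \<in> fvs \<phi> \<Longrightarrow> \<rho> X = \<pi> X) \<Longrightarrow> sub \<sigma> \<rho> \<phi> = sub \<tau> \<pi> \<phi>"
proof (induction \<phi> arbitrary: \<sigma> \<tau> \<rho> \<pi>)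
  case (All \<phi>)
  have "up \<sigma> n = up \<tau> n" if "n \<in> fvn \<phi>" for n
    using that All.prems by (cases n) auto
  then show ?case using All.IH[of "up \<sigma>" "up \<tau>" \<rho> \<pi>] All.prems(2) by simp
next
  case (AllS \<phi>)
  have "upS \<rho> n = upS \<pi> n" if "n \<in> fvs \<phi>" for n
    using that AllS.prems by (cases n) auto
  then show ?case using AllS.IH[of \<sigma> \<tau> "upS \<rho>" "upS \<pi>"] AllS.prems(1) by simp
next
  case (Imp \<phi> \<psi>)
  have "sub \<sigma> \<rho> \<phi> = sub \<tau> \<pi> \<phi>" by (rule Imp.IH(1)) (use Imp.prems in auto)
  moreover have "sub \<sigma> \<rho> \<psi> = sub \<tau> \<pi> \<psi>" by (rule Imp.IH(2)) (use Imp.prems in auto)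
  ultimately show ?case by simp
next
  case (Eq s t) then show ?case using sub_tm_cong[of s \<sigma> \<tau>] sub_tm_cong[of t \<sigma> \<tau>] by auto
next
  case (Less s t) then show ?case using sub_tm_cong[of s \<sigma> \<tau>] sub_tm_cong[of t \<sigma> \<tau>] by auto
next
  case (Mem t X) then show ?case using sub_tm_cong[of t \<sigma> \<tau>] by auto
qed simp

lemma fvt_sub_tm: "fvt (sub_tm \<sigma> t) = (\<Union>n\<in>fvt t. fvt (\<sigma> n))"
  by (induction t) auto

lemma fvn_sub_Var: "fvn (sub (\<lambda>n. Var (f n)) \<rho> \<phi>) \<subseteq> f ` fvn \<phi>"
proof (induction \<phi> arbitrary: f \<rho>)
  case (All \<phi>)
  have *: "up (\<lambda>n. Var (f n)) = (\<lambda>n. Var ((0 ## (\<lambda>n. Suc (f n))) n))"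
    by (auto simp: up_def shift_def fun_eq_iff split: nat.split)
  have "m \<in> f ` (Suc -` fvn \<phi>)" if "Suc m \<in> fvn (sub (up (\<lambda>n. Var (f n))) \<rho> \<phi>)" for m
  proof -
    have "Suc m \<in> (0 ## (\<lambda>n. Suc (f n))) ` fvn \<phi>"
      using that All[of "0 ## (\<lambda>n. Suc (f n))" \<rho>] unfolding * by blast
    then obtain k where "k \<in> fvn \<phi>" "Suc m = (0 ## (\<lambda>n. Suc (f n))) k" by blast
    then show ?thesis by (cases k) auto
  qed
  then show ?case by auto
qed (auto simp: fvt_sub_tm, blast+)

lemma fvs_sub: "fvs (sub \<sigma> \<rho> \<phi>) \<subseteq> \<rho> ` fvs \<phi>"
proof (induction \<phi> arbitrary: \<sigma> \<rho>)
  case (AllS \<phi>)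
  have "m \<in> \<rho> ` (Suc -` fvs \<phi>)" if "Suc m \<in> fvs (sub \<sigma> (upS \<rho>) \<phi>)" for m
  proof -
    have "Suc m \<in> upS \<rho> ` fvs \<phi>" using that AllS by blast
    then obtain k where "k \<in> fvs \<phi>" "Suc m = upS \<rho> k" by blast
    then show ?thesis by (cases k) auto
  qed
  then show ?case by auto
qed (simp; blast)+

section \<open>Semantics\<close>

text \<open>The domain is a field and not the whole type because the final model is a cut in the
  carrier of another one. Number equality is identity, so a term model has to be built from classes
  of terms.\<close>

record 'm mdl =
  dom :: "'m set"
  sets :: "'m set set"
  zer :: 'm
  one :: 'm
  add :: "'m \<Rightarrow> 'm \<Rightarrow> 'm"
  mul :: "'m \<Rightarrow> 'm \<Rightarrow> 'm"
  lss :: "'m \<Rightarrow> 'm \<Rightarrow> bool"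

primrec val :: "'m mdl \<Rightarrow> (nat \<Rightarrow> 'm) \<Rightarrow> tm \<Rightarrow> 'm" where
  "val M e (Var n) = e n"
| "val M e Zero = zer M"
| "val M e One = one M"
| "val M e (Add s t) = add M (val M e s) (val M e t)"
| "val M e (Mul s t) = mul M (val M e s) (val M e t)"

primrec sat :: "'m mdl \<Rightarrow> (nat \<Rightarrow> 'm) \<Rightarrow> (nat \<Rightarrow> 'm set) \<Rightarrow> fm \<Rightarrow> bool" where
  "sat M e E (Eq s t) \<longleftrightarrow> val M e s = val M e t"
| "sat M e E (Less s t) \<longleftrightarrow> lss M (val M e s) (val M e t)"
| "sat M e E (Mem t X) \<longleftrightarrow> val M e t \<in> E X"
| "sat M e E Fls \<longleftrightarrow> False"
| "sat M e E (Imp \<phi> \<psi>) \<longleftrightarrow> (sat M e E \<phi> \<longrightarrow> sat M e E \<psi>)"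
| "sat M e E (All \<phi>) \<longleftrightarrow> (\<forall>x \<in> dom M. sat M (x ## e) E \<phi>)"
| "sat M e E (AllS \<phi>) \<longleftrightarrow> (\<forall>X \<in> sets M. sat M e (X ## E) \<phi>)"

definition wfm :: "'m mdl \<Rightarrow> bool" where
  "wfm M \<longleftrightarrow> zer M \<in> dom M \<and> one M \<in> dom M \<and>
    (\<forall>x\<in>dom M. \<forall>y\<in>dom M. add M x y \<in> dom M \<and> mul M x y \<in> dom M)"

lemma val_dom: "wfm M \<Longrightarrow> range e \<subseteq> dom M \<Longrightarrow> val M e t \<in> dom M"
  by (induction t) (auto simp: wfm_def)

lemma range_scons [simp]: "range (x ## e) \<subseteq> D \<longleftrightarrow> x \<in> D \<and> range e \<subseteq> D"
proof -
  have "(\<forall>n. (x ## e) n \<in> D) \<longleftrightarrow> x \<in> D \<and> (\<forall>n. e n \<in> D)"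
    by (metis not0_implies_Suc old.nat.simps(4) old.nat.simps(5))
  then show ?thesis by (auto simp: image_subset_iff)
qed

lemma val_sub_tm [simp]: "val M e (sub_tm \<sigma> t) = val M (\<lambda>n. val M e (\<sigma> n)) t"
  by (induction t) auto

lemma val_shift [simp]: "val M (x ## e) (shift n) = e n"
  by (simp add: shift_def)

lemma val_up: "(\<lambda>n. val M (x ## e) (up \<sigma> n)) = x ## (\<lambda>n. val M e (\<sigma> n))"
  by (auto simp: fun_eq_iff up_def split: nat.split)

lemma comp_upS: "(X ## E) \<circ> upS \<rho> = X ## (E \<circ> \<rho>)"
  by (auto simp: fun_eq_iff upS_def split: nat.split)

lemma sat_sub [simp]: "sat M e E (sub \<sigma> \<rho> \<phi>) \<longleftrightarrow> sat M (\<lambda>n. val M e (\<sigma> n)) (E \<circ> \<rho>) \<phi>"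
  by (induction \<phi> arbitrary: e E \<sigma> \<rho>) (auto simp: val_up comp_upS simp del: o_apply, auto)

lemma sat_lift [simp]: "sat M (x ## e) E (lift \<phi>) \<longleftrightarrow> sat M e E \<phi>"
  by (simp add: lift_def)

lemma sat_liftS [simp]: "sat M e (X ## E) (liftS \<phi>) \<longleftrightarrow> sat M e E \<phi>"
proof -
  have "(X ## E) \<circ> Suc = E" by auto
  then show ?thesis by (simp add: liftS_def)
qed

lemma sat_inst [simp]: "sat M e E (inst \<phi> t) \<longleftrightarrow> sat M (val M e t ## e) E \<phi>"
proof -
  have "(\<lambda>n. val M e ((t ## Var) n)) = val M e t ## e"
    by (auto simp: fun_eq_iff split: nat.split)
  then show ?thesis by (simp add: inst_def)
qed

lemma sat_instS [simp]: "sat M e E (instS \<phi> X) \<longleftrightarrow> sat M e (E X ## E) \<phi>"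
proof -
  have "E \<circ> (X ## id) = E X ## E"
    by (auto simp: fun_eq_iff split: nat.split)
  then show ?thesis by (simp add: instS_def)
qed

lemma val_cong: "(\<And>n. n \<in> fvt t \<Longrightarrow> e n = e' n) \<Longrightarrow> val M e t = val M e' t"
  by (induction t) auto

lemma sat_cong:
  "(\<And>n. n \<in> fvn \<phi> \<Longrightarrow> e n = e' n) \<Longrightarrow> (\<And>X. X \<in> fvs \<phi> \<Longrightarrow> E X = E' X)
    \<Longrightarrow> sat M e E \<phi> \<longleftrightarrow> sat M e' E' \<phi>"
proof (induction \<phi> arbitrary: e e' E E')
  case (Eq s t) then show ?case using val_cong[of s e e' M] val_cong[of t e e' M] by auto
next
  case (Less s t) then show ?case using val_cong[of s e e' M] val_cong[of t e e' M] by auto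
next
  case (Mem t X) then show ?case using val_cong[of t e e' M] by auto
next
  case (Imp \<phi> \<psi>) then show ?case
    by (metis UnCI fvn.simps(5) fvs.simps(5) sat.simps(5))
next
  case (All \<phi>)
  have "sat M (x ## e) E \<phi> \<longleftrightarrow> sat M (x ## e') E' \<phi>" for x
    by (rule All.IH) (use All.prems in \<open>auto split: nat.split\<close>)
  then show ?case by simp
next
  case (AllS \<phi>)
  have "sat M e (x ## E) \<phi> \<longleftrightarrow> sat M e' (x ## E') \<phi>" for x
    by (rule AllS.IH) (use AllS.prems in \<open>auto split: nat.split\<close>)
  then show ?case by simp
qed simp

theorem soundness:
  "\<Gamma> \<turnstile> \<phi> \<Longrightarrow> wfm M \<Longrightarrow> range e \<subseteq> dom M \<Longrightarrow> range E \<subseteq> sets M \<Longrightarrow>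
    \<forall>\<psi>\<in>\<Gamma>. sat M e E \<psi> \<Longrightarrow> sat M e E \<phi>"
proof (induction arbitrary: e E rule: proves.induct)
  case (Raa \<phi> \<Gamma>)
  then show ?case by (metis insert_iff sat.simps(4) sat.simps(5))
next
  case (AllI \<Gamma> \<phi>)
  then show ?case by simp
next
  case (AllE \<Gamma> \<phi> t)
  then show ?case by (simp add: val_dom)
next
  case (AllSI \<Gamma> \<phi>)
  then show ?case by simp
next
  case (AllSE \<Gamma> \<phi> X)
  then show ?case by (simp add: range_subsetD)
qed auto

section \<open>Completeness\<close>

lemma proves_mono: "\<Gamma> \<turnstile> \<phi> \<Longrightarrow> \<Gamma> \<subseteq> \<Delta> \<Longrightarrow> \<Delta> \<turnstile> \<phi>"
proof (induction arbitrary: \<Delta> rule: proves.induct)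
  case (ImpI \<phi> \<Gamma> \<psi>) then show ?case by (meson insert_mono proves.ImpI)
next
  case (Raa \<phi> \<Gamma>) then show ?case by (meson insert_mono proves.Raa)
next
  case (AllI \<Gamma> \<phi>) then show ?case by (meson image_mono proves.AllI)
next
  case (AllSI \<Gamma> \<phi>) then show ?case by (meson image_mono proves.AllSI)
next
  case (EqSubst \<Gamma> s t \<phi>) then show ?case by (meson proves.EqSubst)
qed (auto intro: proves.intros)

text \<open>Contexts are arbitrary, possibly infinite sets. The finite support of a derivation is
  what makes the union of a chain of consistent sets consistent.\<close>

lemma proves_finite: "\<Gamma> \<turnstile> \<phi> \<Longrightarrow> \<exists>\<Delta>. finite \<Delta> \<and> \<Delta> \<subseteq> \<Gamma> \<and> \<Delta> \<turnstile> \<phi>"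
proof (induction rule: proves.induct)
  case (Assm \<phi> \<Gamma>)
  then show ?case by (intro exI[of _ "{\<phi>}"]) (auto intro: proves.Assm)
next
  case (ImpI \<phi> \<Gamma> \<psi>)
  then obtain \<Delta> where "finite \<Delta>" "\<Delta> \<subseteq> insert \<phi> \<Gamma>" "\<Delta> \<turnstile> \<psi>" by blast
  moreover from this have "\<Delta> - {\<phi>} \<turnstile> Imp \<phi> \<psi>"
    by (intro proves.ImpI) (auto elim: proves_mono)
  ultimately show ?case by (intro exI[of _ "\<Delta> - {\<phi>}"]) auto
next
  case (ImpE \<Gamma> \<phi> \<psi>)
  then obtain \<Delta> \<Delta>' where "finite \<Delta>" "\<Delta> \<subseteq> \<Gamma>" "\<Delta> \<turnstile> Imp \<phi> \<psi>" "finite \<Delta>'" "\<Delta>' \<subseteq> \<Gamma>" "\<Delta>' \<turnstile> \<phi>" by blast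
  then show ?case
    by (intro exI[of _ "\<Delta> \<union> \<Delta>'"])
      (meson Un_least finite_Un proves.ImpE proves_mono sup_ge1 sup_ge2)
next
  case (Raa \<phi> \<Gamma>)
  then obtain \<Delta> where "finite \<Delta>" "\<Delta> \<subseteq> insert (Neg \<phi>) \<Gamma>" "\<Delta> \<turnstile> Fls" by blast
  moreover from this have "\<Delta> - {Neg \<phi>} \<turnstile> \<phi>"
    by (intro proves.Raa[of \<phi>]) (auto elim: proves_mono)
  ultimately show ?case by (intro exI[of _ "\<Delta> - {Neg \<phi>}"]) auto
next
  case (AllI \<Gamma> \<phi>)
  then obtain \<Delta> where \<Delta>: "finite \<Delta>" "\<Delta> \<subseteq> lift ` \<Gamma>" "\<Delta> \<turnstile> \<phi>" by blast
  then obtain \<Delta>' where "finite \<Delta>'" "\<Delta>' \<subseteq> \<Gamma>" "\<Delta> = lift ` \<Delta>'" by (meson finite_subset_image)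
  then show ?case using \<Delta> by (intro exI[of _ \<Delta>']) (auto intro: proves.AllI)
next
  case (AllSI \<Gamma> \<phi>)
  then obtain \<Delta> where \<Delta>: "finite \<Delta>" "\<Delta> \<subseteq> liftS ` \<Gamma>" "\<Delta> \<turnstile> \<phi>" by blast
  then obtain \<Delta>' where "finite \<Delta>'" "\<Delta>' \<subseteq> \<Gamma>" "\<Delta> = liftS ` \<Delta>'" by (meson finite_subset_image)
  then show ?case using \<Delta> by (intro exI[of _ \<Delta>']) (auto intro: proves.AllSI)
next
  case (EqRefl \<Gamma> t)
  then show ?case by (intro exI[of _ "{}"]) (auto intro: proves.EqRefl)
next
  case (EqSubst \<Gamma> s t \<phi>)
  then obtain \<Delta> \<Delta>' where "finite \<Delta>" "\<Delta> \<subseteq> \<Gamma>" "\<Delta> \<turnstile> Eq s t" "finite \<Delta>'" "\<Delta>' \<subseteq> \<Gamma>" "\<Delta>' \<turnstile> inst \<phi> s" by blast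
  then show ?case
    by (intro exI[of _ "\<Delta> \<union> \<Delta>'"])
      (meson Un_least finite_Un proves.EqSubst proves_mono sup_ge1 sup_ge2)
qed (auto intro: proves.intros)

lemma proves_sub: "\<Gamma> \<turnstile> \<phi> \<Longrightarrow> sub \<sigma> \<rho> ` \<Gamma> \<turnstile> sub \<sigma> \<rho> \<phi>"
proof (induction arbitrary: \<sigma> \<rho> rule: proves.induct)
  case (ImpE \<Gamma> \<phi> \<psi>)
  then show ?case unfolding sub.simps by (meson proves.ImpE)
next
  case (Raa \<phi> \<Gamma>)
  then show ?case using proves.Raa by fastforce
next
  case (AllI \<Gamma> \<phi>)
  have "sub (up \<sigma>) \<rho> ` lift ` \<Gamma> = lift ` sub \<sigma> \<rho> ` \<Gamma>"
    by (auto simp: image_image sub_lift)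
  then show ?case using AllI.IH[of "up \<sigma>" \<rho>] by (auto intro: proves.AllI)
next
  case (AllE \<Gamma> \<phi> t)
  then show ?case by (auto simp: sub_inst intro: proves.AllE)
next
  case (AllSI \<Gamma> \<phi>)
  have "sub \<sigma> (upS \<rho>) ` liftS ` \<Gamma> = liftS ` sub \<sigma> \<rho> ` \<Gamma>"
    by (auto simp: image_image sub_liftS)
  then show ?case using AllSI.IH[of \<sigma> "upS \<rho>"] by (auto intro: proves.AllSI)
next
  case (AllSE \<Gamma> \<phi> t)
  then show ?case by (auto simp: sub_instS intro: proves.AllSE)
next
  case (EqSubst \<Gamma> s t \<phi>)
  then show ?case unfolding sub_inst sub.simps by (meson proves.EqSubst)
qed (auto intro: proves.intros)

text \<open>The rule \<open>AllI\<close> shifts the whole context. The substitution that sends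
  \<open>v\<close> to index 0 and every other variable up by one acts as \<open>lift\<close> on a
  context without \<open>v\<close> and turns the instance at \<open>v\<close> back into the body, so
  the eigenvariable form follows from \<open>proves_sub\<close>.\<close>

lemma AllI_fresh:
  assumes "\<Gamma> \<turnstile> inst \<phi> (Var v)" "\<forall>\<psi>\<in>\<Gamma>. v \<notin> fvn \<psi>" "v \<notin> fvn (All \<phi>)"
  shows "\<Gamma> \<turnstile> All \<phi>"
proof -
  define \<sigma> where "\<sigma> n = (if n = v then Var 0 else Var (Suc n))" for n
  have "sub \<sigma> id \<psi> = lift \<psi>" if "\<psi> \<in> \<Gamma>" for \<psi>
    unfolding lift_def by (rule sub_cong) (use assms that in \<open>auto simp: \<sigma>_def shift_def\<close>)
  then have 1: "sub \<sigma> id ` \<Gamma> = lift ` \<Gamma>" by auto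
  have "sub \<sigma> id (inst \<phi> (Var v)) = sub (\<lambda>n. sub_tm \<sigma> ((Var v ## Var) n)) (id \<circ> id) \<phi>"
    unfolding inst_def sub_sub ..
  also have "\<dots> = sub Var id \<phi>"
    by (rule sub_cong) (use assms(3) in \<open>auto simp: \<sigma>_def split: nat.split\<close>)
  finally show ?thesis using proves_sub[OF assms(1), of \<sigma> id] 1 by (auto intro: AllI)
qed

lemma AllSI_fresh:
  assumes "\<Gamma> \<turnstile> instS \<phi> X" "\<forall>\<psi>\<in>\<Gamma>. X \<notin> fvs \<psi>" "X \<notin> fvs (AllS \<phi>)"
  shows "\<Gamma> \<turnstile> AllS \<phi>"
proof -
  define \<rho> where "\<rho> n = (if n = X then 0 else Suc n)" for n
  have "sub Var \<rho> \<psi> = liftS \<psi>" if "\<psi> \<in> \<Gamma>" for \<psi>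
    unfolding liftS_def by (rule sub_cong) (use assms that in \<open>auto simp: \<rho>_def\<close>)
  then have 1: "sub Var \<rho> ` \<Gamma> = liftS ` \<Gamma>" by auto
  have "sub Var \<rho> (instS \<phi> X) = sub (\<lambda>n. sub_tm Var (Var n)) (\<rho> \<circ> (X ## id)) \<phi>"
    unfolding instS_def sub_sub ..
  also have "\<dots> = sub Var id \<phi>"
    by (rule sub_cong) (use assms(3) in \<open>auto simp: \<rho>_def split: nat.split\<close>)
  finally show ?thesis using proves_sub[OF assms(1), of Var \<rho>] 1 by (auto intro: AllSI)
qed

section \<open>Maximal consistent sets with witnesses\<close>

instance tm :: countable by countable_datatype
instance fm :: countable by countable_datatype

definition roomy :: "fm set \<Rightarrow> bool" where
  "roomy \<Gamma> \<longleftrightarrow> infinite (- (\<Union>\<psi>\<in>\<Gamma>. fvn \<psi>)) \<and> infinite (- (\<Union>\<psi>\<in>\<Gamma>. fvs \<psi>))"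

lemma roomy_insert: "roomy \<Gamma> \<Longrightarrow> roomy (insert \<phi> \<Gamma>)"
proof -
  have "- (\<Union>\<psi>\<in>insert \<phi> \<Gamma>. fvn \<psi>) = - (\<Union>\<psi>\<in>\<Gamma>. fvn \<psi>) - fvn \<phi>"
    "- (\<Union>\<psi>\<in>insert \<phi> \<Gamma>. fvs \<psi>) = - (\<Union>\<psi>\<in>\<Gamma>. fvs \<psi>) - fvs \<phi>" by auto
  then show "roomy \<Gamma> \<Longrightarrow> roomy (insert \<phi> \<Gamma>)"
    unfolding roomy_def by (metis Diff_infinite_finite finite_fvn finite_fvs)
qed

lemma roomy_fresh:
  assumes "roomy \<Gamma>" shows "\<exists>v. (\<forall>\<psi>\<in>\<Gamma>. v \<notin> fvn \<psi>)" "\<exists>X. (\<forall>\<psi>\<in>\<Gamma>. X \<notin> fvs \<psi>)"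
  using assms unfolding roomy_def by (metis (no_types, lifting) ComplD UN_I all_not_in_conv finite.emptyI)+

lemma consistent_Neg:
  assumes "consistent \<Gamma>" "\<not> consistent (insert \<phi> \<Gamma>)"
  shows "\<Gamma> \<turnstile> Neg \<phi>" "consistent (insert (Neg \<phi>) \<Gamma>)"
proof -
  show *: "\<Gamma> \<turnstile> Neg \<phi>" using assms(2) unfolding consistent_def by (auto intro: ImpI)
  show "consistent (insert (Neg \<phi>) \<Gamma>)"
    using * assms(1) unfolding consistent_def by (meson ImpE Raa)
qed

text \<open>Completeness and the witness condition in one notion: a rejected universal formula must
  come with a variable that refutes it.\<close>

definition decides :: "fm set \<Rightarrow> fm \<Rightarrow> bool" where
  "decides \<Gamma> \<phi> \<longleftrightarrow> \<phi> \<in> \<Gamma> \<or> Neg \<phi> \<in> \<Gamma> \<and>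
    (\<forall>\<psi>. \<phi> = All \<psi> \<longrightarrow> (\<exists>v. Neg (inst \<psi> (Var v)) \<in> \<Gamma>)) \<and>
    (\<forall>\<psi>. \<phi> = AllS \<psi> \<longrightarrow> (\<exists>X. Neg (instS \<psi> X) \<in> \<Gamma>))"

lemma decides_mono: "decides \<Gamma> \<phi> \<Longrightarrow> \<Gamma> \<subseteq> \<Delta> \<Longrightarrow> decides \<Delta> \<phi>"
  unfolding decides_def by (metis in_mono)

lemma extend_deciding:
  assumes "consistent \<Gamma>" "roomy \<Gamma>"
  shows "\<exists>\<Delta>. \<Gamma> \<subseteq> \<Delta> \<and> consistent \<Delta> \<and> roomy \<Delta> \<and> decides \<Delta> \<phi>"
proof (cases "consistent (insert \<phi> \<Gamma>)")
  case True
  then show ?thesis using assms roomy_insert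
    by (intro exI[of _ "insert \<phi> \<Gamma>"]) (auto simp: decides_def)
next
  case False
  define \<Gamma>' where "\<Gamma>' = insert (Neg \<phi>) \<Gamma>"
  have \<Gamma>': "consistent \<Gamma>'" "roomy \<Gamma>'" "Neg \<phi> \<in> \<Gamma>'" "\<Gamma> \<subseteq> \<Gamma>'"
    using consistent_Neg[OF assms(1) False] roomy_insert[OF assms(2)] by (auto simp: \<Gamma>'_def)
  consider \<psi> where "\<phi> = All \<psi>" | \<psi> where "\<phi> = AllS \<psi>" | "\<forall>\<psi>. \<phi> \<noteq> All \<psi> \<and> \<phi> \<noteq> AllS \<psi>" by blast
  then show ?thesis
  proof cases
    case 1
    obtain v where v: "\<forall>\<chi>\<in>\<Gamma>'. v \<notin> fvn \<chi>" using roomy_fresh \<Gamma>' by blast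
    then have "v \<notin> fvn \<phi>" using \<Gamma>'(3) by fastforce
    \<comment> \<open>If the instance at the fresh \<open>v\<close> were provable, generalisation
      would prove \<open>\<phi>\<close> next to \<open>Neg \<phi>\<close>.\<close>
    then have "\<not> \<Gamma>' \<turnstile> inst \<psi> (Var v)"
      using AllI_fresh v 1 \<Gamma>' by (metis Assm ImpE consistent_def)
    then have "consistent (insert (Neg (inst \<psi> (Var v))) \<Gamma>')"
      unfolding consistent_def by (meson Raa)
    then show ?thesis using \<Gamma>' 1 roomy_insert
      by (intro exI[of _ "insert (Neg (inst \<psi> (Var v))) \<Gamma>'"]) (auto simp: decides_def)
  next
    case 2
    obtain v where v: "\<forall>\<chi>\<in>\<Gamma>'. v \<notin> fvs \<chi>" using roomy_fresh \<Gamma>' by blast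
    then have "v \<notin> fvs \<phi>" using \<Gamma>'(3) by fastforce
    then have "\<not> \<Gamma>' \<turnstile> instS \<psi> v"
      using AllSI_fresh v 2 \<Gamma>' by (metis Assm ImpE consistent_def)
    then have "consistent (insert (Neg (instS \<psi> v)) \<Gamma>')"
      unfolding consistent_def by (meson Raa)
    then show ?thesis using \<Gamma>' 2 roomy_insert
      by (intro exI[of _ "insert (Neg (instS \<psi> v)) \<Gamma>'"]) (auto simp: decides_def)
  next
    case 3
    then show ?thesis using \<Gamma>' by (intro exI[of _ \<Gamma>']) (auto simp: decides_def)
  qed
qed

lemma consistent_chain:
  assumes "\<And>n. consistent (f n)" "\<And>n. f n \<subseteq> f (Suc n)"
  shows "consistent (\<Union>n :: nat. f n)"
  unfolding consistent_def
proof
  have mono: "f m \<subseteq> f n" if "m \<le> n" for m n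
    using that assms(2) lift_Suc_mono_le[of f] by (simp add: mono_def)
  assume "(\<Union>n. f n) \<turnstile> Fls"
  then obtain \<Delta> where \<Delta>: "finite \<Delta>" "\<Delta> \<subseteq> (\<Union>n. f n)" "\<Delta> \<turnstile> Fls" using proves_finite by blast
  have "\<exists>n. \<Delta> \<subseteq> f n" using \<Delta>(1,2)
  proof (induction \<Delta> rule: finite_induct)
    case (insert x F)
    then obtain n m where "F \<subseteq> f n" "x \<in> f m" by auto
    then have "insert x F \<subseteq> f (max n m)" using mono[of n "max n m"] mono[of m "max n m"] by auto
    then show ?case by blast
  qed simp
  then show False using \<Delta>(3) assms(1) proves_mono unfolding consistent_def by blast
qed

lemma henkin_extension:
  assumes "consistent \<Gamma>" "roomy \<Gamma>"
  shows "\<exists>H. \<Gamma> \<subseteq> H \<and> consistent H \<and> (\<forall>\<phi>. decides H \<phi>)"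
proof -
  define P where "P \<Delta> \<longleftrightarrow> consistent \<Delta> \<and> roomy \<Delta>" for \<Delta>
  have "\<exists>f. \<forall>n. (P (f n) \<and> (n = 0 \<longrightarrow> f n = \<Gamma>)) \<and>
      (f n \<subseteq> f (Suc n) \<and> decides (f (Suc n)) (from_nat n))"
  proof (rule dependent_nat_choice)
    show "\<exists>x. P x \<and> (0 = (0::nat) \<longrightarrow> x = \<Gamma>)" using assms by (auto simp: P_def)
  next
    fix x and n :: nat assume "P x \<and> (n = 0 \<longrightarrow> x = \<Gamma>)"
    then show "\<exists>y. (P y \<and> (Suc n = 0 \<longrightarrow> y = \<Gamma>)) \<and> x \<subseteq> y \<and> decides y (from_nat n)"
      using extend_deciding[of x] by (auto simp: P_def)
  qed
  then obtain f where f: "\<And>n. P (f n)" "f 0 = \<Gamma>" "\<And>n. f n \<subseteq> f (Suc n)" "\<And>n. decides (f (Suc n)) (from_nat n)"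
    by blast
  define H where "H = (\<Union>n. f n)"
  have "consistent H"
    unfolding H_def using f(1,3) by (intro consistent_chain) (auto simp: P_def)
  moreover have "decides H \<phi>" for \<phi>
  proof -
    have "decides (f (Suc (to_nat \<phi>))) \<phi>" using f(4)[of "to_nat \<phi>"] by simp
    then show ?thesis by (rule decides_mono) (auto simp: H_def)
  qed
  moreover have "\<Gamma> \<subseteq> H" using f(2) by (auto simp: H_def)
  ultimately show ?thesis by blast
qed

text \<open>These two axioms make the numerals pairwise distinct, so the term model is infinite and
  can be renumbered to have all of \<open>nat\<close> as its domain.\<close>

definition succ_axioms :: "fm set" where
  "succ_axioms = {All (Neg (Eq (Add (Var 0) One) Zero)),
     All (All (Imp (Eq (Add (Var 0) One) (Add (Var 1) One)) (Eq (Var 0) (Var 1))))}"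

section \<open>The term model of a complete theory with witnesses\<close>

locale henkin =
  fixes H :: "fm set"
  assumes cons: "consistent H" and dec: "decides H \<phi>" and succ: "succ_axioms \<subseteq> H"
begin

lemma closed: "H \<turnstile> \<phi> \<Longrightarrow> \<phi> \<in> H"
  using dec[of \<phi>] cons unfolding decides_def consistent_def by (meson Assm ImpE)

lemma in_iff: "\<phi> \<in> H \<longleftrightarrow> H \<turnstile> \<phi>"
  using closed Assm by blast

lemma Fls_notin: "Fls \<notin> H"
  using cons by (simp add: consistent_def in_iff)

lemma Neg_in: "Neg \<phi> \<in> H \<longleftrightarrow> \<phi> \<notin> H"
  using dec[of \<phi>] cons unfolding decides_def consistent_def by (meson Assm ImpE)

lemma Imp_in: "Imp \<phi> \<psi> \<in> H \<longleftrightarrow> (\<phi> \<in> H \<longrightarrow> \<psi> \<in> H)"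
proof -
  have "H \<turnstile> Imp \<phi> \<psi>" if "\<psi> \<in> H" using that by (auto intro: ImpI Assm)
  moreover have "H \<turnstile> Imp \<phi> \<psi>" if "\<phi> \<notin> H"
  proof -
    have "insert (Neg \<psi>) (insert \<phi> H) \<turnstile> Fls"
      using that Neg_in[of \<phi>] by (intro ImpE[of _ \<phi> Fls] Assm) auto
    then show ?thesis using ImpI Raa by blast
  qed
  ultimately show ?thesis unfolding in_iff by (meson ImpE closed)
qed

lemma All_in: "All \<phi> \<in> H \<longleftrightarrow> (\<forall>t. inst \<phi> t \<in> H)"
proof
  show "All \<phi> \<in> H \<Longrightarrow> \<forall>t. inst \<phi> t \<in> H" using AllE by (simp add: in_iff)
  show "\<forall>t. inst \<phi> t \<in> H \<Longrightarrow> All \<phi> \<in> H"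
    using dec[of "All \<phi>"] Neg_in unfolding decides_def by blast
qed

lemma AllS_in: "AllS \<phi> \<in> H \<longleftrightarrow> (\<forall>X. instS \<phi> X \<in> H)"
proof
  show "AllS \<phi> \<in> H \<Longrightarrow> \<forall>t. instS \<phi> t \<in> H" using AllSE by (simp add: in_iff)
  show "\<forall>t. instS \<phi> t \<in> H \<Longrightarrow> AllS \<phi> \<in> H"
    using dec[of "AllS \<phi>"] Neg_in unfolding decides_def by blast
qed

definition eqv :: "tm \<Rightarrow> tm \<Rightarrow> bool" where "eqv s t \<longleftrightarrow> Eq s t \<in> H"

lemma eqv_refl [simp]: "eqv t t"
  unfolding eqv_def in_iff by (rule EqRefl)

lemma eqv_subst: "eqv s t \<Longrightarrow> inst \<phi> s \<in> H \<Longrightarrow> inst \<phi> t \<in> H"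
  unfolding eqv_def in_iff by (rule EqSubst)

lemma inst_weak: "sub_tm (s ## Var) (sub_tm shift t) = t"
  by (simp add: sub_tm_sub_tm shift_def)

lemma eqv_sym: "eqv s t \<Longrightarrow> eqv t s"
  using eqv_subst[of s t "Eq (Var 0) (sub_tm shift s)"] eqv_refl[of s, unfolded eqv_def]
  by (simp add: inst_def inst_weak eqv_def)

lemma eqv_trans: "eqv s t \<Longrightarrow> eqv t u \<Longrightarrow> eqv s u"
  using eqv_subst[of t u "Eq (sub_tm shift s) (Var 0)"]
  by (simp add: inst_def inst_weak eqv_def)

lemma eqv_Add: "eqv s s' \<Longrightarrow> eqv t t' \<Longrightarrow> eqv (Add s t) (Add s' t')"
  using eqv_subst[of s s' "Eq (sub_tm shift (Add s t)) (Add (Var 0) (sub_tm shift t))"]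
    eqv_subst[of t t' "Eq (sub_tm shift (Add s t)) (Add (sub_tm shift s') (Var 0))"]
    eqv_refl[of "Add s t", unfolded eqv_def]
  by (simp add: inst_def inst_weak eqv_def)

lemma eqv_Mul: "eqv s s' \<Longrightarrow> eqv t t' \<Longrightarrow> eqv (Mul s t) (Mul s' t')"
  using eqv_subst[of s s' "Eq (sub_tm shift (Mul s t)) (Mul (Var 0) (sub_tm shift t))"]
    eqv_subst[of t t' "Eq (sub_tm shift (Mul s t)) (Mul (sub_tm shift s') (Var 0))"]
    eqv_refl[of "Mul s t", unfolded eqv_def]
  by (simp add: inst_def inst_weak eqv_def)

lemma eqv_Less: "eqv s s' \<Longrightarrow> eqv t t' \<Longrightarrow> Less s t \<in> H \<Longrightarrow> Less s' t' \<in> H"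
  using eqv_subst[of s s' "Less (Var 0) (sub_tm shift t)"]
    eqv_subst[of t t' "Less (sub_tm shift s') (Var 0)"]
  by (simp add: inst_def inst_weak)

lemma eqv_Mem: "eqv s s' \<Longrightarrow> Mem s X \<in> H \<Longrightarrow> Mem s' X \<in> H"
  using eqv_subst[of s s' "Mem (Var 0) X"] by (simp add: inst_def)

lemma eqv_succ_zero: "\<not> eqv (Add t One) Zero"
proof -
  have "All (Neg (Eq (Add (Var 0) One) Zero)) \<in> H" using succ by (simp add: succ_axioms_def)
  then show ?thesis by (auto simp: All_in Imp_in Fls_notin inst_def eqv_def)
qed

lemma eqv_succ_inj: "eqv (Add s One) (Add t One) \<Longrightarrow> eqv s t"
proof -
  let ?\<phi> = "Imp (Eq (Add (Var 0) One) (Add (Var 1) One)) (Eq (Var 0) (Var 1))"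
  have "All (All ?\<phi>) \<in> H" using succ by (simp add: succ_axioms_def)
  then have "inst (sub (up (t ## Var)) id ?\<phi>) s \<in> H"
    unfolding All_in[of "All ?\<phi>"] by (metis All_in inst_def sub.simps(6))
  then show "eqv (Add s One) (Add t One) \<Longrightarrow> eqv s t"
    unfolding inst_sub by (simp add: Imp_in eqv_def)
qed

lemma infinite_classes: "infinite (UNIV // {(s, t). eqv s t})"
proof
  let ?R = "{(s, t). eqv s t}"
  assume fin: "finite (UNIV // ?R)"
  have R: "equiv UNIV ?R"
    by (auto simp: equiv_def refl_on_def sym_def trans_def intro: eqv_sym eqv_trans)
  define S where "S n = ((\<lambda>t. Add t One) ^^ n) Zero" for n
  have "\<not> eqv (S m) (S n)" if "m < n" for m n
    using that
  proof (induction m arbitrary: n)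
    case 0
    then obtain k where "n = Suc k" using less_imp_Suc_add by blast
    then show ?case using eqv_succ_zero eqv_sym by (auto simp: S_def)
  next
    case (Suc m)
    then obtain k where "n = Suc k" "m < k" using Suc_lessE by blast
    then show ?case using Suc.IH[of k] eqv_succ_inj by (auto simp: S_def)
  qed
  then have "inj (\<lambda>n. ?R `` {S n})"
    unfolding inj_def using eq_equiv_class_iff[OF R] by (metis UNIV_I case_prodD eqv_sym linorder_less_linear mem_Collect_eq)
  moreover have "range (\<lambda>n. ?R `` {S n}) \<subseteq> UNIV // ?R" by (auto simp: quotient_def)
  ultimately show False using fin by (meson finite_subset infinite_UNIV_nat range_inj_infinite)
qed

text \<open>The classes of terms form a countably infinite set. A numbering onto \<open>nat\<close>
  gives a model with \<open>dom = UNIV\<close>, which spares domain conditions in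
  \<open>arith\<close> and \<open>base\<close>.\<close>

lemma ex_numbering: "\<exists>k :: tm \<Rightarrow> nat. surj k \<and> (\<forall>s t. k s = k t \<longleftrightarrow> eqv s t)"
proof -
  let ?R = "{(s, t). eqv s t}"
  have R: "equiv UNIV ?R"
    by (auto simp: equiv_def refl_on_def sym_def trans_def intro: eqv_sym eqv_trans)
  have "UNIV // ?R = range (\<lambda>t. ?R `` {t})" by (auto simp: quotient_def)
  then have "countable (UNIV // ?R)" by simp
  then have b: "bij_betw (to_nat_on (UNIV // ?R)) (UNIV // ?R) UNIV"
    using infinite_classes by (rule to_nat_on_infinite)
  define k where "k t = to_nat_on (UNIV // ?R) (?R `` {t})" for t
  have "surj k"
    unfolding surj_def
  proof
    fix n obtain c where "c \<in> UNIV // ?R" "n = to_nat_on (UNIV // ?R) c"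
      using b unfolding bij_betw_def by blast
    then show "\<exists>x. n = k x" unfolding k_def by (metis quotientE)
  qed
  moreover have "k s = k t \<longleftrightarrow> eqv s t" for s t
  proof -
    have "k s = k t \<longleftrightarrow> ?R `` {s} = ?R `` {t}"
      unfolding k_def using b by (metis UNIV_I bij_betw_imp_inj_on inj_on_eq_iff quotientI)
    then show ?thesis using eq_equiv_class_iff[OF R] by auto
  qed
  ultimately show ?thesis by blast
qed

lemma ex_model:
  "\<exists>M :: nat mdl. \<exists>e E. dom M = UNIV \<and> range E \<subseteq> sets M \<and> (\<forall>\<phi>. sat M e E \<phi> \<longleftrightarrow> \<phi> \<in> H)"
proof -
  obtain k :: "tm \<Rightarrow> nat" where k: "surj k" "\<And>s t. k s = k t \<longleftrightarrow> eqv s t" using ex_numbering by blast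
  define g where "g = inv k"
  have kg: "k (g n) = n" for n using k(1) by (simp add: g_def surj_f_inv_f)
  have gk: "eqv (g (k t)) t" for t using k(2) kg by blast
  define ext where "ext X = {n. Mem (g n) X \<in> H}" for X
  define M where "M = \<lparr>dom = UNIV, sets = range ext, zer = k Zero, one = k One,
    add = (\<lambda>m n. k (Add (g m) (g n))), mul = (\<lambda>m n. k (Mul (g m) (g n))),
    lss = (\<lambda>m n. Less (g m) (g n) \<in> H)\<rparr>"
  have M: "dom M = UNIV" "sets M = range ext" "lss M m n \<longleftrightarrow> Less (g m) (g n) \<in> H" for m n
    by (auto simp: M_def)
  have val: "val M (\<lambda>n. k (\<sigma> n)) t = k (sub_tm \<sigma> t)" for \<sigma> t
    by (induction t) (auto simp: M_def k gk intro: eqv_Add eqv_Mul)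
  have lss: "lss M (k s) (k t) \<longleftrightarrow> Less s t \<in> H" for s t
    using eqv_Less gk eqv_sym unfolding M by blast
  have mem: "k t \<in> ext X \<longleftrightarrow> Mem t X \<in> H" for t X
    using eqv_Mem gk eqv_sym unfolding ext_def by blast
  have cl: "(\<forall>t. inst \<psi> t \<in> H) \<longleftrightarrow> (\<forall>m. inst \<psi> (g m) \<in> H)" for \<psi>
    using gk eqv_subst by blast
  \<comment> \<open>The truth lemma is proved for all substitution instances at once, because each
    quantifier extends the substitution by the chosen instance.\<close>
  have "sat M (\<lambda>n. k (\<sigma> n)) (\<lambda>X. ext (\<rho> X)) \<phi> \<longleftrightarrow> sub \<sigma> \<rho> \<phi> \<in> H" for \<sigma> \<rho> \<phi>
  proof (induction \<phi> arbitrary: \<sigma> \<rho>)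
    case (All \<phi>)
    have "m ## (\<lambda>n. k (\<sigma> n)) = (\<lambda>n. k ((g m ## \<sigma>) n))" for m
      by (auto simp: fun_eq_iff kg split: nat.split)
    then show ?case using cl[of "sub (up \<sigma>) \<rho> \<phi>"] by (simp add: All M All_in inst_sub)
  next
    case (AllS \<phi>)
    have "ext X ## (\<lambda>n. ext (\<rho> n)) = (\<lambda>n. ext ((X ## \<rho>) n))" for X
      by (auto simp: fun_eq_iff split: nat.split)
    then show ?case by (simp add: AllS M AllS_in instS_sub)
  qed (auto simp: val lss mem k eqv_def Imp_in Fls_notin)
  from this[of Var id] have "sat M (\<lambda>n. k (Var n)) ext \<phi> \<longleftrightarrow> \<phi> \<in> H" for \<phi> by simp
  then show ?thesis using M by (intro exI[of _ M] exI[of _ "\<lambda>n. k (Var n)"] exI[of _ ext]) auto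
qed

end

theorem model_existence:
  assumes "consistent \<Gamma>" "succ_axioms \<subseteq> \<Gamma>"
  shows "\<exists>M :: nat mdl. \<exists>e E. dom M = UNIV \<and> range E \<subseteq> sets M \<and> (\<forall>\<phi>\<in>\<Gamma>. sat M e E \<phi>)"
proof -
  \<comment> \<open>\<open>\<Gamma>\<close> may mention every variable. Doubling the indices frees
    the odd ones for witnesses and is undone by halving.\<close>
  let ?s = "sub (\<lambda>n. Var (2 * n)) (\<lambda>n. 2 * n)"
  have inv: "sub (\<lambda>n. Var (n div 2)) (\<lambda>n. n div 2) (?s \<phi>) = \<phi>" for \<phi>
    unfolding sub_sub by (simp add: o_def flip: id_def)
  have "consistent (?s ` \<Gamma>)"
    unfolding consistent_def
  proof
    assume "?s ` \<Gamma> \<turnstile> Fls"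
    from proves_sub[OF this, of "\<lambda>n. Var (n div 2)" "\<lambda>n. n div 2"] show False
      using assms(1) by (simp add: image_image inv consistent_def)
  qed
  moreover have "roomy (?s ` \<Gamma>)"
  proof -
    have inf: "infinite (- S)" if "S \<subseteq> range (\<lambda>n::nat. 2 * n)" for S
    proof -
      have "2 * n + 1 \<notin> range (\<lambda>n::nat. 2 * n)" for n by (auto, presburger)
      then have "range (\<lambda>n::nat. 2 * n + 1) \<subseteq> - S" using that by blast
      moreover have "infinite (range (\<lambda>n::nat. 2 * n + 1))"
        by (rule range_inj_infinite) (auto simp: inj_def)
      ultimately show ?thesis using finite_subset by blast
    qed
    show ?thesis unfolding roomy_def
      using fvn_sub_Var[of "\<lambda>n. 2 * n"] fvs_sub[of _ "\<lambda>n. 2 * n"] by (intro conjI inf) blast+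
  qed
  ultimately obtain H where H: "?s ` \<Gamma> \<subseteq> H" "consistent H" "\<And>\<phi>. decides H \<phi>"
    using henkin_extension by blast
  have "?s \<phi> = \<phi>" if "\<phi> \<in> succ_axioms" for \<phi>
    using that by (auto simp: succ_axioms_def shift_def up_def)
  then have "succ_axioms \<subseteq> H" using H(1) assms(2) by (metis image_subset_iff subsetD subsetI)
  then interpret henkin H using H by unfold_locales auto
  obtain M :: "nat mdl" and e E where M: "dom M = UNIV" "range E \<subseteq> sets M" "\<And>\<phi>. sat M e E \<phi> \<longleftrightarrow> \<phi> \<in> H"
    using ex_model by blast
  have "sat M (\<lambda>n. e (2 * n)) (E \<circ> (\<lambda>n. 2 * n)) \<phi>" if "\<phi> \<in> \<Gamma>" for \<phi>
  proof -
    have "sat M e E (?s \<phi>)" using that H(1) M(3) by blast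
    then show ?thesis by simp
  qed
  moreover have "range (E \<circ> (\<lambda>n. 2 * n)) \<subseteq> sets M" using M(2) by auto
  ultimately show ?thesis using M(1) by blast
qed

section \<open>Bounded formulas\<close>

abbreviation ren :: "(nat \<Rightarrow> nat) \<Rightarrow> fm \<Rightarrow> fm" where
  "ren f \<equiv> sub (\<lambda>n. Var (f n)) id"

lemma bounded_And: "bounded \<phi> \<Longrightarrow> bounded \<psi> \<Longrightarrow> bounded (And \<phi> \<psi>)"
  by (intro bounded.intros)

lemma bounded_Or: "bounded \<phi> \<Longrightarrow> bounded \<psi> \<Longrightarrow> bounded (Or \<phi> \<psi>)"
  by (intro bounded.intros)

lemmas bounded_rules = bounded.intros bounded_And bounded_Or

lemma bounded_sub: "bounded \<phi> \<Longrightarrow> bounded (sub \<sigma> \<rho> \<phi>)"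
proof (induction arbitrary: \<sigma> \<rho> rule: bounded.induct)
  case (6 \<phi> t)
  then show ?case using bounded.intros(6)[of "sub (up \<sigma>) \<rho> \<phi>" "sub_tm \<sigma> t"] by (simp add: up_shift)
next
  case (7 \<phi> t)
  then show ?case using bounded.intros(7)[of "sub (up \<sigma>) \<rho> \<phi>" "sub_tm \<sigma> t"] by (simp add: up_shift)
qed (auto intro: bounded.intros)

text \<open>\<open>tr\<close> does not enter set quantifiers; its correctness is stated for formulas
  without them.\<close>

primrec set_free :: "fm \<Rightarrow> bool" where
  "set_free (Eq s t) = True"
| "set_free (Less s t) = True"
| "set_free (Mem t X) = True"
| "set_free Fls = True"
| "set_free (Imp \<phi> \<psi>) = (set_free \<phi> \<and> set_free \<psi>)"
| "set_free (All \<phi>) = set_free \<phi>"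
| "set_free (AllS \<phi>) = False"

lemma bounded_set_free: "bounded \<phi> \<Longrightarrow> set_free \<phi>"
  by (induction rule: bounded.induct) auto

text \<open>Replaces each atom \<open>t \<in> X\<close> by \<open>\<delta> X\<close> at \<open>t\<close>; the depth \<open>d\<close> counts the quantifiers passed.\<close>

primrec tr :: "nat \<Rightarrow> (nat \<Rightarrow> fm) \<Rightarrow> fm \<Rightarrow> fm" where
  "tr d \<delta> (Eq s t) = Eq s t"
| "tr d \<delta> (Less s t) = Less s t"
| "tr d \<delta> (Mem t X) = sub (t ## (\<lambda>n. Var (n + d))) id (\<delta> X)"
| "tr d \<delta> Fls = Fls"
| "tr d \<delta> (Imp \<phi> \<psi>) = Imp (tr d \<delta> \<phi>) (tr d \<delta> \<psi>)"
| "tr d \<delta> (All \<phi>) = All (tr (Suc d) \<delta> \<phi>)"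
| "tr d \<delta> (AllS \<phi>) = AllS \<phi>"

lemma bounded_tr: "bounded \<phi> \<Longrightarrow> (\<And>X. bounded (\<delta> X)) \<Longrightarrow> bounded (tr d \<delta> \<phi>)"
proof (induction arbitrary: d rule: bounded.induct)
  case (3 t X) then show ?case by (auto intro: bounded_sub)
qed (auto intro: bounded.intros)

lemma sat_tr:
  "set_free \<phi> \<Longrightarrow> sat M e E (tr d \<delta> \<phi>) \<longleftrightarrow>
    sat M e (\<lambda>X. {v. sat M (v ## (\<lambda>n. e (n + d))) E (\<delta> X)}) \<phi>"
proof (induction \<phi> arbitrary: d e)
  case (Mem t X)
  have "(\<lambda>n. val M e ((t ## (\<lambda>n. Var (n + d))) n)) = val M e t ## (\<lambda>n. e (n + d))"
    by (auto simp: fun_eq_iff split: nat.split)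
  then show ?case by simp
qed auto

section \<open>Quantifier blocks and universal closures\<close>

lemma sat_All_pow:
  assumes "range e \<subseteq> dom M"
  shows "sat M e E ((All ^^ k) \<phi>) \<longleftrightarrow>
    (\<forall>e'. range e' \<subseteq> dom M \<longrightarrow> (\<forall>n. e' (n + k) = e n) \<longrightarrow> sat M e' E \<phi>)"
  using assms
proof (induction k arbitrary: e \<phi>)
  case 0
  have "e' = e" if "\<forall>n. e' n = e n" for e' :: "nat \<Rightarrow> 'a" using that by auto
  then show ?case using 0 by auto
next
  case (Suc k)
  have "sat M e E ((All ^^ Suc k) \<phi>) \<longleftrightarrow> (\<forall>x\<in>dom M. sat M (x ## e) E ((All ^^ k) \<phi>))" by simp
  also have "\<dots> \<longleftrightarrow> (\<forall>x\<in>dom M. \<forall>e'. range e' \<subseteq> dom M \<longrightarrow> (\<forall>n. e' (n + k) = (x ## e) n) \<longrightarrow> sat M e' E \<phi>)"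
    using Suc by simp
  also have "\<dots> \<longleftrightarrow> (\<forall>e'. range e' \<subseteq> dom M \<longrightarrow> (\<forall>n. e' (n + Suc k) = e n) \<longrightarrow> sat M e' E \<phi>)"
  proof safe
    fix e' assume *: "\<forall>x\<in>dom M. \<forall>e'. range e' \<subseteq> dom M \<longrightarrow> (\<forall>n. e' (n + k) = (x ## e) n) \<longrightarrow> sat M e' E \<phi>"
      "range e' \<subseteq> dom M" "\<forall>n. e' (n + Suc k) = e n"
    have "e' (n + k) = (e' k ## e) n" for n using *(3) by (cases n) auto
    then show "sat M e' E \<phi>" using *(1,2) by blast
  next
    fix x e' assume *: "\<forall>e'. range e' \<subseteq> dom M \<longrightarrow> (\<forall>n. e' (n + Suc k) = e n) \<longrightarrow> sat M e' E \<phi>"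
      "range e' \<subseteq> dom M" "\<forall>n. e' (n + k) = (x ## e) n"
    have "e' (n + Suc k) = e n" for n using *(3)[rule_format, of "Suc n"] by simp
    then show "sat M e' E \<phi>" using *(1,2) by blast
  qed
  finally show ?case .
qed

lemma sat_AllS_pow:
  assumes "range E \<subseteq> sets M"
  shows "sat M e E ((AllS ^^ k) \<phi>) \<longleftrightarrow>
    (\<forall>E'. range E' \<subseteq> sets M \<longrightarrow> (\<forall>n. E' (n + k) = E n) \<longrightarrow> sat M e E' \<phi>)"
  using assms
proof (induction k arbitrary: E \<phi>)
  case 0
  have "E' = E" if "\<forall>n. E' n = E n" for E' :: "nat \<Rightarrow> 'a set" using that by auto
  then show ?case using 0 by auto
next
  case (Suc k)
  have "sat M e E ((AllS ^^ Suc k) \<phi>) \<longleftrightarrow> (\<forall>x\<in>sets M. sat M e (x ## E) ((AllS ^^ k) \<phi>))" by simp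
  also have "\<dots> \<longleftrightarrow> (\<forall>x\<in>sets M. \<forall>E'. range E' \<subseteq> sets M \<longrightarrow> (\<forall>n. E' (n + k) = (x ## E) n) \<longrightarrow> sat M e E' \<phi>)"
    using Suc by simp
  also have "\<dots> \<longleftrightarrow> (\<forall>E'. range E' \<subseteq> sets M \<longrightarrow> (\<forall>n. E' (n + Suc k) = E n) \<longrightarrow> sat M e E' \<phi>)"
  proof safe
    fix E' assume *: "\<forall>x\<in>sets M. \<forall>E'. range E' \<subseteq> sets M \<longrightarrow> (\<forall>n. E' (n + k) = (x ## E) n) \<longrightarrow> sat M e E' \<phi>"
      "range E' \<subseteq> sets M" "\<forall>n. E' (n + Suc k) = E n"
    have "E' (n + k) = (E' k ## E) n" for n using *(3) by (cases n) auto
    then show "sat M e E' \<phi>" using *(1,2) by blast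
  next
    fix x E' assume *: "\<forall>E'. range E' \<subseteq> sets M \<longrightarrow> (\<forall>n. E' (n + Suc k) = E n) \<longrightarrow> sat M e E' \<phi>"
      "range E' \<subseteq> sets M" "\<forall>n. E' (n + k) = (x ## E) n"
    have "E' (n + Suc k) = E n" for n using *(3)[rule_format, of "Suc n"] by simp
    then show "sat M e E' \<phi>" using *(1,2) by blast
  qed
  finally show ?case .
qed

lemma sat_univ_closure:
  fixes M :: "'a mdl"
  assumes "range e \<subseteq> dom M" "range E \<subseteq> sets M"
  shows "sat M e E (univ_closure \<phi>) \<longleftrightarrow>
    (\<forall>e' E'. range e' \<subseteq> dom M \<longrightarrow> range E' \<subseteq> sets M \<longrightarrow> sat M e' E' \<phi>)"
proof
  assume L: "sat M e E (univ_closure \<phi>)"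
  show "\<forall>e' E'. range e' \<subseteq> dom M \<longrightarrow> range E' \<subseteq> sets M \<longrightarrow> sat M e' E' \<phi>"
  proof (intro allI impI)
    fix e' :: "nat \<Rightarrow> 'a" and E' :: "nat \<Rightarrow> 'a set"
    assume *: "range e' \<subseteq> dom M" "range E' \<subseteq> sets M"
    \<comment> \<open>The closure quantifies only the first \<open>nbound \<phi>\<close> entries, so
      \<open>e'\<close> is cut off there and continued by the shifted \<open>e\<close>;
      \<open>\<phi>\<close> does not see the difference.\<close>
    let ?e = "\<lambda>n. if n < nbound \<phi> then e' n else e (n - nbound \<phi>)"
    let ?E = "\<lambda>n. if n < sbound \<phi> then E' n else E (n - sbound \<phi>)"
    have "range ?e \<subseteq> dom M" "range ?E \<subseteq> sets M" using assms * by auto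
    then have "sat M ?e ?E \<phi>"
      using L assms unfolding univ_closure_def by (simp add: sat_AllS_pow sat_All_pow)
    moreover have "sat M ?e ?E \<phi> \<longleftrightarrow> sat M e' E' \<phi>"
      by (rule sat_cong) (auto dest: fvn_nbound fvs_sbound)
    ultimately show "sat M e' E' \<phi>" by simp
  qed
qed (use assms in \<open>simp add: univ_closure_def sat_AllS_pow sat_All_pow\<close>)

primrec AllBs :: "nat \<Rightarrow> tm \<Rightarrow> fm \<Rightarrow> fm" where
  "AllBs 0 t \<phi> = \<phi>"
| "AllBs (Suc k) t \<phi> = AllB t (AllBs k (sub_tm shift t) \<phi>)"

lemma bounded_AllBs: "bounded \<phi> \<Longrightarrow> bounded (AllBs k t \<phi>)"
  by (induction k arbitrary: t) (auto intro: bounded.intros)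

lemma sat_AllBs:
  assumes "dom M = UNIV"
  shows "sat M e E (AllBs k t \<phi>) \<longleftrightarrow>
    (\<forall>e'. (\<forall>i<k. lss M (e' i) (val M e t)) \<longrightarrow> (\<forall>n. e' (n + k) = e n) \<longrightarrow> sat M e' E \<phi>)"
proof (induction k arbitrary: e t)
  case 0
  have "e' = e" if "\<forall>n. e' n = e n" for e' :: "nat \<Rightarrow> 'a" using that by auto
  then show ?case by auto
next
  case (Suc k)
  have "sat M e E (AllBs (Suc k) t \<phi>) \<longleftrightarrow> (\<forall>x. lss M x (val M e t) \<longrightarrow> (\<forall>e'. (\<forall>i<k. lss M (e' i) (val M e t)) \<longrightarrow>
    (\<forall>n. e' (n + k) = (x ## e) n) \<longrightarrow> sat M e' E \<phi>))"
    by (simp add: Suc assms)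
  also have "\<dots> \<longleftrightarrow> (\<forall>e'. (\<forall>i<Suc k. lss M (e' i) (val M e t)) \<longrightarrow> (\<forall>n. e' (n + Suc k) = e n) \<longrightarrow> sat M e' E \<phi>)"
  proof (intro iffI allI impI)
    fix e' assume *: "\<forall>x. lss M x (val M e t) \<longrightarrow> (\<forall>e'. (\<forall>i<k. lss M (e' i) (val M e t)) \<longrightarrow>
      (\<forall>n. e' (n + k) = (x ## e) n) \<longrightarrow> sat M e' E \<phi>)"
      "\<forall>i<Suc k. lss M (e' i) (val M e t)" "\<forall>n. e' (n + Suc k) = e n"
    have "e' (n + k) = (e' k ## e) n" for n using *(3) by (cases n) auto
    then show "sat M e' E \<phi>" using *(1,2) by auto
  next
    fix x e' assume *: "\<forall>e'. (\<forall>i<Suc k. lss M (e' i) (val M e t)) \<longrightarrow> (\<forall>n. e' (n + Suc k) = e n) \<longrightarrow> sat M e' E \<phi>"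
      "lss M x (val M e t)" "\<forall>i<k. lss M (e' i) (val M e t)" "\<forall>n. e' (n + k) = (x ## e) n"
    have "e' (n + Suc k) = e n" for n using *(4)[rule_format, of "Suc n"] by simp
    moreover have "e' k = x" using *(4)[rule_format, of 0] by simp
    ultimately show "sat M e' E \<phi>" using *(1,2,3) by (auto simp: less_Suc_eq)
  qed
  finally show ?case .
qed

lemma sat_ind_inst:
  "sat M e E (ind_inst \<phi>) \<longleftrightarrow>
    (sat M (zer M ## e) E \<phi> \<longrightarrow> (\<forall>x\<in>dom M. sat M (x ## e) E \<phi> \<longrightarrow> sat M (add M x (one M) ## e) E \<phi>)
      \<longrightarrow> (\<forall>x\<in>dom M. sat M (x ## e) E \<phi>))"
proof -
  have "(\<lambda>n. val M (x ## e) ((Add (Var 0) One ## shift) n)) = add M x (one M) ## e" for x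
    by (auto simp: fun_eq_iff split: nat.split)
  then show ?thesis unfolding ind_inst_def by auto
qed

lemma sat_bnd_inst:
  "sat M e E (bnd_inst \<phi>) \<longleftrightarrow>
    ((\<forall>i\<in>dom M. \<exists>j\<in>dom M. sat M (j ## i ## e) E \<phi>) \<longrightarrow>
     (\<forall>m\<in>dom M. \<exists>n\<in>dom M. \<forall>i\<in>dom M. lss M i m \<longrightarrow> (\<exists>j\<in>dom M. lss M j n \<and> sat M (j ## i ## e) E \<phi>)))"
proof -
  have "(\<lambda>k. val M (j ## i ## n ## m ## e) (if k < 2 then Var k else Var (k + 2))) = j ## i ## e" for i j n m
    by (auto simp: fun_eq_iff numeral_2_eq_2 split: nat.split)
  then show ?thesis unfolding bnd_inst_def by (simp add: shift_def)
qed

lemma sat_comp_inst: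
  "sat M e E (comp_inst \<phi> \<psi>) \<longleftrightarrow>
    ((\<forall>x\<in>dom M. sat M (x ## e) E \<phi> \<longleftrightarrow> sat M (x ## e) E \<psi>) \<longrightarrow>
     (\<exists>X\<in>sets M. \<forall>x\<in>dom M. x \<in> X \<longleftrightarrow> sat M (x ## e) E \<phi>))"
  unfolding comp_inst_def by auto

section \<open>Normal forms\<close>

definition collects :: "'m mdl \<Rightarrow> bool" where
  "collects M \<longleftrightarrow>
    (\<forall>\<phi> e E. \<forall>m\<in>dom M. bounded \<phi> \<longrightarrow> range e \<subseteq> dom M \<longrightarrow> range E \<subseteq> sets M \<longrightarrow>
      (\<forall>x\<in>dom M. lss M x m \<longrightarrow> (\<exists>y\<in>dom M. sat M (y ## x ## e) E \<phi>)) \<longrightarrow>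
      (\<exists>n\<in>dom M. \<forall>x\<in>dom M. lss M x m \<longrightarrow> (\<exists>y\<in>dom M. lss M y n \<and> sat M (y ## x ## e) E \<phi>)))"

text \<open>Just enough to contract quantifier blocks, so that the normal forms apply both to the
  first model and to the cut, whose domain is a proper subset. Common upper bounds take the place of
  a pairing function.\<close>

definition coll_model :: "'m mdl \<Rightarrow> bool" where
  "coll_model M \<longleftrightarrow> wfm M \<and> collects M \<and>
    (\<forall>x\<in>dom M. \<forall>y\<in>dom M. \<exists>z\<in>dom M. lss M x z \<and> lss M y z) \<and>
    (\<forall>x\<in>dom M. \<forall>y\<in>dom M. \<forall>z\<in>dom M. lss M x y \<longrightarrow> lss M y z \<longrightarrow> lss M x z)"

lemma coll_model_ne: "coll_model M \<Longrightarrow> dom M \<noteq> {}"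
  unfolding coll_model_def wfm_def by blast

lemma coll_model_dir: "coll_model M \<Longrightarrow> x \<in> dom M \<Longrightarrow> y \<in> dom M \<Longrightarrow> \<exists>z\<in>dom M. lss M x z \<and> lss M y z"
  unfolding coll_model_def by blast

lemma coll_model_trans:
  "coll_model M \<Longrightarrow> lss M x y \<Longrightarrow> lss M y z \<Longrightarrow> x \<in> dom M \<Longrightarrow> y \<in> dom M \<Longrightarrow> z \<in> dom M \<Longrightarrow> lss M x z"
  unfolding coll_model_def by blast

lemma coll_modelD:
  assumes "coll_model M" "m \<in> dom M" "bounded \<phi>" "range e \<subseteq> dom M" "range E \<subseteq> sets M"
    "\<And>x. x \<in> dom M \<Longrightarrow> lss M x m \<Longrightarrow> \<exists>y\<in>dom M. sat M (y ## x ## e) E \<phi>"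
  shows "\<exists>n\<in>dom M. \<forall>x\<in>dom M. lss M x m \<longrightarrow> (\<exists>y\<in>dom M. lss M y n \<and> sat M (y ## x ## e) E \<phi>)"
proof -
  have "collects M" using assms(1) by (simp add: coll_model_def)
  from this[unfolded collects_def, rule_format, OF assms(2-5)] assms(6) show ?thesis by blast
qed

lemma Sigma0_0_bounded: "Sigma0 0 \<phi> \<Longrightarrow> bounded \<phi>"
  by (cases rule: Sigma0.cases) auto

lemma Pi0_0_bounded: "Pi0 0 \<phi> \<Longrightarrow> bounded \<phi>"
  by (cases rule: Pi0.cases) auto

text \<open>At a fixed positive level only two introduction rules can end a derivation, so the
  mutual induction reduces to a single class.\<close>

lemma Sigma0_Suc_induct [consumes 1, case_names base Ex]:
  assumes "Sigma0 (Suc k) \<phi>" "\<And>\<phi>. Pi0 k \<phi> \<Longrightarrow> P \<phi>" "\<And>\<phi>. P \<phi> \<Longrightarrow> P (Ex \<phi>)"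
  shows "P \<phi>"
proof -
  have "(Sigma0 k' \<phi> \<longrightarrow> k' = Suc k \<longrightarrow> P \<phi>) \<and> (Pi0 k'' \<psi> \<longrightarrow> True)" for k' k'' \<psi>
    by (rule Sigma0_Pi0.induct) (use assms(2,3) in auto)
  then show ?thesis using assms(1) by blast
qed

lemma Pi0_Suc_induct [consumes 1, case_names base All]:
  assumes "Pi0 (Suc k) \<phi>" "\<And>\<phi>. Sigma0 k \<phi> \<Longrightarrow> P \<phi>" "\<And>\<phi>. P \<phi> \<Longrightarrow> P (All \<phi>)"
  shows "P \<phi>"
proof -
  have "(Sigma0 k'' \<psi> \<longrightarrow> True) \<and> (Pi0 k' \<phi> \<longrightarrow> k' = Suc k \<longrightarrow> P \<phi>)" for k' k'' \<psi>
    by (rule Sigma0_Pi0.induct) (use assms(2,3) in auto)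
  then show ?thesis using assms(1) by blast
qed

text \<open>One \<open>\<theta>\<close> serves all models on the type \<open>'m\<close>, and
  \<open>Q\<close> says how it is to be quantified. The \<open>itself\<close> argument of the
  abbreviations fixes \<open>'m\<close>, which the formulas do not mention.\<close>

definition nf :: "('m mdl \<Rightarrow> (nat \<Rightarrow> 'm) \<Rightarrow> (nat \<Rightarrow> 'm set) \<Rightarrow> fm \<Rightarrow> bool) \<Rightarrow> fm \<Rightarrow> fm \<Rightarrow> bool" where
  "nf Q \<phi> \<theta> \<longleftrightarrow> bounded \<theta> \<and> (\<forall>M e E. coll_model M \<longrightarrow> range e \<subseteq> dom M \<longrightarrow> range E \<subseteq> sets M \<longrightarrow>
    (sat M e E \<phi> \<longleftrightarrow> Q M e E \<theta>))"

lemma nfD: "nf Q \<phi> \<theta> \<Longrightarrow> bounded \<theta>"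
  "nf Q \<phi> \<theta> \<Longrightarrow> coll_model M \<Longrightarrow> range e \<subseteq> dom M \<Longrightarrow> range E \<subseteq> sets M \<Longrightarrow> sat M e E \<phi> \<longleftrightarrow> Q M e E \<theta>"
  unfolding nf_def by blast+

lemma nfI: "bounded \<theta> \<Longrightarrow> (\<And>M e E. coll_model M \<Longrightarrow> range e \<subseteq> dom M \<Longrightarrow> range E \<subseteq> sets M \<Longrightarrow>
    sat M e E \<phi> \<longleftrightarrow> Q M e E \<theta>) \<Longrightarrow> nf Q \<phi> \<theta>"
  unfolding nf_def by blast

abbreviation "nfS1 (T :: 'm itself) \<equiv> nf (\<lambda>(M :: 'm mdl) e E \<theta>. \<exists>u\<in>dom M. sat M (u ## e) E \<theta>)"
abbreviation "nfP1 (T :: 'm itself) \<equiv> nf (\<lambda>(M :: 'm mdl) e E \<theta>. \<forall>u\<in>dom M. sat M (u ## e) E \<theta>)"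
abbreviation "nfS2 (T :: 'm itself) \<equiv> nf (\<lambda>(M :: 'm mdl) e E \<theta>. \<exists>u\<in>dom M. \<forall>v\<in>dom M. sat M (v ## u ## e) E \<theta>)"
abbreviation "nfP3 (T :: 'm itself) k \<equiv> nf (\<lambda>(M :: 'm mdl) e E \<theta>. \<forall>e'. range e' \<subseteq> dom M \<longrightarrow> (\<forall>n. e' (n + k) = e n) \<longrightarrow>
      (\<exists>u\<in>dom M. \<forall>v\<in>dom M. sat M (v ## u ## e') E \<theta>))"

lemma Sigma0_1_normal:
  assumes "Sigma0 1 \<phi>"
  shows "\<exists>\<theta>. nfS1 TYPE('m) \<phi> \<theta>"
  using assms unfolding One_nat_def
proof (induction rule: Sigma0_Suc_induct)
  case (base \<phi>)
  have "bounded (lift \<phi>)" using base Pi0_0_bounded by (auto simp: lift_def intro: bounded_sub)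
  then show ?case by (intro exI[of _ "lift \<phi>"] nfI) (auto simp: coll_model_ne)
next
  case (Ex \<phi>)
  then obtain \<theta> where nf: "nfS1 TYPE('m) \<phi> \<theta>" by blast
  note \<theta> = nfD[OF nf]
  \<comment> \<open>The new leading variable is a bound for the old witness and the new one
    together.\<close>
  let ?\<theta> = "ExB (Var 0) (ExB (Var 1) (ren (0 ## 1 ## (\<lambda>n. n + 3)) \<theta>))"
  have "sat M e E (Ex \<phi>) \<longleftrightarrow> (\<exists>u\<in>dom M. sat M (u ## e) E ?\<theta>)"
    if M: "coll_model M" "range e \<subseteq> dom M" "range E \<subseteq> sets M" for M :: "'m mdl" and e E
  proof -
    have "(\<lambda>n. (u ## y ## v ## e) ((0 ## 1 ## (\<lambda>n. n + 3)) n)) = u ## y ## e" for u y v :: 'm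
      by (auto simp: fun_eq_iff eval_nat_numeral split: nat.split)
    then have "sat M (v ## e) E ?\<theta> \<longleftrightarrow> (\<exists>y\<in>dom M. lss M y v \<and> (\<exists>u\<in>dom M. lss M u v \<and> sat M (u ## y ## e) E \<theta>))" for v
      by (simp add: shift_def)
    moreover have "sat M e E (Ex \<phi>) \<longleftrightarrow> (\<exists>y\<in>dom M. \<exists>u\<in>dom M. sat M (u ## y ## e) E \<theta>)"
      using \<theta>(2) M by simp
    moreover have "\<exists>v\<in>dom M. lss M x v \<and> lss M y v" if "x \<in> dom M" "y \<in> dom M" for x y
      using coll_model_dir[OF M(1) that] .
    ultimately show ?thesis by meson
  qed
  note * = this
  have "bounded ?\<theta>" by (intro bounded_rules bounded_sub \<theta>)
  then show ?case by (intro exI[of _ ?\<theta>] nfI) (simp, rule *)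
qed

lemma Pi0_1_normal:
  assumes "Pi0 1 \<phi>"
  shows "\<exists>\<theta>. nfP1 TYPE('m) \<phi> \<theta>"
  using assms unfolding One_nat_def
proof (induction rule: Pi0_Suc_induct)
  case (base \<phi>)
  have "bounded (lift \<phi>)" using base Sigma0_0_bounded by (auto simp: lift_def intro: bounded_sub)
  then show ?case by (intro exI[of _ "lift \<phi>"] nfI) (auto simp: coll_model_ne)
next
  case (All \<phi>)
  then obtain \<theta> where nf: "nfP1 TYPE('m) \<phi> \<theta>" by blast
  note \<theta> = nfD[OF nf]
  let ?\<theta> = "AllB (Var 0) (AllB (Var 1) (ren (0 ## 1 ## (\<lambda>n. n + 3)) \<theta>))"
  have "sat M e E (All \<phi>) \<longleftrightarrow> (\<forall>u\<in>dom M. sat M (u ## e) E ?\<theta>)"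
    if M: "coll_model M" "range e \<subseteq> dom M" "range E \<subseteq> sets M" for M :: "'m mdl" and e E
  proof -
    have "(\<lambda>n. (u ## y ## v ## e) ((0 ## 1 ## (\<lambda>n. n + 3)) n)) = u ## y ## e" for u y v :: 'm
      by (auto simp: fun_eq_iff eval_nat_numeral split: nat.split)
    then have "sat M (v ## e) E ?\<theta> \<longleftrightarrow> (\<forall>y\<in>dom M. lss M y v \<longrightarrow> (\<forall>u\<in>dom M. lss M u v \<longrightarrow> sat M (u ## y ## e) E \<theta>))" for v
      by (simp add: shift_def)
    moreover have "sat M e E (All \<phi>) \<longleftrightarrow> (\<forall>y\<in>dom M. \<forall>u\<in>dom M. sat M (u ## y ## e) E \<theta>)"
      using \<theta>(2) M by simp
    moreover have "\<exists>v\<in>dom M. lss M x v \<and> lss M y v" if "x \<in> dom M" "y \<in> dom M" for x y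
      using coll_model_dir[OF M(1) that] .
    ultimately show ?thesis by meson
  qed
  note * = this
  have "bounded ?\<theta>" by (intro bounded_rules bounded_sub \<theta>)
  then show ?case by (intro exI[of _ ?\<theta>] nfI) (simp, rule *)
qed

text \<open>A further existential quantifier is absorbed by bounding its variable and the old
  witness by one \<open>u'\<close>, and the universal variable by \<open>v'\<close>. For the way
  back, suppose every pair below \<open>u'\<close> is refuted. Collecting the refutations over
  \<open>u\<close> and then over \<open>y\<close> gives one bound \<open>w\<close>, which
  contradicts the formula at \<open>v' = w\<close>.\<close>

lemma Sigma0_2_normal:
  assumes "Sigma0 2 \<phi>"
  shows "\<exists>\<theta>. nfS2 TYPE('m) \<phi> \<theta>"
  using assms unfolding numeral_2_eq_2
proof (induction rule: Sigma0_Suc_induct)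
  case (base \<phi>)
  then obtain \<theta> where nf: "nfP1 TYPE('m) \<phi> \<theta>" using Pi0_1_normal[of \<phi>] unfolding One_nat_def by blast
  note \<theta> = nfD[OF nf]
  let ?\<theta> = "ren (0 ## (\<lambda>n. n + 2)) \<theta>"
  have "(\<lambda>n. (v ## u ## e) ((0 ## (\<lambda>n. n + 2)) n)) = v ## e" for u v :: 'm and e
      by (auto simp: fun_eq_iff eval_nat_numeral split: nat.split)
  note * = this
  have "nfS2 TYPE('m) \<phi> ?\<theta>"
  proof (rule nfI)
    fix M :: "'m mdl" and e :: "nat \<Rightarrow> 'm" and E :: "nat \<Rightarrow> 'm set" assume M: "coll_model M" "range e \<subseteq> dom M" "range E \<subseteq> sets M"
    show "sat M e E \<phi> \<longleftrightarrow> (\<exists>u\<in>dom M. \<forall>v\<in>dom M. sat M (v ## u ## e) E ?\<theta>)"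
      unfolding \<theta>(2)[OF M] sat_sub val.simps * using coll_model_ne[OF M(1)] by auto
  qed (intro bounded_sub \<theta>)
  then show ?case by blast
next
  case (Ex \<phi>)
  then obtain \<theta> where nf: "nfS2 TYPE('m) \<phi> \<theta>" by blast
  note \<theta> = nfD[OF nf]
  let ?\<theta>1 = "ExB (Var 2) (AllB (Var 2) (ren (0 ## 1 ## 2 ## (\<lambda>n. n + 5)) \<theta>))"
  let ?\<theta> = "ExB (Var 1) ?\<theta>1"
  have bd: "bounded ?\<theta>" "bounded (AllB (Var 2) (ren (0 ## 1 ## 2 ## (\<lambda>n. n + 5)) \<theta>))"
    by (intro bounded_rules bounded_sub \<theta>)+
  have "sat M e E (Ex \<phi>) \<longleftrightarrow> (\<exists>u\<in>dom M. \<forall>v\<in>dom M. sat M (v ## u ## e) E ?\<theta>)"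
    if M: "coll_model M" "range e \<subseteq> dom M" "range E \<subseteq> sets M" for M :: "'m mdl" and e E
  proof -
    have dir: "\<exists>v\<in>dom M. lss M x v \<and> lss M y v" if "x \<in> dom M" "y \<in> dom M" for x y
      using coll_model_dir[OF M(1) that] .
    note trans = coll_model_trans[OF M(1)]
    have "(\<lambda>n. (v ## u ## y ## v' ## u' ## e) ((0 ## 1 ## 2 ## (\<lambda>n. n + 5)) n)) = v ## u ## y ## e"
      for u y v u' v' :: 'm
      by (auto simp: fun_eq_iff eval_nat_numeral split: nat.split)
    then have s: "sat M (v' ## u' ## e) E ?\<theta> \<longleftrightarrow> (\<exists>y\<in>dom M. lss M y u' \<and> (\<exists>u\<in>dom M. lss M u u' \<and>
      (\<forall>v\<in>dom M. lss M v v' \<longrightarrow> sat M (v ## u ## y ## e) E \<theta>)))" for u' v'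
      by (simp add: shift_def numeral_2_eq_2)
    have x: "sat M e E (Ex \<phi>) \<longleftrightarrow> (\<exists>y\<in>dom M. \<exists>u\<in>dom M. \<forall>v\<in>dom M. sat M (v ## u ## y ## e) E \<theta>)"
      using \<theta>(2) M by simp
    show ?thesis
    proof
      assume "sat M e E (Ex \<phi>)"
      then obtain y u where yu: "y \<in> dom M" "u \<in> dom M" "\<forall>v\<in>dom M. sat M (v ## u ## y ## e) E \<theta>"
        unfolding x by blast
      then obtain u' where "u' \<in> dom M" "lss M y u'" "lss M u u'" using dir by blast
      then have "\<forall>v\<in>dom M. sat M (v ## u' ## e) E ?\<theta>" unfolding s using yu by blast
      then show "\<exists>u\<in>dom M. \<forall>v\<in>dom M. sat M (v ## u ## e) E ?\<theta>" using \<open>u' \<in> dom M\<close> by blast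
    next
      assume "\<exists>u\<in>dom M. \<forall>v\<in>dom M. sat M (v ## u ## e) E ?\<theta>"
      then obtain u' where u': "u' \<in> dom M" "\<And>v'. v' \<in> dom M \<Longrightarrow> (\<exists>y\<in>dom M. lss M y u' \<and> (\<exists>u\<in>dom M. lss M u u' \<and>
        (\<forall>v\<in>dom M. lss M v v' \<longrightarrow> sat M (v ## u ## y ## e) E \<theta>)))" unfolding s by blast
      show "sat M e E (Ex \<phi>)"
      proof (rule ccontr)
        assume "\<not> ?thesis"
        then have n: "\<exists>v\<in>dom M. \<not> sat M (v ## u ## y ## e) E \<theta>" if "y \<in> dom M" "u \<in> dom M" for y u
          using that unfolding x by blast
        let ?\<chi> = "AllB (Var 2) (ExB (Var 1) (ren (0 ## 1 ## 3 ## (\<lambda>n. n + 5)) (Neg \<theta>)))"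
        have "(\<lambda>n. (v ## u ## w ## y ## u' ## e) ((0 ## 1 ## 3 ## (\<lambda>n. n + 5)) n)) = v ## u ## y ## e"
          for u y v u' w :: 'm
          by (auto simp: fun_eq_iff eval_nat_numeral split: nat.split)
        then have c: "sat M (w ## y ## u' ## e) E ?\<chi> \<longleftrightarrow>
          (\<forall>u\<in>dom M. lss M u u' \<longrightarrow> (\<exists>v\<in>dom M. lss M v w \<and> \<not> sat M (v ## u ## y ## e) E \<theta>))" for w y
          by (simp add: shift_def numeral_2_eq_2)
        have "bounded ?\<chi>" by (intro bounded_rules bounded_sub \<theta>)
        moreover have "\<exists>w\<in>dom M. sat M (w ## y ## u' ## e) E ?\<chi>" if "y \<in> dom M" "lss M y u'" for y
          unfolding c using coll_modelD[OF M(1) u'(1), of "Neg \<theta>" "y ## e" E] that M u' n \<theta>(1) bounded_rules by auto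
        ultimately obtain w where "w \<in> dom M" "\<forall>y\<in>dom M. lss M y u' \<longrightarrow> (\<exists>w'\<in>dom M. lss M w' w \<and> sat M (w' ## y ## u' ## e) E ?\<chi>)"
          using coll_modelD[OF M(1) u'(1), of ?\<chi> "u' ## e" E] M u' by auto
        then show False using u'(2)[of w] trans unfolding c by meson
      qed
    qed
  qed
  note * = this
  show ?case by (intro exI[of _ ?\<theta>] nfI) (rule bd, rule *)
qed

text \<open>The outer universal block stays uncontracted, as \<open>k\<close> new entries in front
  of the environment; \<open>block\<close> later bounds the parameters by one number.\<close>

lemma Pi0_3_normal:
  assumes "Pi0 3 \<phi>"
  shows "\<exists>\<theta> k. nfP3 TYPE('m) k \<phi> \<theta>"
  using assms unfolding numeral_3_eq_3
proof (induction rule: Pi0_Suc_induct)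
  case (base \<phi>)
  then obtain \<theta> where nf: "nfS2 TYPE('m) \<phi> \<theta>"
    using Sigma0_2_normal[of \<phi>] unfolding numeral_2_eq_2 by blast
  note \<theta> = nfD[OF nf]
  have "e' = e" if "\<forall>n. e' n = e n" for e' e :: "nat \<Rightarrow> 'm" using that by auto
  then have "nfP3 TYPE('m) 0 \<phi> \<theta>" using \<theta> by (intro nfI) (simp, simp, metis)
  then show ?case by blast
next
  case (All \<phi>)
  then obtain \<theta> k where nf: "nfP3 TYPE('m) k \<phi> \<theta>" by blast
  note \<theta> = nfD[OF nf]
  have "sat M e E (All \<phi>) \<longleftrightarrow> (\<forall>e'. range e' \<subseteq> dom M \<longrightarrow> (\<forall>n. e' (n + Suc k) = e n) \<longrightarrow>
      (\<exists>u\<in>dom M. \<forall>v\<in>dom M. sat M (v ## u ## e') E \<theta>))"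
    if M: "coll_model M" "range e \<subseteq> dom M" "range E \<subseteq> sets M" for M :: "'m mdl" and e E
  proof -
    have "sat M e E (All \<phi>) \<longleftrightarrow> (\<forall>x\<in>dom M. \<forall>e'. range e' \<subseteq> dom M \<longrightarrow> (\<forall>n. e' (n + k) = (x ## e) n) \<longrightarrow>
      (\<exists>u\<in>dom M. \<forall>v\<in>dom M. sat M (v ## u ## e') E \<theta>))" using \<theta>(2) M by simp
    moreover have "(\<exists>x\<in>dom M. \<forall>n. e' (n + k) = (x ## e) n) \<longleftrightarrow> (\<forall>n. e' (n + Suc k) = e n)" if "range e' \<subseteq> dom M" for e'
    proof
      assume *: "\<forall>n. e' (n + Suc k) = e n"
      have "e' (n + k) = (e' k ## e) n" for n using * by (cases n) auto
      then show "\<exists>x\<in>dom M. \<forall>n. e' (n + k) = (x ## e) n" using that by blast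
    next
      assume "\<exists>x\<in>dom M. \<forall>n. e' (n + k) = (x ## e) n"
      then show "\<forall>n. e' (n + Suc k) = e n"
        by (metis add_Suc add_Suc_right old.nat.simps(5))
    qed
    ultimately show ?thesis by meson
  qed
  note * = this
  show ?case by (intro exI[of _ \<theta>] exI[of _ "Suc k"] nfI) (rule \<theta>, rule *)
qed

section \<open>Arithmetic in a model\<close>

locale arith =
  fixes M :: "'m mdl" and Ss :: "'m set set"
  assumes dom [simp]: "dom M = UNIV" and Ss_ne: "Ss \<noteq> {}"
    and ax1: "add M x (one M) \<noteq> zer M"
    and ax2: "add M x (one M) = add M y (one M) \<Longrightarrow> x = y"
    and ax3: "add M x (zer M) = x"
    and ax4: "add M x (add M y (one M)) = add M (add M x y) (one M)"
    and ax5: "mul M x (zer M) = zer M"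
    and ax6: "mul M x (add M y (one M)) = add M (mul M x y) x"
    and ax7: "\<not> lss M x (zer M)"
    and ax8: "lss M x (add M y (one M)) \<longleftrightarrow> lss M x y \<or> x = y"
    and bind: "bounded \<phi> \<Longrightarrow> range E \<subseteq> Ss \<Longrightarrow> sat M (zer M ## e) E \<phi> \<Longrightarrow>
      (\<And>x. sat M (x ## e) E \<phi> \<Longrightarrow> sat M (add M x (one M) ## e) E \<phi>) \<Longrightarrow> sat M (x ## e) E \<phi>"
    and bcoll: "bounded \<phi> \<Longrightarrow> range E \<subseteq> Ss \<Longrightarrow> (\<And>x. lss M x m \<Longrightarrow> \<exists>y. sat M (y ## x ## e) E \<phi>) \<Longrightarrow>
      \<exists>n. \<forall>x. lss M x m \<longrightarrow> (\<exists>y. lss M y n \<and> sat M (y ## x ## e) E \<phi>)"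
begin

abbreviation ad (infixl \<open>\<oplus>\<close> 65) where "x \<oplus> y \<equiv> add M x y"
abbreviation mu (infixl \<open>\<otimes>\<close> 70) where "x \<otimes> y \<equiv> mul M x y"
abbreviation ls (infix \<open>\<prec>\<close> 50) where "x \<prec> y \<equiv> lss M x y"
abbreviation nul (\<open>\<zero>\<close>) where "\<zero> \<equiv> zer M"
abbreviation eins (\<open>\<one>\<close>) where "\<one> \<equiv> one M"
definition lq (infix \<open>\<preceq>\<close> 50) where "x \<preceq> y \<longleftrightarrow> x \<prec> y \<or> x = y"

definition E0 :: "nat \<Rightarrow> 'm set" where "E0 = (\<lambda>_. SOME X. X \<in> Ss)"

lemma E0: "range E0 \<subseteq> Ss" using Ss_ne by (auto simp: E0_def some_in_eq)

lemmas bi = bind[OF _ E0]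

text \<open>The laws of arithmetic come in their usual order, mostly by induction on
  \<open>Var 0\<close> with the remaining arguments as parameters in the environment.\<close>

lemma z_add: "\<zero> \<oplus> x = x"
  using bi[of "Eq (Add Zero (Var 0)) (Var 0)" "\<lambda>_. \<zero>" x]
  by (simp add: bounded.intros ax3 ax4)

lemma s_add: "(y \<oplus> \<one>) \<oplus> x = (y \<oplus> x) \<oplus> \<one>"
  using bi[of "Eq (Add (Add (Var 1) One) (Var 0)) (Add (Add (Var 1) (Var 0)) One)" "\<lambda>_. y" x]
  by (simp add: bounded.intros ax3 ax4)

lemma add_comm: "y \<oplus> x = x \<oplus> y"
  using bi[of "Eq (Add (Var 1) (Var 0)) (Add (Var 0) (Var 1))" "\<lambda>_. y" x]
  by (simp add: bounded.intros ax3 ax4 z_add s_add)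

lemma add_assoc: "a \<oplus> b \<oplus> x = a \<oplus> (b \<oplus> x)"
  using bi[of "Eq (Add (Add (Var 1) (Var 2)) (Var 0)) (Add (Var 1) (Add (Var 2) (Var 0)))" "a ## b ## (\<lambda>_. \<zero>)" x]
  by (simp add: bounded.intros ax3 ax4 numeral_2_eq_2)

lemma add_lcomm: "a \<oplus> (b \<oplus> x) = b \<oplus> (a \<oplus> x)"
  by (metis add_comm add_assoc)

lemmas add_ac = add_assoc add_comm add_lcomm

lemma z_mul: "\<zero> \<otimes> x = \<zero>"
  using bi[of "Eq (Mul Zero (Var 0)) Zero" "\<lambda>_. \<zero>" x]
  by (simp add: bounded.intros ax3 ax5 ax6)

lemma s_mul: "(y \<oplus> \<one>) \<otimes> x = y \<otimes> x \<oplus> x"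
  using bi[of "Eq (Mul (Add (Var 1) One) (Var 0)) (Add (Mul (Var 1) (Var 0)) (Var 0))" "\<lambda>_. y" x]
  by (simp add: bounded.intros ax3 ax5 ax6) (simp add: add_ac)

lemma mul_comm: "y \<otimes> x = x \<otimes> y"
  using bi[of "Eq (Mul (Var 1) (Var 0)) (Mul (Var 0) (Var 1))" "\<lambda>_. y" x]
  by (simp add: bounded.intros ax5 ax6 z_mul s_mul)

lemma distl: "a \<otimes> (b \<oplus> x) = a \<otimes> b \<oplus> a \<otimes> x"
  using bi[of "Eq (Mul (Var 1) (Add (Var 2) (Var 0))) (Add (Mul (Var 1) (Var 2)) (Mul (Var 1) (Var 0)))" "a ## b ## (\<lambda>_. \<zero>)" x]
  by (simp add: bounded.intros ax3 ax5 ax6 numeral_2_eq_2 flip: add_assoc)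

lemma mul_one: "x \<otimes> \<one> = x"
  using ax6[of x \<zero>] by (simp add: z_add ax5)

lemma mul_assoc: "a \<otimes> b \<otimes> x = a \<otimes> (b \<otimes> x)"
  using bi[of "Eq (Mul (Mul (Var 1) (Var 2)) (Var 0)) (Mul (Var 1) (Mul (Var 2) (Var 0)))" "a ## b ## (\<lambda>_. \<zero>)" x]
  by (simp add: bounded.intros ax5 ax6 distl mul_one numeral_2_eq_2)

lemma zero_one: "\<zero> \<noteq> \<one>"
  using ax1[of \<zero>] by (simp add: z_add)

sublocale R: comm_semiring_1 "mul M" "\<one>" "add M" "\<zero>"
proof
  fix a b c
  show "(a \<oplus> b) \<otimes> c = a \<otimes> c \<oplus> b \<otimes> c" by (metis distl mul_comm)
  show "\<one> \<otimes> a = a" by (metis mul_comm mul_one)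
  show "a \<oplus> b = b \<oplus> a" "a \<otimes> b = b \<otimes> a" by (rule add_comm mul_comm)+
qed (auto simp: add_assoc mul_assoc z_add z_mul ax5 zero_one)

lemma add_cancel: "a \<oplus> x = b \<oplus> x \<Longrightarrow> a = b"
  using bi[of "Imp (Eq (Add (Var 1) (Var 0)) (Add (Var 2) (Var 0))) (Eq (Var 1) (Var 2))" "a ## b ## (\<lambda>_. \<zero>)" x]
  by (simp add: bounded.intros ax3 ax4 numeral_2_eq_2) (metis ax2 add_assoc)

lemma add_cancel_left: "x \<oplus> a = x \<oplus> b \<longleftrightarrow> a = b"
  using add_cancel add_comm by metis

lemma lt_succ: "x \<prec> x \<oplus> \<one>" by (simp add: ax8)

lemma zero_or_succ: "x = \<zero> \<or> (\<exists>y. x = y \<oplus> \<one>)"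
proof -
  have b: "bounded (Or (Eq (Var 0) Zero) (ExB (Var 0) (Eq (Var 1) (Add (Var 0) One))))"
    by (intro bounded_rules)
  have "\<exists>y. y \<prec> x \<oplus> \<one> \<and> x \<oplus> \<one> = y \<oplus> \<one>" for x using lt_succ by blast
  then show ?thesis using bi[OF b, of "\<lambda>_. \<zero>" x] by auto
qed

lemma lt_add: "x \<prec> x \<oplus> z \<oplus> \<one>"
  using bi[of "Less (Var 1) (Add (Add (Var 1) (Var 0)) One)" "\<lambda>_. x" z]
  by (simp add: bounded_rules ax8) (metis ax8 add_assoc)

lemma lt_iff: "x \<prec> y \<longleftrightarrow> (\<exists>z. y = x \<oplus> z \<oplus> \<one>)"
proof
  show "\<exists>z. y = x \<oplus> z \<oplus> \<one> \<Longrightarrow> x \<prec> y" using lt_add by blast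
  assume *: "x \<prec> y"
  have step: "\<exists>z. z \<prec> w \<oplus> \<one> \<and> w \<oplus> \<one> = x \<oplus> z \<oplus> \<one>"
    if h: "x \<prec> w \<oplus> \<one>" "x \<prec> w \<longrightarrow> (\<exists>z. z \<prec> w \<and> w = x \<oplus> z \<oplus> \<one>)" for w
  proof (cases "x = w")
    case True
    have "\<zero> \<prec> w \<oplus> \<one>" using lt_add[of \<zero> w] by simp
    then show ?thesis using True by (intro exI[of _ \<zero>]) simp
  next
    case False
    then have "x \<prec> w" using h(1) by (simp add: ax8)
    then obtain z where "z \<prec> w" "w = x \<oplus> z \<oplus> \<one>" using h(2) by auto
    moreover have "z \<oplus> \<one> \<prec> x \<oplus> z \<oplus> \<one> \<oplus> \<one>"
      using lt_add[of "z \<oplus> \<one>" x] by (metis add_assoc add_comm)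
    ultimately show ?thesis by (metis add_assoc)
  qed
  \<comment> \<open>Bounded induction needs a bound on the difference \<open>z\<close>, and
    \<open>y\<close> itself serves.\<close>
  have "x \<prec> y \<longrightarrow> (\<exists>z. z \<prec> y \<and> y = x \<oplus> z \<oplus> \<one>)"
  proof -
    have b: "bounded (Imp (Less (Var 1) (Var 0)) (ExB (Var 0) (Eq (Var 1) (Add (Add (Var 2) (Var 0)) One))))"
      by (intro bounded_rules)
    let ?\<phi> = "Imp (Less (Var 1) (Var 0)) (ExB (Var 0) (Eq (Var 1) (Add (Add (Var 2) (Var 0)) One)))"
    have e: "sat M (w ## (\<lambda>_. x)) E0 ?\<phi> \<longleftrightarrow> (x \<prec> w \<longrightarrow> (\<exists>z. z \<prec> w \<and> w = x \<oplus> z \<oplus> \<one>))" for w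
      by (simp add: numeral_2_eq_2)
    show ?thesis using bi[OF b, of "\<lambda>_. x" y] step unfolding e using ax7 by blast
  qed
  then show "\<exists>z. y = x \<oplus> z \<oplus> \<one>" using * by blast
qed

lemma lt_irrefl: "\<not> x \<prec> x"
  unfolding lt_iff by (metis add_assoc add_cancel_left ax1 ax3)

lemma lt_trans: "x \<prec> y \<Longrightarrow> y \<prec> z \<Longrightarrow> x \<prec> z"
  unfolding lt_iff by (metis add_assoc)

lemma lt_linear: "x \<prec> y \<or> x = y \<or> y \<prec> x"
proof -
  have step: "x \<prec> w \<oplus> \<one> \<or> x = w \<oplus> \<one> \<or> w \<oplus> \<one> \<prec> x" if lin: "x \<prec> w \<or> x = w \<or> w \<prec> x" for w
  proof (cases "w \<prec> x")
    case True
    then obtain z where z: "x = w \<oplus> z \<oplus> \<one>" unfolding lt_iff by blast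
    show ?thesis using zero_or_succ[of z]
    proof
      assume "\<exists>y. z = y \<oplus> \<one>"
      then obtain y where "z = y \<oplus> \<one>" by blast
      then have "x = (w \<oplus> \<one>) \<oplus> y \<oplus> \<one>" using z by (simp add: add_ac)
      then show ?thesis using lt_add by metis
    qed (use z in simp)
  qed (use lin ax8 in blast)
  have "\<zero> \<prec> x \<or> x = \<zero>" using zero_or_succ[of x] lt_add[of \<zero>] by auto
  then show ?thesis
    using bi[of "Or (Less (Var 1) (Var 0)) (Or (Eq (Var 1) (Var 0)) (Less (Var 0) (Var 1)))" "\<lambda>_. x" y] step
    by (simp add: bounded_rules) blast
qed

sublocale L: linorder "(\<preceq>)" "(\<prec>)"
  by unfold_locales (unfold lq_def, (meson lt_irrefl lt_trans lt_linear)+)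

lemma le_iff: "x \<preceq> y \<longleftrightarrow> (\<exists>z. y = x \<oplus> z)"
  unfolding lq_def lt_iff by (metis add_assoc ax3 zero_or_succ)

lemma lt_succ_iff: "x \<prec> y \<oplus> \<one> \<longleftrightarrow> x \<preceq> y" by (simp add: ax8 lq_def)

lemma succ_le_iff: "x \<oplus> \<one> \<preceq> y \<longleftrightarrow> x \<prec> y"
  unfolding le_iff lt_iff by (metis add_assoc add_comm)

lemma le_add1 [simp]: "x \<preceq> x \<oplus> y" and le_add2 [simp]: "x \<preceq> y \<oplus> x"
  using le_iff add_comm by metis+

lemma zero_le [simp]: "\<zero> \<preceq> x" using le_iff by auto

lemma add_mono: "a \<preceq> b \<Longrightarrow> c \<preceq> d \<Longrightarrow> a \<oplus> c \<preceq> b \<oplus> d"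
  unfolding le_iff by (metis add_assoc add_comm)

lemma mul_mono: "a \<preceq> b \<Longrightarrow> c \<preceq> d \<Longrightarrow> a \<otimes> c \<preceq> b \<otimes> d"
proof -
  assume "a \<preceq> b" "c \<preceq> d"
  then obtain u v where "b = a \<oplus> u" "d = c \<oplus> v" unfolding le_iff by blast
  then have "b \<otimes> d = a \<otimes> c \<oplus> (a \<otimes> v \<oplus> u \<otimes> (c \<oplus> v))" by (simp add: algebra_simps)
  then show ?thesis using le_iff by blast
qed

lemma val_mono: "(\<And>n. e n \<preceq> e' n) \<Longrightarrow> val M e t \<preceq> val M e' t"
  by (induction t) (auto intro: add_mono mul_mono)

lemma wfm_M: "wfm M" by (simp add: wfm_def)

lemma sat_AllB [simp]: "sat M e E (AllB t \<phi>) \<longleftrightarrow> (\<forall>x. x \<prec> val M e t \<longrightarrow> sat M (x ## e) E \<phi>)"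
  by simp

lemma sat_ExB [simp]: "sat M e E (ExB t \<phi>) \<longleftrightarrow> (\<exists>x. x \<prec> val M e t \<and> sat M (x ## e) E \<phi>)"
  by simp

lemma bounded_least:
  assumes "bounded \<phi>" "range E \<subseteq> Ss" "sat M (x ## e) E \<phi>"
  shows "\<exists>x. sat M (x ## e) E \<phi> \<and> (\<forall>y. y \<prec> x \<longrightarrow> \<not> sat M (y ## e) E \<phi>)"
proof (rule ccontr)
  assume neg: "\<not> ?thesis"
  let ?\<psi> = "AllB (Var 0) (Neg (ren (0 ## (\<lambda>n. n + 2)) \<phi>))"
  have "(\<lambda>n. (y ## x ## e) ((0 ## (\<lambda>n. n + 2)) n)) = y ## e" for x y
    by (auto simp: fun_eq_iff split: nat.split)
  then have s: "sat M (x ## e) E ?\<psi> \<longleftrightarrow> (\<forall>y. y \<prec> x \<longrightarrow> \<not> sat M (y ## e) E \<phi>)" for x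
    by (simp add: shift_def)
  have "sat M (x ## e) E ?\<psi>" for x
  proof (rule bind[OF _ assms(2)])
    show "bounded ?\<psi>" by (intro bounded_rules bounded_sub assms)
    show "sat M (\<zero> ## e) E ?\<psi>" unfolding s using ax7 by blast
    show "sat M (x ## e) E ?\<psi> \<Longrightarrow> sat M ((x \<oplus> \<one>) ## e) E ?\<psi>" for x
      unfolding s using neg ax8 by blast
  qed
  then show False using assms(3) lt_succ unfolding s by blast
qed

text \<open>The least \<open>z\<close> with no solution above it is itself a solution; otherwise it
  is not zero and its predecessor would have the same property.\<close>

lemma bounded_max:
  assumes "bounded \<phi>" "range E \<subseteq> Ss" "sat M (x ## e) E \<phi>" "\<And>y. sat M (y ## e) E \<phi> \<Longrightarrow> y \<prec> b"
  shows "\<exists>x. sat M (x ## e) E \<phi> \<and> (\<forall>y. x \<prec> y \<longrightarrow> \<not> sat M (y ## e) E \<phi>)"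
proof -
  let ?\<psi> = "AllB (Var 1) (Imp (Less (Var 1) (Var 0)) (Neg (ren (0 ## (\<lambda>n. n + 3)) \<phi>)))"
  have "(\<lambda>n. (y ## x ## b ## e) ((0 ## (\<lambda>n. n + 3)) n)) = y ## e" for x y
    by (auto simp: fun_eq_iff eval_nat_numeral split: nat.split)
  then have s: "sat M (x ## b ## e) E ?\<psi> \<longleftrightarrow> (\<forall>y. x \<prec> y \<longrightarrow> \<not> sat M (y ## e) E \<phi>)" for x
    using assms(4) by (auto simp: shift_def)
  have "bounded ?\<psi>" by (intro bounded_rules bounded_sub assms)
  moreover have "sat M (b ## b ## e) E ?\<psi>" unfolding s using assms(4) lt_trans lt_irrefl by meson
  ultimately obtain z where z: "\<forall>y. z \<prec> y \<longrightarrow> \<not> sat M (y ## e) E \<phi>" 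
    "\<And>w. w \<prec> z \<Longrightarrow> \<exists>y. w \<prec> y \<and> sat M (y ## e) E \<phi>"
    using bounded_least[of ?\<psi> E b "b ## e"] assms(2) unfolding s by metis
  have "sat M (z ## e) E \<phi>"
  proof (cases "z = \<zero>")
    case True
    then show ?thesis using assms(3) z(1) by (metis lq_def zero_le)
  next
    case False
    then obtain w where "z = w \<oplus> \<one>" using zero_or_succ by blast
    then obtain y where "w \<prec> y" "sat M (y ## e) E \<phi>" using z(2)[of w] lt_succ by blast
    then show ?thesis using z(1) \<open>z = w \<oplus> \<one>\<close> by (metis lq_def succ_le_iff)
  qed
  then show ?thesis using z(1) by blast
qed

lemma coll_model: "sets M = Ss \<Longrightarrow> coll_model M"
proof -
  assume S: "sets M = Ss"
  have "collects M" unfolding collects_def using bcoll S by auto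
  moreover have "\<exists>z. x \<prec> z \<and> y \<prec> z" for x y
    by (metis L.dual_order.strict_trans1 le_add1 le_add2 lt_succ)
  ultimately show ?thesis unfolding coll_model_def using wfm_M lt_trans by auto
qed

text \<open>If each \<open>y \<prec> u\<close> had a refuting \<open>v\<close>, such
  \<open>v\<close> could be found below a common \<open>n\<close>, against the hypothesis at
  \<open>w = n\<close>. This is how the proof passes from all stages \<open>w\<close> to the
  limit.\<close>

lemma coll_swap:
  assumes b: "bounded \<theta>" and E: "range E \<subseteq> Ss"
    and *: "\<And>w. \<exists>y. y \<prec> u \<and> (\<forall>v. v \<prec> w \<longrightarrow> sat M (v ## y ## e) E \<theta>)"
  shows "\<exists>y. y \<prec> u \<and> (\<forall>v. sat M (v ## y ## e) E \<theta>)"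
proof (rule ccontr)
  assume "\<not> ?thesis"
  then have "\<exists>v. sat M (v ## y ## e) E (Neg \<theta>)" if "y \<prec> u" for y using that by auto
  from bcoll[OF _ E this]
  obtain n where "\<forall>y. y \<prec> u \<longrightarrow> (\<exists>v. v \<prec> n \<and> sat M (v ## y ## e) E (Neg \<theta>))"
    using b bounded_rules by meson
  then show False using *[of n] by auto
qed

section \<open>Bounds on the membership queries of a bounded formula\<close>

lemma query_bound_step:
  assumes "\<And>e E E'. (\<And>X v. v \<prec> val M e q \<Longrightarrow> v \<in> E X \<longleftrightarrow> v \<in> E' X) \<Longrightarrow> sat M e E \<phi> \<longleftrightarrow> sat M e E' \<phi>"
    and "\<And>X v. v \<prec> val M e (sub_tm (t ## Var) q) \<Longrightarrow> v \<in> E X \<longleftrightarrow> v \<in> E' X"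
    and "x \<prec> val M e t"
  shows "sat M (x ## e) E \<phi> \<longleftrightarrow> sat M (x ## e) E' \<phi>"
proof (rule assms(1))
  fix X v assume v: "v \<prec> val M (x ## e) q"
  have "(\<lambda>n. val M e ((t ## Var) n)) = val M e t ## e"
    by (auto simp: fun_eq_iff split: nat.split)
  moreover have "val M (x ## e) q \<preceq> val M (val M e t ## e) q"
    by (rule val_mono) (use assms(3) in \<open>auto simp: lq_def split: nat.split\<close>)
  ultimately show "v \<in> E X \<longleftrightarrow> v \<in> E' X" using assms(2) v by (simp add: L.less_le_trans)
qed

end

definition query_bound :: "'m itself \<Rightarrow> fm \<Rightarrow> tm \<Rightarrow> bool" where
  "query_bound T \<phi> q \<longleftrightarrow> (\<forall>(M :: 'm mdl) Ss e E E'. arith M Ss \<longrightarrow>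
    (\<forall>X v. lss M v (val M e q) \<longrightarrow> (v \<in> E X \<longleftrightarrow> v \<in> E' X)) \<longrightarrow> (sat M e E \<phi> \<longleftrightarrow> sat M e E' \<phi>))"

lemma query_boundD:
  fixes M :: "'m mdl" and E :: "nat \<Rightarrow> 'm set"
  assumes "query_bound TYPE('m) \<phi> q" "arith M Ss" "\<And>X v. lss M v (val M e q) \<Longrightarrow> v \<in> E X \<longleftrightarrow> v \<in> E' X"
  shows "sat M e E \<phi> \<longleftrightarrow> sat M e E' \<phi>"
  using assms unfolding query_bound_def by blast

text \<open>Terms are monotone, so under a bounded quantifier the variable may be replaced by its
  bound \<open>t\<close>; for an implication the sum of two bounds dominates both.\<close>

lemma ex_query_bound: "bounded \<phi> \<Longrightarrow> \<exists>q. query_bound TYPE('m) \<phi> q"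
proof (induction rule: bounded.induct)
  case (3 t X)
  have "query_bound TYPE('m) (Mem t X) (Add t One)"
    unfolding query_bound_def by (auto simp: arith.lt_succ)
  then show ?case by blast
next
  case (5 \<phi> \<psi>)
  then obtain q r where *: "query_bound TYPE('m) \<phi> q" "query_bound TYPE('m) \<psi> r" by blast
  have "query_bound TYPE('m) (Imp \<phi> \<psi>) (Add q r)"
    unfolding query_bound_def
  proof (intro allI impI)
    fix M :: "'m mdl" and Ss e and E E' :: "nat \<Rightarrow> 'm set"
    assume M: "arith M Ss" and a: "\<forall>X v. lss M v (val M e (Add q r)) \<longrightarrow> (v \<in> E X \<longleftrightarrow> v \<in> E' X)"
    interpret arith M Ss by fact
    have "sat M e E \<phi> \<longleftrightarrow> sat M e E' \<phi>"
      by (rule query_boundD[OF *(1) M]) (use a in \<open>auto intro: L.less_le_trans[OF _ le_add1]\<close>)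
    moreover have "sat M e E \<psi> \<longleftrightarrow> sat M e E' \<psi>"
      by (rule query_boundD[OF *(2) M]) (use a in \<open>auto intro: L.less_le_trans[OF _ le_add2]\<close>)
    ultimately show "sat M e E (Imp \<phi> \<psi>) \<longleftrightarrow> sat M e E' (Imp \<phi> \<psi>)" by simp
  qed
  then show ?case by blast
next
  case (6 \<phi> t)
  then obtain q where *: "query_bound TYPE('m) \<phi> q" by blast
  have "query_bound TYPE('m) (AllB t \<phi>) (sub_tm (t ## Var) q)"
    unfolding query_bound_def
  proof (intro allI impI)
    fix M :: "'m mdl" and Ss e and E E' :: "nat \<Rightarrow> 'm set"
    assume M: "arith M Ss" and a: "\<forall>X v. lss M v (val M e (sub_tm (t ## Var) q)) \<longrightarrow> (v \<in> E X \<longleftrightarrow> v \<in> E' X)"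
    interpret arith M Ss by fact
    have "sat M (x ## e) E \<phi> \<longleftrightarrow> sat M (x ## e) E' \<phi>" if "lss M x (val M e t)" for x
      by (rule query_bound_step[of q \<phi> e t E E']) (rule query_boundD[OF * M], use a that in auto)
    then show "sat M e E (AllB t \<phi>) \<longleftrightarrow> sat M e E' (AllB t \<phi>)" unfolding sat_AllB by blast
  qed
  then show ?case by blast
next
  case (7 \<phi> t)
  then obtain q where *: "query_bound TYPE('m) \<phi> q" by blast
  have "query_bound TYPE('m) (ExB t \<phi>) (sub_tm (t ## Var) q)"
    unfolding query_bound_def
  proof (intro allI impI)
    fix M :: "'m mdl" and Ss e and E E' :: "nat \<Rightarrow> 'm set"
    assume M: "arith M Ss" and a: "\<forall>X v. lss M v (val M e (sub_tm (t ## Var) q)) \<longrightarrow> (v \<in> E X \<longleftrightarrow> v \<in> E' X)"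
    interpret arith M Ss by fact
    have "sat M (x ## e) E \<phi> \<longleftrightarrow> sat M (x ## e) E' \<phi>" if "lss M x (val M e t)" for x
      by (rule query_bound_step[of q \<phi> e t E E']) (rule query_boundD[OF * M], use a that in auto)
    then show "sat M e E (ExB t \<phi>) \<longleftrightarrow> sat M e E' (ExB t \<phi>)" unfolding sat_ExB by blast
  qed
  then show ?case by blast
qed (auto simp: query_bound_def)

section \<open>Models of recursive comprehension with collection\<close>

text \<open>\<open>RCA0\<close> and Sigma_2 collection reduced to bounded matrices, the form in
  which they are applied. In \<open>ca\<close> the complement is given by a Sigma_1 formula.\<close>

locale base = arith M "sets M" for M :: "'m mdl" +
  assumes s1ind: "bounded \<phi> \<Longrightarrow> range E \<subseteq> sets M \<Longrightarrow> \<exists>y. sat M (y ## zer M ## e) E \<phi> \<Longrightarrow>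
      (\<And>x. \<exists>y. sat M (y ## x ## e) E \<phi> \<Longrightarrow> \<exists>y. sat M (y ## add M x (one M) ## e) E \<phi>) \<Longrightarrow> \<exists>y. sat M (y ## x ## e) E \<phi>"
    and ca: "bounded \<alpha> \<Longrightarrow> bounded \<beta> \<Longrightarrow> range E \<subseteq> sets M \<Longrightarrow>
      (\<And>v. (\<exists>u. sat M (u ## v ## e) E \<alpha>) \<longleftrightarrow> \<not> (\<exists>u. sat M (u ## v ## e) E \<beta>)) \<Longrightarrow>
      \<exists>X\<in>sets M. \<forall>v. v \<in> X \<longleftrightarrow> (\<exists>u. sat M (u ## v ## e) E \<alpha>)"
    and bs2: "bounded \<theta> \<Longrightarrow> range E \<subseteq> sets M \<Longrightarrow> (\<And>x. lss M x m \<Longrightarrow> \<exists>y. \<forall>z. sat M (z ## y ## x ## e) E \<theta>) \<Longrightarrow>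
      \<exists>n. \<forall>x. lss M x m \<longrightarrow> (\<exists>y. lss M y n \<and> (\<forall>z. sat M (z ## y ## x ## e) E \<theta>))"
begin

lemma bounded_ca:
  assumes "bounded \<phi>" "range E \<subseteq> sets M"
  shows "{v. sat M (v ## e) E \<phi>} \<in> sets M"
proof -
  have "\<exists>X\<in>sets M. \<forall>v. v \<in> X \<longleftrightarrow> (\<exists>u. sat M (u ## v ## e) E (lift \<phi>))"
    by (rule ca[of "lift \<phi>" "Neg (lift \<phi>)"])
      (use assms in \<open>auto simp: lift_def intro!: bounded_rules bounded_sub\<close>)
  then obtain X where "X \<in> sets M" "\<forall>v. v \<in> X \<longleftrightarrow> sat M (v ## e) E \<phi>" by auto
  moreover from this have "X = {v. sat M (v ## e) E \<phi>}" by auto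
  ultimately show ?thesis by simp
qed

lemma mul_eq_zero: "a \<otimes> b = \<zero> \<Longrightarrow> a = \<zero> \<or> b = \<zero>"
  using zero_or_succ[of b] zero_or_succ[of a] by (metis ax1 ax6 add_assoc)

lemma le_mul: "d \<noteq> \<zero> \<Longrightarrow> q \<preceq> d \<otimes> q"
  using zero_or_succ[of d] by (metis le_add2 s_mul)

subsection \<open>Pairing\<close>

text \<open>A polynomial pairing, hence available as a term. The value lies between the squares of
  \<open>n + s\<close> and \<open>n + s + 1\<close>, so first the sum and then \<open>n\<close> can
  be read off. It is injective but not onto.\<close>

definition pr :: "'m \<Rightarrow> 'm \<Rightarrow> 'm" where "pr n s = (n \<oplus> s) \<otimes> (n \<oplus> s) \<oplus> n"

lemma pr_le: "n \<preceq> pr n s" "s \<preceq> pr n s"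
proof -
  show "n \<preceq> pr n s" by (simp add: pr_def)
  have "n \<oplus> s \<preceq> (n \<oplus> s) \<otimes> (n \<oplus> s)" using le_mul[of "n \<oplus> s" "n \<oplus> s"] by (cases "n \<oplus> s = \<zero>") auto
  then show "s \<preceq> pr n s" unfolding pr_def by (meson L.order_trans le_add1 le_add2)
qed

lemma pr_less: "n \<oplus> s \<prec> n' \<oplus> s' \<Longrightarrow> pr n s \<prec> pr n' s'"
proof -
  assume "n \<oplus> s \<prec> n' \<oplus> s'"
  then have "(n \<oplus> s) \<oplus> \<one> \<preceq> n' \<oplus> s'" by (simp add: succ_le_iff)
  then have "((n \<oplus> s) \<oplus> \<one>) \<otimes> ((n \<oplus> s) \<oplus> \<one>) \<preceq> (n' \<oplus> s') \<otimes> (n' \<oplus> s')" by (intro mul_mono)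
  then have le: "((n \<oplus> s) \<oplus> \<one>) \<otimes> ((n \<oplus> s) \<oplus> \<one>) \<preceq> pr n' s'" unfolding pr_def by (meson L.order_trans le_add1)
  have "((n \<oplus> s) \<oplus> \<one>) \<otimes> ((n \<oplus> s) \<oplus> \<one>) = pr n s \<oplus> (n \<oplus> s \<oplus> s) \<oplus> \<one>"
    unfolding pr_def by (simp add: algebra_simps)
  then have "pr n s \<prec> ((n \<oplus> s) \<oplus> \<one>) \<otimes> ((n \<oplus> s) \<oplus> \<one>)" using lt_add by metis
  then show ?thesis using le by (rule L.less_le_trans)
qed

lemma pr_inj: "pr n s = pr n' s' \<longleftrightarrow> n = n' \<and> s = s'"
proof
  assume p: "pr n s = pr n' s'"
  then have "n \<oplus> s = n' \<oplus> s'" using pr_less[of n s n' s'] pr_less[of n' s' n s] lt_linear lt_irrefl by metis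
  moreover from this have "n = n'" using p unfolding pr_def by (simp add: add_cancel_left)
  ultimately show "n = n' \<and> s = s'" by (simp add: add_cancel_left)
qed auto

subsection \<open>Coding finite sets by numbers\<close>

definition dv :: "'m \<Rightarrow> 'm \<Rightarrow> bool" where "dv d s \<longleftrightarrow> (\<exists>q. s = d \<otimes> q)"

text \<open>The moduli of Goedel's beta function: those of numbers below \<open>n\<close> are
  pairwise coprime once \<open>m\<close> is divisible by all nonzero numbers below \<open>n\<close>.
  A finite set is coded by a number whose divisors among the moduli belong to its elements.\<close>

definition modu :: "'m \<Rightarrow> 'm \<Rightarrow> 'm" where "modu m x = \<one> \<oplus> (x \<oplus> \<one>) \<otimes> m"

definition code_set :: "'m \<Rightarrow> 'm \<Rightarrow> 'm set" where "code_set s m = {x. dv (modu m x) s}"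

lemma modu_ne: "modu m x \<noteq> \<zero>"
  unfolding modu_def using ax1 add_comm by metis

lemma dv_bounded: "d \<noteq> \<zero> \<Longrightarrow> dv d s \<longleftrightarrow> (\<exists>q. q \<prec> s \<oplus> \<one> \<and> s = d \<otimes> q)"
  unfolding dv_def lt_succ_iff using le_mul by metis

text \<open>Divisibility of a difference without subtraction: if \<open>a \<preceq> b\<close>, the
  equation forces \<open>q\<close> to be zero.\<close>

lemma dv_diff: "d \<otimes> a = q \<oplus> d \<otimes> b \<Longrightarrow> dv d q"
proof -
  assume *: "d \<otimes> a = q \<oplus> d \<otimes> b"
  show "dv d q"
  proof (cases "a \<preceq> b")
    case True
    then have "d \<otimes> a \<preceq> d \<otimes> b" by (intro mul_mono) auto
    then have "q \<oplus> d \<otimes> b \<preceq> \<zero> \<oplus> d \<otimes> b" using * by simp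
    then have "q = \<zero>" by (metis add_cancel L.order_antisym le_add2 z_add)
    then show ?thesis unfolding dv_def by (intro exI[of _ \<zero>]) simp
  next
    case False
    then obtain c where "a = b \<oplus> c" using le_iff by (meson L.nle_le)
    then have "d \<otimes> c \<oplus> d \<otimes> b = q \<oplus> d \<otimes> b" using * by (simp add: distl add_comm)
    then show ?thesis unfolding dv_def using add_cancel by metis
  qed
qed

text \<open>This is coprimality in the form of Euclid's lemma. With \<open>dx\<close>,
  \<open>dy\<close> the two moduli, \<open>(y+1) dx - (x+1) dy = y - x\<close>, so \<open>dy\<close>
  divides \<open>D q\<close> where \<open>D\<close> is the distance of \<open>x\<close> and
  \<open>y\<close>. As \<open>D\<close> divides \<open>m\<close>, and
  \<open>dy q = q + (y+1) m q\<close>, it divides \<open>q\<close>.\<close>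

lemma modu_coprime:
  assumes "x \<noteq> y" "\<And>j. j \<noteq> \<zero> \<Longrightarrow> j \<prec> n \<Longrightarrow> dv j m" "x \<prec> n" "y \<prec> n" "dv (modu m y) (modu m x \<otimes> q)"
  shows "dv (modu m y) q"
proof -
  let ?dx = "modu m x" and ?dy = "modu m y"
  obtain k where k: "?dx \<otimes> q = ?dy \<otimes> k" using assms(5) by (auto simp: dv_def)
  have "\<exists>D. D \<noteq> \<zero> \<and> D \<prec> n \<and> dv ?dy (D \<otimes> q)"
  proof (cases "x \<prec> y")
    case True
    then obtain D where D: "y = x \<oplus> D" using le_iff L.less_imp_le by metis
    have "?dy \<otimes> ((y \<oplus> \<one>) \<otimes> k) = (y \<oplus> \<one>) \<otimes> (?dx \<otimes> q)" using k by (simp add: ac_simps)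
    also have "\<dots> = D \<otimes> q \<oplus> ?dy \<otimes> ((x \<oplus> \<one>) \<otimes> q)" unfolding modu_def D by (simp add: algebra_simps)
    finally have "dv ?dy (D \<otimes> q)" by (rule dv_diff)
    moreover have "D \<preceq> y" "D \<noteq> \<zero>" using D True lt_irrefl by auto
    ultimately show ?thesis using assms(4) L.le_less_trans by blast
  next
    case False
    then have yx: "y \<preceq> x" by auto
    then obtain D where D: "x = y \<oplus> D" using le_iff by metis
    have "?dy \<otimes> ((x \<oplus> \<one>) \<otimes> q) = D \<otimes> q \<oplus> (y \<oplus> \<one>) \<otimes> (?dx \<otimes> q)" unfolding modu_def D by (simp add: algebra_simps)
    also have "\<dots> = D \<otimes> q \<oplus> ?dy \<otimes> ((y \<oplus> \<one>) \<otimes> k)" unfolding k by (simp add: ac_simps)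
    finally have "dv ?dy (D \<otimes> q)" by (rule dv_diff)
    moreover have "D \<preceq> x" "D \<noteq> \<zero>" using D assms(1) by auto
    ultimately show ?thesis using assms(3) L.le_less_trans by blast
  qed
  then obtain D c m' where D: "D \<otimes> q = ?dy \<otimes> c" "m = D \<otimes> m'" using assms(2) unfolding dv_def by metis
  have "?dy \<otimes> q = q \<oplus> (y \<oplus> \<one>) \<otimes> m' \<otimes> (D \<otimes> q)" unfolding modu_def D(2) by (simp add: algebra_simps)
  also have "\<dots> = q \<oplus> ?dy \<otimes> ((y \<oplus> \<one>) \<otimes> m' \<otimes> c)" unfolding D(1) by (simp add: ac_simps)
  finally show ?thesis by (rule dv_diff)
qed

definition DVf :: "tm \<Rightarrow> tm \<Rightarrow> fm" where
  "DVf d s = ExB (Add s One) (Eq (sub_tm shift s) (Mul (sub_tm shift d) (Var 0)))"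

lemma sat_DVf: "val M e d \<noteq> \<zero> \<Longrightarrow> sat M e E (DVf d s) \<longleftrightarrow> dv (val M e d) (val M e s)"
  unfolding DVf_def by (simp add: dv_bounded)

lemma bounded_DVf: "bounded (DVf d s)"
  unfolding DVf_def by (intro bounded_rules)

definition CSf :: "tm \<Rightarrow> tm \<Rightarrow> tm \<Rightarrow> fm" where
  "CSf x s m = DVf (Add One (Mul (Add x One) m)) s"

lemma sat_CSf: "sat M e E (CSf x s m) \<longleftrightarrow> val M e x \<in> code_set (val M e s) (val M e m)"
  unfolding CSf_def code_set_def using modu_ne by (subst sat_DVf) (auto simp: modu_def)

lemma bounded_CSf: "bounded (CSf x s m)"
  unfolding CSf_def by (rule bounded_DVf)

text \<open>A substitute for the factorial, which is not given by a term: Sigma_1 induction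
  multiplies by the next number.\<close>

lemma ex_common_multiple: "\<exists>m. m \<noteq> \<zero> \<and> (\<forall>j. j \<prec> n \<longrightarrow> j \<noteq> \<zero> \<longrightarrow> dv j m)"
proof -
  let ?\<phi> = "And (Neg (Eq (Var 0) Zero)) (AllB (Var 1) (Imp (Neg (Eq (Var 0) Zero)) (DVf (Var 0) (Var 1))))"
  have s: "sat M (m ## n ## E) E' ?\<phi> \<longleftrightarrow> m \<noteq> \<zero> \<and> (\<forall>j. j \<prec> n \<longrightarrow> j \<noteq> \<zero> \<longrightarrow> dv j m)" for m n E E'
    by (auto simp: sat_DVf)
  have "\<exists>m. sat M (m ## n ## (\<lambda>_. \<zero>)) E0 ?\<phi>"
  proof (rule s1ind[OF _ E0])
    show "bounded ?\<phi>" by (intro bounded_rules bounded_DVf)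
    show "\<exists>m. sat M (m ## \<zero> ## (\<lambda>_. \<zero>)) E0 ?\<phi>" unfolding s using ax7 ax1 by metis
    fix x assume "\<exists>y. sat M (y ## x ## (\<lambda>_. \<zero>)) E0 ?\<phi>"
    then obtain m where m: "m \<noteq> \<zero>" "\<And>j. j \<prec> x \<Longrightarrow> j \<noteq> \<zero> \<Longrightarrow> dv j m" unfolding s by blast
    show "\<exists>y. sat M (y ## (x \<oplus> \<one>) ## (\<lambda>_. \<zero>)) E0 ?\<phi>"
    \<comment> \<open>Multiplying by zero would lose \<open>m \<noteq> \<zero>\<close>. Below one
      there is no nonzero number, so \<open>m\<close> can be kept.\<close>
    proof (cases "x = \<zero>")
      case True
      then show ?thesis unfolding s using m ax8 ax7 by (metis (no_types))
    next
      case False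
      have "dv j (m \<otimes> x)" if "j \<prec> x \<oplus> \<one>" "j \<noteq> \<zero>" for j
        using that m(2)[of j] unfolding ax8 dv_def by (metis mul_assoc mul_comm)
      moreover have "m \<otimes> x \<noteq> \<zero>" using False m(1) mul_eq_zero by blast
      ultimately show ?thesis unfolding s by blast
    qed
  qed
  then show ?thesis unfolding s .
qed

text \<open>The least common multiple of the moduli of \<open>X\<close> is a code: the moduli are pairwise coprime, so if the modulus of
  some \<open>x \<notin> X\<close> divided it, the quotient would be a smaller common multiple.\<close>

lemma ex_code:
  assumes X: "X \<in> sets M"
  shows "\<exists>s m. \<forall>x. x \<prec> n \<longrightarrow> (x \<in> code_set s m \<longleftrightarrow> x \<in> X)"
proof -
  obtain m where m: "m \<noteq> \<zero>" "\<And>j. j \<noteq> \<zero> \<Longrightarrow> j \<prec> n \<Longrightarrow> dv j m" using ex_common_multiple by metis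
  let ?E = "\<lambda>_::nat. X"
  have E: "range ?E \<subseteq> sets M" using X by auto
  let ?\<phi> = "And (Neg (Eq (Var 0) Zero)) (AllB (Var 1) (Imp (Mem (Var 0) 0) (CSf (Var 0) (Var 1) (Var 3))))"
  have b: "bounded ?\<phi>" by (intro bounded_rules bounded_CSf)
  have s: "sat M (s ## n ## (\<lambda>_. m)) ?E ?\<phi> \<longleftrightarrow> s \<noteq> \<zero> \<and> (\<forall>x. x \<prec> n \<longrightarrow> x \<in> X \<longrightarrow> dv (modu m x) s)" for s n
    by (auto simp: sat_CSf code_set_def eval_nat_numeral)
  have "\<exists>s. sat M (s ## n ## (\<lambda>_. m)) ?E ?\<phi>"
  proof (rule s1ind[OF b E])
    show "\<exists>y. sat M (y ## \<zero> ## (\<lambda>_. m)) ?E ?\<phi>" unfolding s using ax7 ax1 by metis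
    fix x assume "\<exists>y. sat M (y ## x ## (\<lambda>_. m)) ?E ?\<phi>"
    then obtain t where t: "t \<noteq> \<zero>" "\<And>z. z \<prec> x \<Longrightarrow> z \<in> X \<Longrightarrow> dv (modu m z) t" unfolding s by blast
    have "dv (modu m z) (t \<otimes> modu m x)" if "z \<prec> x \<oplus> \<one>" "z \<in> X" for z
      using that t(2)[of z] unfolding ax8 dv_def by (metis mul_assoc mul_comm)
    moreover have "t \<otimes> modu m x \<noteq> \<zero>" using t(1) modu_ne mul_eq_zero by blast
    ultimately show "\<exists>y. sat M (y ## (x \<oplus> \<one>) ## (\<lambda>_. m)) ?E ?\<phi>" unfolding s by blast
  qed
  then obtain s where "sat M (s ## n ## (\<lambda>_. m)) ?E ?\<phi>"
    "\<forall>t. t \<prec> s \<longrightarrow> \<not> sat M (t ## n ## (\<lambda>_. m)) ?E ?\<phi>"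
    using bounded_least[OF b E, of _ "n ## (\<lambda>_. m)"] by meson
  then have s0: "s \<noteq> \<zero>" "\<And>x. x \<prec> n \<Longrightarrow> x \<in> X \<Longrightarrow> dv (modu m x) s"
    and min: "\<And>t. t \<prec> s \<Longrightarrow> t \<noteq> \<zero> \<Longrightarrow> \<not> (\<forall>x. x \<prec> n \<longrightarrow> x \<in> X \<longrightarrow> dv (modu m x) t)"
    unfolding s by meson+
  have "x \<in> X" if x: "x \<prec> n" "dv (modu m x) s" for x
  proof (rule ccontr)
    assume nX: "x \<notin> X"
    obtain q where q: "s = modu m x \<otimes> q" using x(2) by (auto simp: dv_def)
    then have q0: "q \<noteq> \<zero>" using s0 by auto
    have "modu m x \<otimes> q = q \<oplus> q \<otimes> (x \<oplus> \<one>) \<otimes> m" unfolding modu_def by (simp add: algebra_simps)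
    moreover have "q \<otimes> (x \<oplus> \<one>) \<otimes> m \<noteq> \<zero>" using q0 m(1) ax1 mul_eq_zero by blast
    ultimately have "q \<prec> s" using q by (metis lq_def le_add1 add_cancel_left ax3)
    moreover have "dv (modu m y) q" if "y \<prec> n" "y \<in> X" for y
      by (rule modu_coprime[of x y n m]) (use that x nX m(2) s0(2) q in auto)
    ultimately show False using min q0 by blast
  qed
  then show ?thesis using s0(2) unfolding code_set_def by blast
qed

subsection \<open>Course-of-values recursion\<close>

text \<open>By \<open>loc\<close> the condition at \<open>k\<close> only looks at \<open>X\<close>
  below \<open>k\<close>. Coded approximations that obey the condition up to \<open>n\<close> exist
  by Sigma_1 induction and agree by the least number principle. Hence \<open>k\<close> belongs to
  the set iff some good approximation past \<open>k\<close> contains it, iff all of them do, which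
  is Delta_1.\<close>

lemma recursion:
  assumes b: "bounded \<phi>" and E: "range E \<subseteq> sets M"
    and loc: "\<And>k X X'. (\<And>v. v \<prec> k \<Longrightarrow> v \<in> X \<longleftrightarrow> v \<in> X') \<Longrightarrow> sat M (k ## e) (X ## E) \<phi> \<longleftrightarrow> sat M (k ## e) (X' ## E) \<phi>"
  shows "\<exists>X\<in>sets M. \<forall>k. k \<in> X \<longleftrightarrow> sat M (k ## e) (X ## E) \<phi>"
proof -
  define good where "good Z n \<longleftrightarrow> (\<forall>k. k \<prec> n \<longrightarrow> (k \<in> Z \<longleftrightarrow> sat M (k ## e) (Z ## E) \<phi>))" for Z n
  \<comment> \<open>Set variable 0 becomes membership in the coded set and variable
    \<open>Suc X\<close> becomes \<open>X\<close>, so the set under construction disappears from the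
    environment.\<close>
  define \<delta> where "\<delta> = CSf (Var 0) (Var 3) (Var 2) ## (\<lambda>X. Mem (Var 0) X)"
  define \<phi>' where "\<phi>' = tr 0 \<delta> (ren (0 ## (\<lambda>j. j + 4)) \<phi>)"
  define G where "G = AllB (Var 2) (Iff (CSf (Var 0) (Var 2) (Var 1)) \<phi>')"
  have b\<delta>: "bounded (\<delta> X)" for X
    unfolding \<delta>_def by (cases X) (auto intro: bounded_CSf bounded_rules)
  have bG: "bounded G" unfolding G_def \<phi>'_def by (intro bounded_rules bounded_CSf bounded_tr bounded_sub b b\<delta>)
  have sG: "sat M (m ## s ## n ## e) E G \<longleftrightarrow> good (code_set s m) n" for m s n
  proof -
    have "sat M (k ## m ## s ## n ## e) E \<phi>' \<longleftrightarrow> sat M (k ## e) (code_set s m ## E) \<phi>" for k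
    proof -
      have "(\<lambda>X. {v. sat M (v ## (\<lambda>j. (k ## m ## s ## n ## e) (j + 0))) E (\<delta> X)}) = code_set s m ## E"
        by (auto simp: fun_eq_iff \<delta>_def sat_CSf eval_nat_numeral split: nat.split)
      moreover have "(\<lambda>j. (k ## m ## s ## n ## e) ((0 ## (\<lambda>j. j + 4)) j)) = k ## e"
        by (auto simp: fun_eq_iff eval_nat_numeral split: nat.split)
      moreover have "set_free (ren (0 ## (\<lambda>j. j + 4)) \<phi>)" by (intro bounded_set_free bounded_sub b)
      ultimately show ?thesis unfolding \<phi>'_def by (simp add: sat_tr)
    qed
    then show ?thesis unfolding G_def good_def by (auto simp: sat_CSf eval_nat_numeral)
  qed
  have cs: "code_set s m \<in> sets M" for s m
    using bounded_ca[OF bounded_CSf[of "Var 0" "Var 1" "Var 2"] E0, of "s ## m ## (\<lambda>_. \<zero>)"]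
    by (simp add: sat_CSf eval_nat_numeral)
  have ren_G: "bounded (sub \<sigma> id G)" for \<sigma> using bG by (rule bounded_sub)
  \<comment> \<open>\<open>s1ind\<close> admits one unbounded quantifier, so \<open>s\<close> and
    \<open>m\<close> are both searched below a single \<open>c\<close>.\<close>
  let ?\<phi>1 = "ExB (Var 0) (ExB (Var 1) (ren (0 ## 1 ## 3 ## (\<lambda>j. j + 4)) G))"
  have b1: "bounded ?\<phi>1" by (intro bounded_rules ren_G)
  have s1: "sat M (c ## n ## e) E ?\<phi>1 \<longleftrightarrow> (\<exists>s. s \<prec> c \<and> (\<exists>m. m \<prec> c \<and> good (code_set s m) n))" for c n
  proof -
    have "(\<lambda>j. (m ## s ## c ## n ## e) ((0 ## 1 ## 3 ## (\<lambda>j. j + 4)) j)) = m ## s ## n ## e" for m s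
      by (auto simp: fun_eq_iff eval_nat_numeral split: nat.split)
    then show ?thesis by (simp add: sG)
  qed
  have two: "\<exists>c. s \<prec> c \<and> m \<prec> c" for s m
    by (metis L.le_less_trans le_add1 le_add2 lt_succ)
  have ex: "\<exists>s m. good (code_set s m) n" for n
  proof -
    have "\<exists>c. sat M (c ## n ## e) E ?\<phi>1"
    proof (rule s1ind[OF b1 E])
      show "\<exists>c. sat M (c ## \<zero> ## e) E ?\<phi>1" unfolding s1 good_def using ax7 lt_succ by blast
      fix n assume "\<exists>c. sat M (c ## n ## e) E ?\<phi>1"
      then obtain s m where g: "good (code_set s m) n" unfolding s1 by blast
      let ?Z = "code_set s m"
      let ?t = "sat M (n ## e) (?Z ## E) \<phi>"
      let ?X = "{v. v \<prec> n \<and> v \<in> ?Z \<or> v = n \<and> ?t}"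
      have "{v. v \<prec> n \<and> v \<in> Z \<or> v = n \<and> t} \<in> sets M" if "Z \<in> sets M" for Z t
      proof -
        have E': "range (\<lambda>_::nat. Z) \<subseteq> sets M" using that by auto
        show ?thesis
        \<comment> \<open>\<open>t\<close> is a truth value and not a formula; fixing it leaves a
          bounded definition in which \<open>\<phi>\<close> does not occur.\<close>
        proof (cases t)
          case True
          then have "{v. sat M (v ## (\<lambda>_. n)) (\<lambda>_. Z) (Or (And (Less (Var 0) (Var 1)) (Mem (Var 0) 0)) (Eq (Var 0) (Var 1)))}
            = {v. v \<prec> n \<and> v \<in> Z \<or> v = n \<and> t}" by auto
          moreover have "bounded (Or (And (Less (Var 0) (Var 1)) (Mem (Var 0) 0)) (Eq (Var 0) (Var 1)))"
            by (intro bounded_rules)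
          ultimately show ?thesis using bounded_ca[OF _ E', of _ "\<lambda>_. n"] by force
        next
          case False
          then have "{v. sat M (v ## (\<lambda>_. n)) (\<lambda>_. Z) (And (Less (Var 0) (Var 1)) (Mem (Var 0) 0))}
            = {v. v \<prec> n \<and> v \<in> Z \<or> v = n \<and> t}" by auto
          moreover have "bounded (And (Less (Var 0) (Var 1)) (Mem (Var 0) 0))"
            by (intro bounded_rules)
          ultimately show ?thesis using bounded_ca[OF _ E', of _ "\<lambda>_. n"] by force
        qed
      qed
      from this[OF cs] have "?X \<in> sets M" .
      then obtain s' m' where c: "\<And>x. x \<prec> n \<oplus> \<one> \<Longrightarrow> x \<in> code_set s' m' \<longleftrightarrow> x \<in> ?X" using ex_code by blast
      have agree: "v \<in> code_set s' m' \<longleftrightarrow> v \<in> ?Z" if "v \<prec> n" for v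
        using c[of v] that lt_irrefl by (auto simp: ax8)
      have "k \<in> code_set s' m' \<longleftrightarrow> sat M (k ## e) (code_set s' m' ## E) \<phi>" if "k \<prec> n \<oplus> \<one>" for k
      proof -
        have "sat M (k ## e) (code_set s' m' ## E) \<phi> \<longleftrightarrow> sat M (k ## e) (?Z ## E) \<phi>"
        proof (rule loc)
          fix v assume "v \<prec> k"
          then have "v \<prec> n" using that lt_trans[of v k n] by (auto simp: ax8)
          then show "v \<in> code_set s' m' \<longleftrightarrow> v \<in> ?Z" by (rule agree)
        qed
        moreover have "k \<in> code_set s' m' \<longleftrightarrow> sat M (k ## e) (?Z ## E) \<phi>"
          using that c[of k] g lt_irrefl unfolding good_def ax8 by auto
        ultimately show ?thesis by simp
      qed
      then have "good (code_set s' m') (n \<oplus> \<one>)" by (simp add: good_def)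
      then show "\<exists>c. sat M (c ## (n \<oplus> \<one>) ## e) E ?\<phi>1" unfolding s1 using two by meson
    qed
    then show ?thesis unfolding s1 by blast
  qed
  have uniq: "k \<in> code_set s m \<longleftrightarrow> k \<in> code_set s' m'"
    if g: "good (code_set s m) n" "good (code_set s' m') n'" "k \<prec> n" "k \<prec> n'" for s m s' m' n n' k
  proof (rule ccontr)
    assume neg: "\<not> ?thesis"
    let ?\<psi> = "And (And (Less (Var 0) (Var 1)) (Less (Var 0) (Var 2))) (Neg (Iff (Mem (Var 0) 0) (Mem (Var 0) 1)))"
    let ?E = "code_set s m ## (\<lambda>_. code_set s' m')"
    have "bounded ?\<psi>" by (intro bounded_rules)
    moreover have "range ?E \<subseteq> sets M" using cs by auto
    moreover have s: "sat M (x ## n ## n' ## (\<lambda>_. \<zero>)) ?E ?\<psi> \<longleftrightarrow> x \<prec> n \<and> x \<prec> n' \<and> (x \<in> code_set s m \<longleftrightarrow> x \<notin> code_set s' m')" for x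
      by (auto simp: eval_nat_numeral)
    ultimately obtain x where x: "x \<prec> n" "x \<prec> n'" "x \<in> code_set s m \<longleftrightarrow> x \<notin> code_set s' m'"
      "\<And>y. y \<prec> x \<Longrightarrow> \<not> (y \<prec> n \<and> y \<prec> n' \<and> (y \<in> code_set s m \<longleftrightarrow> y \<notin> code_set s' m'))"
      using bounded_least[of ?\<psi> ?E k "n ## n' ## (\<lambda>_. \<zero>)"] g neg unfolding s by blast
    have "sat M (x ## e) (code_set s m ## E) \<phi> \<longleftrightarrow> sat M (x ## e) (code_set s' m' ## E) \<phi>"
      by (rule loc) (use x lt_trans in blast)
    then show False using g x unfolding good_def by blast
  qed
  \<comment> \<open>\<open>G\<close> at length \<open>k \<oplus> \<one>\<close>, the shortest
    approximation that decides \<open>k\<close>.\<close>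
  define g where "g = sub (Var 0 ## Var 1 ## Add (Var 3) One ## (\<lambda>j. Var (j + 4))) id G"
  let ?D = "CSf (Var 3) (Var 1) (Var 0)"
  let ?\<alpha> = "ExB (Var 0) (ExB (Var 1) (And g ?D))"
  let ?\<beta> = "ExB (Var 0) (ExB (Var 1) (And g (Neg ?D)))"
  have sg: "sat M (m ## s ## c ## k ## e) E g \<longleftrightarrow> good (code_set s m) (k \<oplus> \<one>)" for m s c k
  proof -
    have "(\<lambda>j. val M (m ## s ## c ## k ## e) ((Var 0 ## Var 1 ## Add (Var 3) One ## (\<lambda>j. Var (j + 4))) j)) = m ## s ## (k \<oplus> \<one>) ## e"
      by (auto simp: fun_eq_iff eval_nat_numeral split: nat.split)
    then show ?thesis by (simp only: g_def sat_sub comp_id sG)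
  qed
  have sa: "(\<exists>c. sat M (c ## k ## e) E ?\<alpha>) \<longleftrightarrow> (\<exists>s m. good (code_set s m) (k \<oplus> \<one>) \<and> k \<in> code_set s m)" for k
    using two by (simp add: sg sat_CSf eval_nat_numeral) blast
  have sb: "(\<exists>c. sat M (c ## k ## e) E ?\<beta>) \<longleftrightarrow> (\<exists>s m. good (code_set s m) (k \<oplus> \<one>) \<and> k \<notin> code_set s m)" for k
    using two by (simp add: sg sat_CSf eval_nat_numeral) blast
  have "\<exists>X\<in>sets M. \<forall>k. k \<in> X \<longleftrightarrow> (\<exists>c. sat M (c ## k ## e) E ?\<alpha>)"
  proof (rule ca[OF _ _ E])
    show "bounded ?\<alpha>" "bounded ?\<beta>" unfolding g_def by (intro bounded_rules bounded_CSf ren_G)+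
    show "(\<exists>c. sat M (c ## k ## e) E ?\<alpha>) \<longleftrightarrow> \<not> (\<exists>c. sat M (c ## k ## e) E ?\<beta>)" for k
      unfolding sa sb using ex[of "k \<oplus> \<one>"] uniq lt_succ by blast
  qed
  then obtain X where X: "X \<in> sets M" "\<And>k. k \<in> X \<longleftrightarrow> (\<exists>s m. good (code_set s m) (k \<oplus> \<one>) \<and> k \<in> code_set s m)"
    unfolding sa by blast
  have "k \<in> X \<longleftrightarrow> sat M (k ## e) (X ## E) \<phi>" for k
  proof -
    obtain s m where g: "good (code_set s m) (k \<oplus> \<one>)" using ex by blast
    have agree: "v \<in> X \<longleftrightarrow> v \<in> code_set s m" if "v \<prec> k \<oplus> \<one>" for v
    proof -
      obtain s' m' where g': "good (code_set s' m') (v \<oplus> \<one>)" using ex by blast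
      show ?thesis unfolding X(2) using uniq[OF _ g _ that] g' lt_succ by blast
    qed
    have "sat M (k ## e) (X ## E) \<phi> \<longleftrightarrow> sat M (k ## e) (code_set s m ## E) \<phi>"
      by (rule loc) (use agree ax8 in blast)
    then show ?thesis using agree[of k] g lt_succ unfolding good_def by blast
  qed
  then show ?thesis using X(1) by blast
qed

end

section \<open>The set of rows\<close>

definition PRt :: "tm \<Rightarrow> tm \<Rightarrow> tm" where
  "PRt a b = Add (Mul (Add a b) (Add a b)) a"

primrec conj :: "fm list \<Rightarrow> fm" where
  "conj [] = Neg Fls"
| "conj (\<phi> # \<phi>s) = And \<phi> (conj \<phi>s)"

lemma sat_conj [simp]: "sat M e E (conj \<phi>s) \<longleftrightarrow> (\<forall>\<phi>\<in>set \<phi>s. sat M e E \<phi>)"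
  by (induction \<phi>s) auto

lemma bounded_conj: "(\<And>\<phi>. \<phi> \<in> set \<phi>s \<Longrightarrow> bounded \<phi>) \<Longrightarrow> bounded (conj \<phi>s)"
  by (induction \<phi>s) (auto intro: bounded_rules)

primrec nmu :: "'m mdl \<Rightarrow> nat \<Rightarrow> 'm" where
  "nmu M 0 = zer M"
| "nmu M (Suc n) = add M (nmu M n) (one M)"

text \<open>All variables but \<open>z\<close>, \<open>y\<close>, \<open>x\<close> are set to zero:
  the rows handle statements with a single number parameter, and \<open>block\<close> reduces the
  general case to them.\<close>

definition clo :: "nat \<Rightarrow> tm" where
  "clo = Var 0 ## Var 1 ## Var 2 ## (\<lambda>_. Zero)"

lemma val_clo: "(\<lambda>n. val M (z ## y ## x ## e) (clo n)) = z ## y ## x ## (\<lambda>_. zer M)"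
  by (auto simp: fun_eq_iff clo_def eval_nat_numeral split: nat.split)

context base
begin

lemma val_PRt [simp]: "val M e (PRt a b) = pr (val M e a) (val M e b)"
  by (simp add: PRt_def pr_def)

lemma bs2_finite:
  assumes "finite \<Theta>" "\<And>\<theta>. \<theta> \<in> \<Theta> \<Longrightarrow> bounded \<theta>" "range E \<subseteq> sets M"
    "\<And>\<theta> x. \<theta> \<in> \<Theta> \<Longrightarrow> x \<preceq> c \<Longrightarrow> \<exists>y. \<forall>z. sat M (z ## y ## x ## e) E \<theta>"
  shows "\<exists>u. c \<prec> u \<and> (\<forall>\<theta>\<in>\<Theta>. \<forall>x. x \<preceq> c \<longrightarrow> (\<exists>y. y \<prec> u \<and> (\<forall>z. sat M (z ## y ## x ## e) E \<theta>)))"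
  using assms(1,2,4)
proof (induction \<Theta> rule: finite_induct)
  case empty
  then show ?case using lt_succ by blast
next
  case (insert \<theta> \<Theta>)
  obtain u where u: "c \<prec> u" "\<forall>\<theta>\<in>\<Theta>. \<forall>x. x \<preceq> c \<longrightarrow> (\<exists>y. y \<prec> u \<and> (\<forall>z. sat M (z ## y ## x ## e) E \<theta>))"
    using insert.IH insert.prems by auto
  have "\<exists>n. \<forall>x. x \<prec> c \<oplus> \<one> \<longrightarrow> (\<exists>y. y \<prec> n \<and> (\<forall>z. sat M (z ## y ## x ## e) E \<theta>))"
    by (rule bs2) (use insert.prems assms(3) in \<open>auto simp: lt_succ_iff\<close>)
  then obtain v where v: "\<And>x. x \<preceq> c \<Longrightarrow> \<exists>y. y \<prec> v \<and> (\<forall>z. sat M (z ## y ## x ## e) E \<theta>)"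
    unfolding lt_succ_iff by blast
  have "y \<prec> u \<Longrightarrow> y \<prec> u \<oplus> v" "y \<prec> v \<Longrightarrow> y \<prec> u \<oplus> v" for y
    using L.less_le_trans le_add1 le_add2 by metis+
  then show ?case using u v by (intro exI[of _ "u \<oplus> v"]) (metis insert_iff)
qed

end

text \<open>In \<open>T\<close> the statements are true for every set \<open>X\<close>, because
  \<open>P\<close> is built only later and depends on the list of statements.\<close>

locale rows = base M for M :: "'m mdl" +
  fixes A :: "'m set" and \<Theta> :: "fm list" and q :: "fm \<Rightarrow> tm" and c0 :: 'm
  assumes A: "A \<in> sets M" and \<Theta>: "\<And>\<theta>. \<theta> \<in> set \<Theta> \<Longrightarrow> bounded \<theta>"
    and q: "\<And>\<theta>. \<theta> \<in> set \<Theta> \<Longrightarrow> query_bound TYPE('m) \<theta> (q \<theta>)"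
    and T: "\<And>\<theta> X x. \<theta> \<in> set \<Theta> \<Longrightarrow> X \<in> sets M \<Longrightarrow> \<exists>y. \<forall>z. sat M (z ## y ## x ## (\<lambda>_. zer M)) (X ## (\<lambda>_. A)) \<theta>"
begin

abbreviation en :: "'m \<Rightarrow> 'm \<Rightarrow> 'm \<Rightarrow> nat \<Rightarrow> 'm" where "en z y x \<equiv> z ## y ## x ## (\<lambda>_. zer M)"

definition pvis :: "'m set \<Rightarrow> 'm \<Rightarrow> 'm \<Rightarrow> 'm \<Rightarrow> bool" where
  "pvis P n t s \<longleftrightarrow> pr n t \<prec> s \<and> pr n t \<in> P"

text \<open>Row zero of \<open>P\<close> will be empty; \<open>c0\<close> is treated as its only
  element and starts the recursion.\<close>

definition vis :: "'m set \<Rightarrow> 'm \<Rightarrow> 'm \<Rightarrow> 'm \<Rightarrow> bool" where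
  "vis P n t s \<longleftrightarrow> n = \<zero> \<and> t = c0 \<or> pvis P n t s"

text \<open>The guard on \<open>q \<theta>\<close> makes the condition at stage \<open>s\<close> depend only on \<open>P\<close> below \<open>s\<close>.\<close>

definition suff :: "'m set \<Rightarrow> 'm \<Rightarrow> 'm \<Rightarrow> 'm \<Rightarrow> fm \<Rightarrow> bool" where
  "suff P t c s \<theta> \<longleftrightarrow> (\<forall>x. x \<preceq> t \<longrightarrow> (\<exists>y. y \<prec> c \<and>
    (\<forall>z. z \<prec> s \<longrightarrow> val M (en z y x) (q \<theta>) \<preceq> s \<longrightarrow> sat M (en z y x) (P ## (\<lambda>_. A)) \<theta>)))"

definition okay :: "'m set \<Rightarrow> 'm \<Rightarrow> 'm \<Rightarrow> 'm \<Rightarrow> bool" where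
  "okay P n c s \<longleftrightarrow> (\<forall>t. vis P n t s \<longrightarrow> t \<prec> c \<and> (\<forall>\<theta>\<in>set \<Theta>. suff P t c s \<theta>))"

text \<open>At such a stage no visible element of row \<open>n + 1\<close> is acceptable as a bound
  for what is visible of row \<open>n\<close>; the number \<open>s\<close> itself is then put into
  every row above \<open>n\<close>.\<close>

definition act :: "'m set \<Rightarrow> 'm \<Rightarrow> 'm \<Rightarrow> bool" where
  "act P n s \<longleftrightarrow> \<not> (\<exists>c. c \<prec> s \<and> pvis P (n \<oplus> \<one>) c s \<and> okay P n c s)"

lemma okay_mono: "okay P n c s \<Longrightarrow> c \<preceq> c' \<Longrightarrow> okay P n c' s"
  unfolding okay_def suff_def using L.less_le_trans by meson

lemma vis_bound: "vis P n t s \<Longrightarrow> t \<prec> s \<oplus> c0 \<oplus> \<one>"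
  unfolding vis_def pvis_def lt_succ_iff using pr_le(2)
  by (metis L.le_less_trans L.less_imp_le L.order_trans le_add1 le_add2)

definition PVf :: "tm \<Rightarrow> tm \<Rightarrow> tm \<Rightarrow> fm" where
  "PVf a b s = And (Less (PRt a b) s) (Mem (PRt a b) 0)"

definition THf :: "fm \<Rightarrow> fm" where
  "THf \<theta> = AllB (Add (Var 0) One) (ExB (Var 2) (AllB (Var 5)
    (Imp (Less (sub_tm clo (q \<theta>)) (Add (Var 6) One)) (sub clo id \<theta>))))"

text \<open>\<open>c0\<close> is read from the tail of the environment, at index 5 or 6 according to
  the depth. The range of \<open>t\<close> is bounded as in \<open>vis_bound\<close>.\<close>

definition ACTf :: fm where
  "ACTf = Neg (ExB (Var 1) (And (PVf (Add (Var 1) One) (Var 0) (Var 2))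
    (AllB (Add (Add (Var 2) (Var 5)) One)
      (Imp (Or (And (Eq (Var 2) Zero) (Eq (Var 0) (Var 6))) (PVf (Var 2) (Var 0) (Var 3)))
        (And (Less (Var 0) (Var 1)) (conj (map THf \<Theta>)))))))"

definition ROWf :: fm where
  "ROWf = ExB (Add (Var 0) One) (ExB (Add (Var 1) One)
    (And (Eq (Var 2) (PRt (Var 1) (Var 0))) (ExB (Var 1) ACTf)))"

lemma bounded_THf: "\<theta> \<in> set \<Theta> \<Longrightarrow> bounded (THf \<theta>)"
  unfolding THf_def by (intro bounded_rules bounded_sub \<Theta>)

lemma bounded_ROWf: "bounded ROWf"
  unfolding ROWf_def ACTf_def PVf_def
  by (intro bounded_rules bounded_conj) (auto intro: bounded_THf)

lemma sat_PVf: "sat M e E (PVf a b s) \<longleftrightarrow> pvis (E 0) (val M e a) (val M e b) (val M e s)"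
  by (simp add: PVf_def pvis_def)

lemma sat_THf: "sat M (t ## c ## n ## s ## e) (P ## (\<lambda>_. A)) (THf \<theta>) \<longleftrightarrow> suff P t c s \<theta>"
  unfolding THf_def suff_def by (simp add: val_clo eval_nat_numeral lt_succ_iff)

lemma sat_ACTf: "sat M (n ## s ## m ## k ## (\<lambda>_. c0)) (P ## (\<lambda>_. A)) ACTf \<longleftrightarrow> act P n s"
proof -
  have 1: "sat M (t ## c ## n ## s ## m ## k ## (\<lambda>_. c0)) (P ## (\<lambda>_. A))
      (Imp (Or (And (Eq (Var 2) Zero) (Eq (Var 0) (Var 6))) (PVf (Var 2) (Var 0) (Var 3)))
        (And (Less (Var 0) (Var 1)) (conj (map THf \<Theta>)))) \<longleftrightarrow>
      (vis P n t s \<longrightarrow> t \<prec> c \<and> (\<forall>\<theta>\<in>set \<Theta>. suff P t c s \<theta>))" for t c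
    by (auto simp: sat_THf sat_PVf vis_def eval_nat_numeral)
  have 2: "sat M (c ## n ## s ## m ## k ## (\<lambda>_. c0)) (P ## (\<lambda>_. A)) (AllB (Add (Add (Var 2) (Var 5)) One)
      (Imp (Or (And (Eq (Var 2) Zero) (Eq (Var 0) (Var 6))) (PVf (Var 2) (Var 0) (Var 3)))
        (And (Less (Var 0) (Var 1)) (conj (map THf \<Theta>))))) \<longleftrightarrow> okay P n c s" for c
    unfolding okay_def sat_AllB 1 using vis_bound[of P n _ s]
    by (auto simp: eval_nat_numeral)
  have 3: "sat M e E (And \<phi> \<psi>) \<longleftrightarrow> sat M e E \<phi> \<and> sat M e E \<psi>" for e E \<phi> \<psi> by simp
  have 4: "sat M e E (Neg \<phi>) \<longleftrightarrow> \<not> sat M e E \<phi>" for e E \<phi> by simp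
  show ?thesis unfolding ACTf_def act_def 4[of _ _ "ExB _ _"] sat_ExB 3 2 by (simp add: sat_PVf eval_nat_numeral)
qed

lemma sat_ROWf: "sat M (k ## (\<lambda>_. c0)) (P ## (\<lambda>_. A)) ROWf \<longleftrightarrow> (\<exists>m s. k = pr m s \<and> (\<exists>n. n \<prec> m \<and> act P n s))"
  unfolding ROWf_def using pr_le by (simp add: sat_ACTf lt_succ_iff eval_nat_numeral) blast

text \<open>Stage \<open>s\<close> inspects \<open>P\<close> only below \<open>s\<close>, by the
  guard in \<open>suff\<close> and by \<open>pvis\<close>. As \<open>s \<preceq> pr m s\<close>,
  this is the locality that \<open>recursion\<close> demands.\<close>

lemma act_local:
  assumes "\<And>v. v \<prec> s \<Longrightarrow> v \<in> P \<longleftrightarrow> v \<in> P'"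
  shows "act P n s \<longleftrightarrow> act P' n s"
proof -
  have 1: "pvis P n t s \<longleftrightarrow> pvis P' n t s" for n t unfolding pvis_def using assms by blast
  have 2: "sat M (en z y x) (P ## (\<lambda>_. A)) \<theta> \<longleftrightarrow> sat M (en z y x) (P' ## (\<lambda>_. A)) \<theta>"
    if "\<theta> \<in> set \<Theta>" "val M (en z y x) (q \<theta>) \<preceq> s" for x y z \<theta>
    by (rule query_boundD[OF q[OF that(1)] arith_axioms])
      (use that assms L.less_le_trans in \<open>auto split: nat.split\<close>)
  have "suff P t c s \<theta> \<longleftrightarrow> suff P' t c s \<theta>" if "\<theta> \<in> set \<Theta>" for t c \<theta>
    unfolding suff_def using 2[OF that] by meson
  then show ?thesis unfolding act_def okay_def vis_def 1 by simp
qed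

text \<open>Letting \<open>n\<close> range over all numbers below \<open>m\<close> makes the rows
  increase with \<open>m\<close>, so an element of one row lies in all later rows, those of
  nonstandard index included.\<close>

lemma ex_row_set: "\<exists>P\<in>sets M. \<forall>m s. pr m s \<in> P \<longleftrightarrow> (\<exists>n. n \<prec> m \<and> act P n s)"
proof -
  have "\<exists>P\<in>sets M. \<forall>k. k \<in> P \<longleftrightarrow> sat M (k ## (\<lambda>_. c0)) (P ## (\<lambda>_. A)) ROWf"
  proof (rule recursion[OF bounded_ROWf])
    show "range (\<lambda>_::nat. A) \<subseteq> sets M" using A by auto
    fix k X X' assume *: "\<And>v. v \<prec> k \<Longrightarrow> v \<in> X \<longleftrightarrow> v \<in> X'"
    have "act X n s \<longleftrightarrow> act X' n s" if "k = pr m s" for m n s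
      by (rule act_local) (use * that pr_le(2) L.less_le_trans in blast)
    then show "sat M (k ## (\<lambda>_. c0)) (X ## (\<lambda>_. A)) ROWf \<longleftrightarrow> sat M (k ## (\<lambda>_. c0)) (X' ## (\<lambda>_. A)) ROWf"
      unfolding sat_ROWf by blast
  qed
  then obtain P where P: "P \<in> sets M" "\<And>k. k \<in> P \<longleftrightarrow> (\<exists>m s. k = pr m s \<and> (\<exists>n. n \<prec> m \<and> act P n s))"
    unfolding sat_ROWf by blast
  have "pr m s \<in> P \<longleftrightarrow> (\<exists>n. n \<prec> m \<and> act P n s)" for m s
    unfolding P(2)[of "pr m s"] pr_inj by blast
  then show ?thesis using P(1) by blast
qed

end

locale row_set = rows M A \<Theta> q c0 for M :: "'m mdl" and A \<Theta> q c0 +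
  fixes P :: "'m set"
  assumes P: "P \<in> sets M" and row: "\<And>m s. pr m s \<in> P \<longleftrightarrow> (\<exists>n. n \<prec> m \<and> act P n s)"
begin

lemma PA: "range (P ## (\<lambda>_. A)) \<subseteq> sets M" using A P by auto

lemma row_zero: "pr \<zero> s \<notin> P" unfolding row using ax7 by blast

lemma row_Suc: "pr (n \<oplus> \<one>) s \<in> P \<longleftrightarrow> pr n s \<in> P \<or> act P n s"
  unfolding row ax8 by blast

text \<open>The last element of a row that has settled. The index is a standard number, since rows
  are shown to settle by recursion in the metatheory.\<close>

definition lim_row :: "nat \<Rightarrow> 'm \<Rightarrow> bool" where
  "lim_row n c \<longleftrightarrow> (if n = 0 then c = c0 else pr (nmu M n) c \<in> P) \<and> (\<forall>s. c \<prec> s \<longrightarrow> pr (nmu M n) s \<notin> P)"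

lemma lim_row_vis: "lim_row n c \<Longrightarrow> vis P (nmu M n) t s \<Longrightarrow> t \<preceq> c"
proof (cases n)
  case 0
  assume "lim_row n c" "vis P (nmu M n) t s"
  then show ?thesis using 0 row_zero by (auto simp: lim_row_def vis_def pvis_def)
next
  case (Suc k)
  assume "lim_row n c" "vis P (nmu M n) t s"
  then have "pr (nmu M n) t \<in> P" using Suc ax1 by (auto simp: vis_def pvis_def)
  then show ?thesis using \<open>lim_row n c\<close> unfolding lim_row_def by (meson L.not_le)
qed

lemma lim_row_large: "lim_row n c \<Longrightarrow> \<exists>S. \<forall>s. S \<prec> s \<longrightarrow> vis P (nmu M n) c s"
  by (cases n) (auto simp: lim_row_def vis_def pvis_def)

text \<open>Sigma_2 collection gives \<open>u\<close> above true witnesses for all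
  \<open>x \<preceq> c\<close>. An element at or above \<open>u\<close> can never be refuted, so
  once one is visible, row \<open>n + 1\<close> stops growing. Its maximum \<open>c'\<close> is
  acceptable at all later stages, and in the limit this becomes truth.\<close>

lemma lim_row_step:
  assumes c: "lim_row n c"
  shows "\<exists>c'. lim_row (Suc n) c' \<and> c \<prec> c' \<and>
    (\<forall>\<theta>\<in>set \<Theta>. \<forall>x. x \<preceq> c \<longrightarrow> (\<exists>y. y \<prec> c' \<and> (\<forall>z. sat M (en z y x) (P ## (\<lambda>_. A)) \<theta>)))"
proof -
  let ?n = "nmu M n"
  obtain u where u: "c \<prec> u"
    "\<And>\<theta> x. \<theta> \<in> set \<Theta> \<Longrightarrow> x \<preceq> c \<Longrightarrow> \<exists>y. y \<prec> u \<and> (\<forall>z. sat M (en z y x) (P ## (\<lambda>_. A)) \<theta>)"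
    using bs2_finite[of "set \<Theta>" "P ## (\<lambda>_. A)" c "\<lambda>_. \<zero>"] \<Theta> T P PA by auto
  have "\<exists>B. \<forall>s. pr (?n \<oplus> \<one>) s \<in> P \<longrightarrow> s \<prec> B"
  proof (cases "\<exists>s. pr (?n \<oplus> \<one>) s \<in> P \<and> u \<preceq> s")
    case True
    then obtain s0 where s0: "pr (?n \<oplus> \<one>) s0 \<in> P" "u \<preceq> s0" by blast
    have "pr (?n \<oplus> \<one>) s \<notin> P" if s: "pr (?n \<oplus> \<one>) s0 \<oplus> c \<oplus> \<one> \<preceq> s" for s
    proof -
      have l: "pr (?n \<oplus> \<one>) s0 \<prec> s" "c \<prec> s"
        using s unfolding succ_le_iff by (meson L.le_less_trans le_add1 le_add2)+
      have "okay P ?n s0 s"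
        unfolding okay_def
      proof (intro allI impI conjI ballI)
        fix t assume t: "vis P ?n t s"
        then have tc: "t \<preceq> c" using lim_row_vis c by blast
        then show "t \<prec> s0" using u(1) s0(2) L.le_less_trans L.less_le_trans by blast
        fix \<theta> assume "\<theta> \<in> set \<Theta>"
        then have "\<exists>y. y \<prec> s0 \<and> (\<forall>z. sat M (en z y x) (P ## (\<lambda>_. A)) \<theta>)" if "x \<preceq> t" for x
          using that u(2)[of \<theta> x] tc s0(2) L.order_trans L.less_le_trans by meson
        then show "suff P t s0 s \<theta>" unfolding suff_def by blast
      qed
      moreover have "s0 \<prec> s" using l(1) pr_le(2) L.le_less_trans by blast
      ultimately have "\<not> act P ?n s" unfolding act_def pvis_def using l(1) s0(1) by blast
      moreover have "pr ?n s \<notin> P" using c l(2) by (auto simp: lim_row_def)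
      ultimately show ?thesis unfolding row_Suc by blast
    qed
    then show ?thesis by (meson L.not_le)
  next
    case False
    then show ?thesis by (meson L.not_le)
  qed
  then obtain B where B: "\<And>s. pr (?n \<oplus> \<one>) s \<in> P \<Longrightarrow> s \<prec> B" by blast
  \<comment> \<open>At stage zero nothing is visible, so zero enters and the row is not
    empty.\<close>
  have "act P ?n \<zero>" unfolding act_def using ax7 by blast
  then have "pr (?n \<oplus> \<one>) \<zero> \<in> P" unfolding row_Suc by blast
  then obtain c' where c': "pr (?n \<oplus> \<one>) c' \<in> P" "\<And>s. c' \<prec> s \<Longrightarrow> pr (?n \<oplus> \<one>) s \<notin> P"
    using bounded_max[of "Mem (PRt (Var 1) (Var 0)) 0" "P ## (\<lambda>_. A)" \<zero> "\<lambda>_. ?n \<oplus> \<one>" B] PA B bounded.intros(3) by auto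
  have lim: "lim_row (Suc n) c'" using c' by (simp add: lim_row_def)
  have ok: "okay P ?n c' s" if "c' \<prec> s" for s
  proof -
    \<comment> \<open>After its maximum the row does not act, so some visible \<open>d\<close> is
      acceptable; \<open>d \<preceq> c'\<close>, and acceptability passes to larger numbers.\<close>
    have "\<not> act P ?n s" using c'(2)[OF that] row_Suc by blast
    then obtain d where "pvis P (?n \<oplus> \<one>) d s" "okay P ?n d s" unfolding act_def by blast
    moreover from this have "d \<preceq> c'" using c'(2) unfolding pvis_def by (meson L.not_le)
    ultimately show ?thesis using okay_mono by blast
  qed
  obtain S where S: "\<And>s. S \<prec> s \<Longrightarrow> vis P ?n c s" using lim_row_large[OF c] by blast
  have big: "\<exists>s. S \<prec> s \<and> c' \<prec> s \<and> w \<preceq> s \<and> b \<preceq> s" for w b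
  proof -
    have "S \<preceq> S \<oplus> c' \<oplus> w \<oplus> b" "c' \<preceq> S \<oplus> c' \<oplus> w \<oplus> b" "w \<preceq> S \<oplus> c' \<oplus> w \<oplus> b" "b \<preceq> S \<oplus> c' \<oplus> w \<oplus> b"
      by (meson L.order_trans le_add1 le_add2)+
    then show ?thesis by (intro exI[of _ "S \<oplus> c' \<oplus> w \<oplus> b \<oplus> \<one>"]) (auto simp: lt_succ_iff lq_def[of _ "_ \<oplus> \<one>"])
  qed
  have cc: "c \<prec> c'" using big[of \<zero> \<zero>] ok S unfolding okay_def by blast
  have "\<exists>y. y \<prec> c' \<and> (\<forall>z. sat M (en z y x) (P ## (\<lambda>_. A)) \<theta>)" if th: "\<theta> \<in> set \<Theta>" "x \<preceq> c" for \<theta> x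
  proof -
    show ?thesis
    proof (rule coll_swap)
      show "bounded \<theta>" using \<Theta> th by blast
      show "range (P ## (\<lambda>_. A)) \<subseteq> sets M" by (rule PA)
      fix w
      \<comment> \<open>Late enough that \<open>c\<close> is visible and, by monotonicity of terms,
        that the guard on \<open>q \<theta>\<close> holds for all \<open>z \<prec> w\<close> and
        \<open>y \<prec> c'\<close>.\<close>
      obtain s where s: "S \<prec> s" "c' \<prec> s" "w \<preceq> s" "val M (en w c' x) (q \<theta>) \<preceq> s" using big by blast
      then obtain y where y: "y \<prec> c'" "\<And>z. z \<prec> s \<Longrightarrow> val M (en z y x) (q \<theta>) \<preceq> s \<Longrightarrow> sat M (en z y x) (P ## (\<lambda>_. A)) \<theta>"
        using ok[OF s(2)] S[OF s(1)] th unfolding okay_def suff_def by blast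
      have "sat M (en z y x) (P ## (\<lambda>_. A)) \<theta>" if "z \<prec> w" for z
      proof (rule y(2))
        show "z \<prec> s" using that s(3) by (rule L.less_le_trans)
        have "val M (en z y x) (q \<theta>) \<preceq> val M (en w c' x) (q \<theta>)"
          by (rule val_mono) (use that y(1) in \<open>auto simp: lq_def split: nat.split\<close>)
        then show "val M (en z y x) (q \<theta>) \<preceq> s" using s(4) by (rule L.order_trans)
      qed
      then show "\<exists>y. y \<prec> c' \<and> (\<forall>z. z \<prec> w \<longrightarrow> sat M (en z y x) (P ## (\<lambda>_. A)) \<theta>)"
        using y(1) by auto
    qed
  qed
  then show ?thesis using lim cc by blast
qed

end

theorem (in base) ex_rows:
  assumes "A \<in> sets M" "finite \<Theta>" "\<And>\<theta>. \<theta> \<in> \<Theta> \<Longrightarrow> bounded \<theta>"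
    "\<And>\<theta> X x. \<theta> \<in> \<Theta> \<Longrightarrow> X \<in> sets M \<Longrightarrow> \<exists>y. \<forall>z. sat M (z ## y ## x ## (\<lambda>_. zer M)) (X ## (\<lambda>_. A)) \<theta>"
  obtains P c where "P \<in> sets M" "c 0 = c0" "\<And>n. c n \<prec> c (Suc n)"
    "\<And>n m. nmu M n \<prec> m \<Longrightarrow> pr m (c (Suc n)) \<in> P" "\<And>n s. c n \<prec> s \<Longrightarrow> pr (nmu M n) s \<notin> P"
    "\<And>n \<theta> x. \<theta> \<in> \<Theta> \<Longrightarrow> x \<preceq> c n \<Longrightarrow>
      \<exists>y. y \<prec> c (Suc n) \<and> (\<forall>z. sat M (z ## y ## x ## (\<lambda>_. zer M)) (P ## (\<lambda>_. A)) \<theta>)"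
proof -
  obtain \<Theta>' where \<Theta>': "set \<Theta>' = \<Theta>" using assms(2) finite_list by blast
  have "\<exists>q. \<forall>\<theta>\<in>\<Theta>. query_bound TYPE('m) \<theta> (q \<theta>)" using ex_query_bound assms(3) by metis
  then obtain q where q: "\<And>\<theta>. \<theta> \<in> \<Theta> \<Longrightarrow> query_bound TYPE('m) \<theta> (q \<theta>)" by blast
  have b: "\<And>\<theta>. \<theta> \<in> set \<Theta>' \<Longrightarrow> bounded \<theta>"
    and q': "\<And>\<theta>. \<theta> \<in> set \<Theta>' \<Longrightarrow> query_bound TYPE('m) \<theta> (q \<theta>)"
    and T: "\<And>\<theta> X x. \<theta> \<in> set \<Theta>' \<Longrightarrow> X \<in> sets M \<Longrightarrow> \<exists>y. \<forall>z. sat M (z ## y ## x ## (\<lambda>_. zer M)) (X ## (\<lambda>_. A)) \<theta>"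
    using assms q \<Theta>' by auto
  interpret rows M A \<Theta>' q c0 using assms(1) b q' T by unfold_locales auto
  obtain P where PP: "P \<in> sets M" "\<And>m s. pr m s \<in> P \<longleftrightarrow> (\<exists>n. n \<prec> m \<and> act P n s)"
    using ex_row_set by blast
  interpret row_set M A \<Theta>' q c0 P using PP by unfold_locales auto
  have zero: "lim_row 0 c0" using row_zero by (simp add: lim_row_def)
  note step = lim_row_step[unfolded \<Theta>']
  have "\<exists>c. \<forall>n. (lim_row n (c n) \<and> (n = 0 \<longrightarrow> c n = c0)) \<and> (c n \<prec> c (Suc n) \<and>
    (\<forall>\<theta>\<in>\<Theta>. \<forall>x. x \<preceq> c n \<longrightarrow> (\<exists>y. y \<prec> c (Suc n) \<and> (\<forall>z. sat M (z ## y ## x ## (\<lambda>_. zer M)) (P ## (\<lambda>_. A)) \<theta>))))"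
    by (rule dependent_nat_choice) (use zero step in auto)
  then obtain c where "\<forall>n. (lim_row n (c n) \<and> (n = 0 \<longrightarrow> c n = c0)) \<and> (c n \<prec> c (Suc n) \<and>
    (\<forall>\<theta>\<in>\<Theta>. \<forall>x. x \<preceq> c n \<longrightarrow> (\<exists>y. y \<prec> c (Suc n) \<and> (\<forall>z. sat M (z ## y ## x ## (\<lambda>_. zer M)) (P ## (\<lambda>_. A)) \<theta>))))" ..
  then have c: "\<And>n. lim_row n (c n)" "c 0 = c0" "\<And>n. c n \<prec> c (Suc n)"
    "\<And>n. \<forall>\<theta>\<in>\<Theta>. \<forall>x. x \<preceq> c n \<longrightarrow> (\<exists>y. y \<prec> c (Suc n) \<and> (\<forall>z. sat M (z ## y ## x ## (\<lambda>_. zer M)) (P ## (\<lambda>_. A)) \<theta>))"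
    by simp_all
  have 1: "pr m (c (Suc n)) \<in> P" if "nmu M n \<prec> m" for m n
  proof -
    have "pr (nmu M n \<oplus> \<one>) (c (Suc n)) \<in> P" using c(1)[of "Suc n"] by (simp add: lim_row_def)
    moreover have "nmu M n \<oplus> \<one> \<preceq> m" using that by (simp add: succ_le_iff)
    ultimately show ?thesis unfolding PP(2) by (meson L.less_le_trans)
  qed
  have 2: "pr (nmu M n) s \<notin> P" if "c n \<prec> s" for n s
    using c(1)[of n] that by (simp add: lim_row_def)
  have 3: "\<exists>y. y \<prec> c (Suc n) \<and> (\<forall>z. sat M (z ## y ## x ## (\<lambda>_. zer M)) (P ## (\<lambda>_. A)) \<theta>)"
    if "\<theta> \<in> \<Theta>" "x \<preceq> c n" for n \<theta> x using c(4)[of n] that by simp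
  show ?thesis by (rule that[OF PP(1) c(2,3) 1 2 3])
qed

section \<open>Models of the axioms\<close>

definition basic_fms :: "fm set" where
  "basic_fms = 
    {Neg (Eq (Add (Var 0) One) Zero),
     Imp (Eq (Add (Var 0) One) (Add (Var 1) One)) (Eq (Var 0) (Var 1)),
     Eq (Add (Var 0) Zero) (Var 0),
     Eq (Add (Var 0) (Add (Var 1) One)) (Add (Add (Var 0) (Var 1)) One),
     Eq (Mul (Var 0) Zero) Zero,
     Eq (Mul (Var 0) (Add (Var 1) One)) (Add (Mul (Var 0) (Var 1)) (Var 0)),
     Neg (Less (Var 0) Zero),
     Iff (Less (Var 0) (Add (Var 1) One)) (Or (Less (Var 0) (Var 1)) (Eq (Var 0) (Var 1)))}"

lemma basic_axioms_eq: "basic_axioms = univ_closure ` basic_fms"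
  unfolding basic_axioms_def basic_fms_def ..

lemma arithI:
  fixes M :: "'m mdl"
  assumes dom: "dom M = UNIV" and ne: "Ss \<noteq> {}"
    and basic: "\<And>\<phi> e. \<phi> \<in> basic_fms \<Longrightarrow> sat M e E \<phi>"
    and ind: "\<And>\<phi> e E. bounded \<phi> \<Longrightarrow> range E \<subseteq> Ss \<Longrightarrow> sat M e E (ind_inst \<phi>)"
    and bnd: "\<And>\<phi> e E. bounded \<phi> \<Longrightarrow> range E \<subseteq> Ss \<Longrightarrow> sat M e E (bnd_inst \<phi>)"
  shows "arith M Ss"
proof
  show "dom M = UNIV" "Ss \<noteq> {}" by fact+
  fix x y m
  have b: "\<forall>\<phi>\<in>basic_fms. sat M (x ## y ## (\<lambda>_. zer M)) E \<phi>" using basic by blast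
  show "add M x (one M) \<noteq> zer M" "add M x (one M) = add M y (one M) \<Longrightarrow> x = y"
    "add M x (zer M) = x" "add M x (add M y (one M)) = add M (add M x y) (one M)"
    "mul M x (zer M) = zer M" "mul M x (add M y (one M)) = add M (mul M x y) x"
    "\<not> lss M x (zer M)" "lss M x (add M y (one M)) \<longleftrightarrow> lss M x y \<or> x = y"
    using b by (auto simp: basic_fms_def)
  fix \<phi> e and E :: "nat \<Rightarrow> 'm set" assume \<phi>: "bounded \<phi>" "range E \<subseteq> Ss"
  show "sat M (zer M ## e) E \<phi> \<Longrightarrow> (\<And>x. sat M (x ## e) E \<phi> \<Longrightarrow> sat M (add M x (one M) ## e) E \<phi>) \<Longrightarrow> sat M (x ## e) E \<phi>"
    using ind[OF \<phi>] unfolding sat_ind_inst dom by blast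
  assume *: "\<And>x. lss M x m \<Longrightarrow> \<exists>y. sat M (y ## x ## e) E \<phi>"
  \<comment> \<open>The axiom assumes witnesses for all \<open>i\<close>; with the guard
    \<open>i < m\<close> any number is a witness outside the range.\<close>
  let ?\<phi> = "Imp (Less (Var 1) (Var 2)) (ren (0 ## 1 ## (\<lambda>n. n + 3)) \<phi>)"
  have "(\<lambda>n. (j ## i ## m ## e) ((0 ## 1 ## (\<lambda>n. n + 3)) n)) = j ## i ## e" for i j
    by (auto simp: fun_eq_iff eval_nat_numeral split: nat.split)
  then have s: "sat M (j ## i ## m ## e) E ?\<phi> \<longleftrightarrow> (lss M i m \<longrightarrow> sat M (j ## i ## e) E \<phi>)" for i j
    by (simp add: numeral_2_eq_2)
  have 1: "sat M (m ## e) E (bnd_inst ?\<phi>)" by (intro bnd bounded_rules bounded_sub \<phi>)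
  have 2: "\<forall>i\<in>dom M. \<exists>j\<in>dom M. lss M i m \<longrightarrow> sat M (j ## i ## e) E \<phi>" using * dom by blast
  have "m \<in> dom M" by (simp add: dom)
  from bspec[OF mp[OF 1[unfolded sat_bnd_inst s] 2] this]
  obtain n where "\<forall>i\<in>dom M. lss M i m \<longrightarrow> (\<exists>j\<in>dom M. lss M j n \<and> (lss M i m \<longrightarrow> sat M (j ## i ## e) E \<phi>))" ..
  then have "\<forall>x. lss M x m \<longrightarrow> (\<exists>y. lss M y n \<and> sat M (y ## x ## e) E \<phi>)" by (auto simp: dom)
  then show "\<exists>n. \<forall>x. lss M x m \<longrightarrow> (\<exists>y. lss M y n \<and> sat M (y ## x ## e) E \<phi>)" ..
qed

lemma Sigma0_1_bounded: "bounded \<phi> \<Longrightarrow> Sigma0 1 \<phi>"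
  using Sigma0_Pi0.intros(2,3) by (metis One_nat_def)

lemma Pi0_1_bounded: "bounded \<phi> \<Longrightarrow> Pi0 1 \<phi>"
  using Sigma0_Pi0.intros(1,5) by (metis One_nat_def)

lemma Sigma0_2_bounded: "bounded \<phi> \<Longrightarrow> Sigma0 2 \<phi>"
  using Pi0_1_bounded Sigma0_Pi0.intros(3) by (metis One_nat_def numeral_2_eq_2)

lemma Sigma0_2_All: "bounded \<phi> \<Longrightarrow> Sigma0 2 (All \<phi>)"
  using Pi0_1_bounded Sigma0_Pi0.intros(3,6) by (metis One_nat_def numeral_2_eq_2)

lemma Sigma0_1_Ex: "bounded \<phi> \<Longrightarrow> Sigma0 1 (Ex \<phi>)"
  using Sigma0_1_bounded Sigma0_Pi0.intros(4) by (metis One_nat_def)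

lemma Pi0_1_All: "bounded \<phi> \<Longrightarrow> Pi0 1 (All \<phi>)"
  using Pi0_1_bounded Sigma0_Pi0.intros(6) by (metis One_nat_def)

lemma base_of_axioms:
  fixes M :: "'m mdl"
  assumes dom: "dom M = UNIV" and E: "range E \<subseteq> sets M"
    and sat: "\<And>\<phi>. \<phi> \<in> RCA0 \<union> BSigma 2 \<Longrightarrow> sat M e E \<phi>"
  shows "base M"
proof -
  have uc: "sat M e' E' \<phi>" if "univ_closure \<phi> \<in> RCA0 \<union> BSigma 2" "range E' \<subseteq> sets M" for \<phi> e' E'
    using sat[OF that(1)] that(2) E dom by (subst (asm) sat_univ_closure) auto
  have bas: "sat M e' E' \<phi>" if "\<phi> \<in> basic_fms" "range E' \<subseteq> sets M" for \<phi> e' E'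
    by (rule uc) (use that in \<open>auto simp: RCA0_def basic_axioms_eq\<close>)
  have ind: "sat M e' E' (ind_inst \<phi>)" if "Sigma0 1 \<phi>" "range E' \<subseteq> sets M" for \<phi> e' E'
    by (rule uc) (use that in \<open>auto simp: RCA0_def ISigma_def\<close>)
  have bnd: "sat M e' E' (bnd_inst \<phi>)" if "Sigma0 2 \<phi>" "range E' \<subseteq> sets M" for \<phi> e' E'
    by (rule uc) (use that in \<open>auto simp: BSigma_def\<close>)
  have cmp: "sat M e' E' (comp_inst \<phi> \<psi>)" if "Sigma0 1 \<phi>" "Pi0 1 \<psi>" "range E' \<subseteq> sets M" for \<phi> \<psi> e' E'
    by (rule uc) (use that in \<open>auto simp: RCA0_def Delta1_CA_def\<close>)
  interpret arith M "sets M"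
    using E by (intro arithI[OF dom _ bas[OF _ E]] ind bnd Sigma0_1_bounded Sigma0_2_bounded) auto
  show ?thesis
  proof
    fix \<phi> e x and E' :: "nat \<Rightarrow> 'm set" assume \<phi>: "bounded \<phi>" "range E' \<subseteq> sets M"
    show "\<exists>y. sat M (y ## zer M ## e) E' \<phi> \<Longrightarrow>
      (\<And>x. \<exists>y. sat M (y ## x ## e) E' \<phi> \<Longrightarrow> \<exists>y. sat M (y ## add M x (one M) ## e) E' \<phi>) \<Longrightarrow> \<exists>y. sat M (y ## x ## e) E' \<phi>"
      using ind[OF Sigma0_1_Ex[OF \<phi>(1)] \<phi>(2), of e] unfolding sat_ind_inst by auto
  next
    fix \<alpha> \<beta> e and E' :: "nat \<Rightarrow> 'm set" assume *: "bounded \<alpha>" "bounded \<beta>" "range E' \<subseteq> sets M"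
      "\<And>v. (\<exists>u. sat M (u ## v ## e) E' \<alpha>) \<longleftrightarrow> \<not> (\<exists>u. sat M (u ## v ## e) E' \<beta>)"
    have "Pi0 1 (All (Neg \<beta>))" using * by (intro Pi0_1_All bounded_rules)
    from cmp[OF Sigma0_1_Ex[OF *(1)] this *(3), of e]
    show "\<exists>X\<in>sets M. \<forall>v. v \<in> X \<longleftrightarrow> (\<exists>u. sat M (u ## v ## e) E' \<alpha>)"
      unfolding sat_comp_inst using *(4) by simp
  next
    fix \<theta> m e and E' :: "nat \<Rightarrow> 'm set" assume *: "bounded \<theta>" "range E' \<subseteq> sets M" "\<And>x. x \<prec> m \<Longrightarrow> \<exists>y. \<forall>z. sat M (z ## y ## x ## e) E' \<theta>"
    let ?\<phi> = "Imp (Less (Var 2) (Var 3)) (ren (0 ## 1 ## 2 ## (\<lambda>n. n + 4)) \<theta>)"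
    have "(\<lambda>n. (z ## j ## i ## m ## e) ((0 ## 1 ## 2 ## (\<lambda>n. n + 4)) n)) = z ## j ## i ## e" for i j z
      by (auto simp: fun_eq_iff eval_nat_numeral split: nat.split)
    then have s: "sat M (j ## i ## m ## e) E' (All ?\<phi>) \<longleftrightarrow> (i \<prec> m \<longrightarrow> (\<forall>z. sat M (z ## j ## i ## e) E' \<theta>))" for i j
      by (auto simp: eval_nat_numeral)
    have "bounded ?\<phi>" by (intro bounded_rules bounded_sub *)
    from bnd[OF Sigma0_2_All[OF this] *(2), of "m ## e"]
    have 1: "sat M (m ## e) E' (bnd_inst (All ?\<phi>))" .
    have 2: "\<forall>i\<in>dom M. \<exists>j\<in>dom M. i \<prec> m \<longrightarrow> (\<forall>z. sat M (z ## j ## i ## e) E' \<theta>)"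
    proof
      fix i show "\<exists>j\<in>dom M. i \<prec> m \<longrightarrow> (\<forall>z. sat M (z ## j ## i ## e) E' \<theta>)"
        using *(3)[of i] by (cases "i \<prec> m") auto
    qed
    have "m \<in> dom M" by simp
    from bspec[OF mp[OF 1[unfolded sat_bnd_inst s] 2] this]
    obtain n where "\<forall>i\<in>dom M. i \<prec> m \<longrightarrow> (\<exists>j\<in>dom M. j \<prec> n \<and> (i \<prec> m \<longrightarrow> (\<forall>z. sat M (z ## j ## i ## e) E' \<theta>)))" ..
    then have "\<forall>x. x \<prec> m \<longrightarrow> (\<exists>y. y \<prec> n \<and> (\<forall>z. sat M (z ## y ## x ## e) E' \<theta>))" by (simp cong: imp_cong conj_cong)
    then show "\<exists>n. \<forall>x. x \<prec> m \<longrightarrow> (\<exists>y. y \<prec> n \<and> (\<forall>z. sat M (z ## y ## x ## e) E' \<theta>))" ..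
  qed
qed

section \<open>Collection for blocks of parameters\<close>

context base
begin

text \<open>Induction on the number \<open>j\<close> of parameters that range up to
  \<open>x\<close>. For a fixed value \<open>a\<close> of parameter \<open>j\<close> the induction
  hypothesis bounds the witnesses. By \<open>coll_swap\<close>, that \<open>u\<close> is such a
  bound can be written as forall \<open>w\<close> with a bounded matrix, so \<open>bs2\<close> can
  collect over \<open>a\<close>.\<close>

lemma block_bs2_aux:
  assumes b: "bounded \<theta>" and E: "range E \<subseteq> sets M" and h: "\<And>e. \<exists>y. \<forall>z. sat M (z ## y ## e) E \<theta>"
  shows "\<exists>u. \<forall>e'. (\<forall>i<j. e' i \<preceq> x) \<longrightarrow> (\<forall>i\<ge>j. e' i = e i) \<longrightarrow> (\<exists>y. y \<prec> u \<and> (\<forall>z. sat M (z ## y ## e') E \<theta>))"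
proof (induction j arbitrary: e)
  case 0
  obtain y where "\<forall>z. sat M (z ## y ## e) E \<theta>" using h by blast
  moreover have "e' = e" if "\<forall>i\<ge>0. e' i = e i" for e' using that by auto
  ultimately show ?case using lt_succ by (metis (full_types))
next
  case (Suc j)
  \<comment> \<open>Behind the first \<open>j\<close> parameters come \<open>w\<close>,
    \<open>u\<close>, \<open>a\<close>, \<open>x\<close>. Parameter \<open>j\<close> is read as
    \<open>a\<close>, two places further, and the later ones move by only three places because
    \<open>a\<close> replaces one of them.\<close>
  let ?f = "\<lambda>n. if n < 2 + j then n else if n = 2 + j then n + 2 else n + 3"
  let ?\<chi> = "AllBs j (Add (Var 3) One) (ExB (Var (j + 1)) (AllB (Var (j + 1)) (ren ?f \<theta>)))"
  let ?rest = "\<lambda>n. e (n + Suc j)"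
  have b\<chi>: "bounded ?\<chi>" by (intro bounded_rules bounded_AllBs bounded_sub b)
  have env: "(\<lambda>n. (z ## y ## e') (?f n)) = z ## y ## (\<lambda>i. if i < j then e' i else if i = j then a else e i)"
    if "\<forall>n. e' (n + j) = (w ## u ## a ## x ## ?rest) n" for e' w u a z y
  proof
    fix n
    show "(z ## y ## e') (?f n) = (z ## y ## (\<lambda>i. if i < j then e' i else if i = j then a else e i)) n"
    proof (cases "n < 2")
      case True
      then show ?thesis by (auto simp: less_2_cases_iff)
    next
      case False
      then obtain i where n: "n = Suc (Suc i)" by (metis add_2_eq_Suc le_Suc_ex not_less)
      consider "i < j" | "i = j" | k where "i = Suc (j + k)" using less_imp_Suc_add nat_neq_iff by metis
      then show ?thesis
      proof cases
        case 2
        then show ?thesis using n that[rule_format, of 2] by (simp add: eval_nat_numeral)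
      next
        case (3 k)
        then show ?thesis using n that[rule_format, of "k + 4"] by (simp add: eval_nat_numeral add.commute)
      qed (use n in simp)
    qed
  qed
  have s: "sat M (w ## u ## a ## x ## ?rest) E ?\<chi> \<longleftrightarrow>
      (\<forall>e'. (\<forall>i<j. e' i \<preceq> x) \<longrightarrow> (\<forall>n. e' (n + j) = (w ## u ## a ## x ## ?rest) n) \<longrightarrow>
        (\<exists>y. y \<prec> u \<and> (\<forall>z. z \<prec> w \<longrightarrow> sat M (z ## y ## (\<lambda>i. if i < j then e' i else if i = j then a else e i)) E \<theta>)))" for w u a
  proof -
    have "sat M e' E (ExB (Var (j + 1)) (AllB (Var (j + 1)) (ren ?f \<theta>))) \<longleftrightarrow>
      (\<exists>y. y \<prec> u \<and> (\<forall>z. z \<prec> w \<longrightarrow> sat M (z ## y ## (\<lambda>i. if i < j then e' i else if i = j then a else e i)) E \<theta>))"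
      if "\<forall>n. e' (n + j) = (w ## u ## a ## x ## ?rest) n" for e'
    proof -
      have "e' (j + 1) = u" "e' j = w" using that[rule_format, of 1] that[rule_format, of 0] by auto
      then show ?thesis using env[OF that] by simp
    qed
    moreover have "val M (w ## u ## a ## x ## ?rest) (Add (Var 3) One) = x \<oplus> \<one>"
      by (simp add: eval_nat_numeral)
    ultimately show ?thesis unfolding sat_AllBs[OF dom] by (simp only: lt_succ_iff) meson
  qed
  have all: "(\<forall>w. sat M (w ## u ## a ## x ## ?rest) E ?\<chi>) \<longleftrightarrow>
      (\<forall>e'. (\<forall>i<Suc j. e' i \<preceq> x) \<longrightarrow> e' j = a \<longrightarrow> (\<forall>i\<ge>Suc j. e' i = e i) \<longrightarrow> (\<exists>y. y \<prec> u \<and> (\<forall>z. sat M (z ## y ## e') E \<theta>)))"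
    if a: "a \<preceq> x" for u a
  proof (intro iffI allI impI)
    fix e' assume L: "\<forall>w. sat M (w ## u ## a ## x ## ?rest) E ?\<chi>" "\<forall>i<Suc j. e' i \<preceq> x" "e' j = a" "\<forall>i\<ge>Suc j. e' i = e i"
    have eq: "(\<lambda>i. if i < j then e' i else if i = j then a else e i) = e'"
      using L(3,4) by (auto simp: fun_eq_iff)
    show "\<exists>y. y \<prec> u \<and> (\<forall>z. sat M (z ## y ## e') E \<theta>)"
    proof (rule coll_swap[OF b E])
      fix w
      let ?e = "\<lambda>i. if i < j then e' i else (w ## u ## a ## x ## ?rest) (i - j)"
      have "\<exists>y. y \<prec> u \<and> (\<forall>z. z \<prec> w \<longrightarrow> sat M (z ## y ## (\<lambda>i. if i < j then ?e i else if i = j then a else e i)) E \<theta>)"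
        using L(1)[rule_format, of w, unfolded s, rule_format, of ?e] L(2) by auto
      moreover have "(\<lambda>i. if i < j then ?e i else if i = j then a else e i) = e'" using L(3,4) by (auto simp: fun_eq_iff)
      ultimately show "\<exists>y. y \<prec> u \<and> (\<forall>z. z \<prec> w \<longrightarrow> sat M (z ## y ## e') E \<theta>)" by simp
    qed
  next
    fix w assume R: "\<forall>e'. (\<forall>i<Suc j. e' i \<preceq> x) \<longrightarrow> e' j = a \<longrightarrow> (\<forall>i\<ge>Suc j. e' i = e i) \<longrightarrow> (\<exists>y. y \<prec> u \<and> (\<forall>z. sat M (z ## y ## e') E \<theta>))"
    show "sat M (w ## u ## a ## x ## ?rest) E ?\<chi>"
      unfolding s
    proof (intro allI impI)
      fix e' :: "nat \<Rightarrow> 'm" assume "\<forall>i<j. e' i \<preceq> x"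
      then have "(if i < j then e' i else if i = j then a else e i) \<preceq> x" if "i < Suc j" for i
        using that a by (auto simp: less_Suc_eq)
      then show "\<exists>y. y \<prec> u \<and> (\<forall>z. z \<prec> w \<longrightarrow> sat M (z ## y ## (\<lambda>i. if i < j then e' i else if i = j then a else e i)) E \<theta>)"
        using R[rule_format, of "\<lambda>i. if i < j then e' i else if i = j then a else e i"] by fastforce
    qed
  qed
  have "\<exists>u. \<forall>w. sat M (w ## u ## a ## x ## ?rest) E ?\<chi>" if "a \<prec> x \<oplus> \<one>" for a
  proof -
    have a: "a \<preceq> x" using that by (simp add: lt_succ_iff)
    obtain u where "\<forall>e'. (\<forall>i<j. e' i \<preceq> x) \<longrightarrow> (\<forall>i\<ge>j. e' i = (e(j := a)) i) \<longrightarrow> (\<exists>y. y \<prec> u \<and> (\<forall>z. sat M (z ## y ## e') E \<theta>))"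
      using Suc.IH[of "e(j := a)"] by blast
    then have "\<forall>w. sat M (w ## u ## a ## x ## ?rest) E ?\<chi>" unfolding all[OF a] by auto
    then show ?thesis by blast
  qed
  then have "\<exists>v. \<forall>a. a \<prec> x \<oplus> \<one> \<longrightarrow> (\<exists>u. u \<prec> v \<and> (\<forall>w. sat M (w ## u ## a ## x ## ?rest) E ?\<chi>))"
    by (rule bs2[OF b\<chi> E])
  then obtain v where v: "\<And>a. a \<preceq> x \<Longrightarrow> \<exists>u. u \<prec> v \<and> (\<forall>w. sat M (w ## u ## a ## x ## ?rest) E ?\<chi>)"
    unfolding lt_succ_iff by meson
  show ?case
  proof (rule exI[of _ v], intro allI impI)
    fix e' assume e': "\<forall>i<Suc j. e' i \<preceq> x" "\<forall>i\<ge>Suc j. e' i = e i"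
    then have a: "e' j \<preceq> x" by simp
    then obtain u where "u \<prec> v" "\<forall>w. sat M (w ## u ## e' j ## x ## ?rest) E ?\<chi>" using v by blast
    then show "\<exists>y. y \<prec> v \<and> (\<forall>z. sat M (z ## y ## e') E \<theta>)"
      using e' lt_trans unfolding all[OF a] by blast
  qed
qed

end

text \<open>Reduces any number of parameters to the single bound \<open>x\<close>, with
  \<open>y\<close> and \<open>z\<close> as bounds for the variables of the same role in
  \<open>\<theta>\<close>. The two indices \<open>nbound \<theta> + 1\<close> differ in meaning: the
  first is \<open>y\<close>, the second, one binder deeper, is \<open>z\<close>.\<close>

definition block :: "fm \<Rightarrow> fm" where
  "block \<theta> = AllBs (nbound \<theta>) (Add (Var 2) One) (ExB (Var (nbound \<theta> + 1)) (AllB (Var (nbound \<theta> + 1)) \<theta>))"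

lemma bounded_block: "bounded \<theta> \<Longrightarrow> bounded (block \<theta>)"
  unfolding block_def by (intro bounded_rules bounded_AllBs)

lemma (in arith) sat_block:
  "sat M (z ## y ## x ## e) E (block \<theta>) \<longleftrightarrow>
    (\<forall>e'. (\<forall>i. e' i \<preceq> x) \<longrightarrow> (\<exists>y'. y' \<prec> y \<and> (\<forall>z'. z' \<prec> z \<longrightarrow> sat M (z' ## y' ## e') E \<theta>)))"
proof -
  let ?K = "nbound \<theta>"
  have s: "sat M (z ## y ## x ## e) E (block \<theta>) \<longleftrightarrow> (\<forall>e'. (\<forall>i<?K. e' i \<preceq> x) \<longrightarrow> (\<forall>n. e' (n + ?K) = (z ## y ## x ## e) n) \<longrightarrow>
    (\<exists>y'. y' \<prec> y \<and> (\<forall>z'. z' \<prec> z \<longrightarrow> sat M (z' ## y' ## e') E \<theta>)))"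
  proof -
    have "sat M e' E (ExB (Var (?K + 1)) (AllB (Var (?K + 1)) \<theta>)) \<longleftrightarrow> (\<exists>y'. y' \<prec> y \<and> (\<forall>z'. z' \<prec> z \<longrightarrow> sat M (z' ## y' ## e') E \<theta>))"
      if "\<forall>n. e' (n + ?K) = (z ## y ## x ## e) n" for e'
    proof -
      have "e' (?K + 1) = y" "e' ?K = z" using that[rule_format, of 1] that[rule_format, of 0] by auto
      then show ?thesis by simp
    qed
    moreover have "val M (z ## y ## x ## e) (Add (Var 2) One) = x \<oplus> \<one>"
      by (simp add: eval_nat_numeral)
    ultimately show ?thesis unfolding block_def sat_AllBs[OF dom] by (simp only: lt_succ_iff) meson
  qed
  have cong: "sat M (z' ## y' ## e') E \<theta> \<longleftrightarrow> sat M (z' ## y' ## e'') E \<theta>" if "\<forall>i<?K. e' i = e'' i" for z' y' e' e''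
    by (rule sat_cong) (use that fvn_nbound in \<open>force split: nat.split\<close>)+
  show ?thesis unfolding s
  proof (intro iffI allI impI)
    fix e' :: "nat \<Rightarrow> 'm" assume L: "\<forall>e'. (\<forall>i<?K. e' i \<preceq> x) \<longrightarrow> (\<forall>n. e' (n + ?K) = (z ## y ## x ## e) n) \<longrightarrow>
      (\<exists>y'. y' \<prec> y \<and> (\<forall>z'. z' \<prec> z \<longrightarrow> sat M (z' ## y' ## e') E \<theta>))" "\<forall>i. e' i \<preceq> x"
    let ?e = "\<lambda>i. if i < ?K then e' i else (z ## y ## x ## e) (i - ?K)"
    have "\<exists>y'. y' \<prec> y \<and> (\<forall>z'. z' \<prec> z \<longrightarrow> sat M (z' ## y' ## ?e) E \<theta>)" using L(1)[rule_format, of ?e] L(2) by auto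
    then show "\<exists>y'. y' \<prec> y \<and> (\<forall>z'. z' \<prec> z \<longrightarrow> sat M (z' ## y' ## e') E \<theta>)" using cong[of ?e e'] by simp
  next
    fix e' :: "nat \<Rightarrow> 'm" assume R: "\<forall>e'. (\<forall>i. e' i \<preceq> x) \<longrightarrow> (\<exists>y'. y' \<prec> y \<and> (\<forall>z'. z' \<prec> z \<longrightarrow> sat M (z' ## y' ## e') E \<theta>))"
      "\<forall>i<?K. e' i \<preceq> x"
    let ?e = "\<lambda>i. if i < ?K then e' i else \<zero>"
    have "\<exists>y'. y' \<prec> y \<and> (\<forall>z'. z' \<prec> z \<longrightarrow> sat M (z' ## y' ## ?e) E \<theta>)" using R(1)[rule_format, of ?e] R(2) by auto
    then show "\<exists>y'. y' \<prec> y \<and> (\<forall>z'. z' \<prec> z \<longrightarrow> sat M (z' ## y' ## e') E \<theta>)" using cong[of ?e e'] by simp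
  qed
qed

lemma (in base) block_valid:
  assumes b: "bounded \<theta>" and E: "range E \<subseteq> sets M" and h: "\<And>e. \<exists>y. \<forall>z. sat M (z ## y ## e) E \<theta>"
  shows "\<exists>y. \<forall>z. sat M (z ## y ## x ## e) E (block \<theta>)"
proof -
  let ?K = "nbound \<theta>"
  have cong: "sat M (z' ## y' ## e') E \<theta> \<longleftrightarrow> sat M (z' ## y' ## e'') E \<theta>" if "\<forall>i<?K. e' i = e'' i" for z' y' e' e''
    by (rule sat_cong) (use that fvn_nbound in \<open>force split: nat.split\<close>)+
  obtain u where u: "\<And>e'. (\<forall>i<?K. e' i \<preceq> x) \<Longrightarrow> (\<forall>i\<ge>?K. e' i = \<zero>) \<Longrightarrow> \<exists>y. y \<prec> u \<and> (\<forall>z. sat M (z ## y ## e') E \<theta>)"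
    using block_bs2_aux[OF b E h, of ?K x "\<lambda>_. \<zero>"] by blast
  have "\<exists>y. y \<prec> u \<and> (\<forall>z. sat M (z ## y ## e') E \<theta>)" if "\<forall>i. e' i \<preceq> x" for e'
    using u[of "\<lambda>i. if i < ?K then e' i else \<zero>"] that cong[of "\<lambda>i. if i < ?K then e' i else \<zero>" e'] by simp
  then show ?thesis unfolding sat_block by blast
qed

section \<open>A model with a distinguished sequence\<close>

text \<open>The polynomial of \<open>pr\<close> outside \<open>base\<close>, since it is also
  evaluated in the extension and in the cut.\<close>

definition prm :: "'m mdl \<Rightarrow> 'm \<Rightarrow> 'm \<Rightarrow> 'm" where
  "prm M n s = add M (mul M (add M n s) (add M n s)) n"

lemma (in base) pr_prm: "pr = prm M"
  by (simp add: fun_eq_iff pr_def prm_def)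

lemma val_PRt_prm [simp]: "val M e (PRt a b) = prm M (val M e a) (val M e b)"
  by (simp add: PRt_def prm_def)

primrec numt :: "nat \<Rightarrow> tm" where
  "numt 0 = Zero"
| "numt (Suc n) = Add (numt n) One"

lemma val_numt [simp]: "val M e (numt n) = nmu M n"
  by (induction n) auto

definition two :: "nat \<Rightarrow> nat" where "two n = (if n = 0 then 0 else 1)"

lemma two_env: "E \<circ> two = E 0 ## (\<lambda>_. E 1)"
  by (auto simp: fun_eq_iff two_def split: nat.split)

text \<open>The number variable 0 stands for a bound \<open>d\<close> of the sequence \<open>c\<close>, and \<open>Suc n\<close> for \<open>c n\<close>.
  The set variables 0 and 1 stand for \<open>P\<close> and \<open>A\<close>.\<close>

definition row1 :: "nat \<Rightarrow> fm" where
  "row1 n = All (Imp (Less (numt n) (Var 0)) (Mem (PRt (Var 0) (Var (n + 3))) 0))"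

definition row2 :: "nat \<Rightarrow> fm" where
  "row2 n = All (Imp (Less (Var (n + 2)) (Var 0)) (Neg (Mem (PRt (numt n) (Var 0)) 0)))"

definition cond :: "fm \<Rightarrow> nat \<Rightarrow> fm" where
  "cond \<theta> n = All (Imp (Less (Var 0) (Add (Var (n + 2)) One))
    (Ex (And (Less (Var 0) (Var (n + 4))) (All (sub clo two \<theta>)))))"

text \<open>\<open>X\<close> ranges over all sets because the set that plays \<open>P\<close>
  differs from one finite part of the theory to the next.\<close>

definition valid :: "'m mdl \<Rightarrow> 'm set \<Rightarrow> fm set" where
  "valid M A = {\<phi>. \<forall>e. \<forall>X\<in>sets M. sat M e (X ## (\<lambda>_. A)) \<phi>}"

definition valid1 :: "'m mdl \<Rightarrow> 'm set \<Rightarrow> fm set" where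
  "valid1 M A = {\<theta>. bounded \<theta> \<and> (\<forall>X\<in>sets M. \<forall>x. \<exists>y. \<forall>z. sat M (z ## y ## x ## (\<lambda>_. zer M)) (X ## (\<lambda>_. A)) \<theta>)}"

text \<open>The requirements on the sequence are cut off at \<open>k\<close>, and so are the
  formulas \<open>\<theta>\<close> by their codes; the union over \<open>k\<close> is the theory of
  the extension.\<close>

definition seq_theory :: "'m mdl \<Rightarrow> 'm set \<Rightarrow> nat \<Rightarrow> fm set" where
  "seq_theory M A k = (\<lambda>\<phi>. sub Var two ((All ^^ nbound \<phi>) \<phi>)) ` valid M A
    \<union> (\<lambda>n. Less (numt n) (Var 1)) ` {..<k}
    \<union> (\<lambda>n. Less (Var (Suc n)) (Var (Suc (Suc n)))) ` {..<k}
    \<union> (\<lambda>n. Less (Var (Suc n)) (Var 0)) ` {..<k}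
    \<union> row1 ` {..<k} \<union> row2 ` {..<k}
    \<union> (\<lambda>(\<theta>, n). cond \<theta> n) ` ({\<theta> \<in> valid1 M A. to_nat \<theta> < k} \<times> {..<k})"

lemma sat_row1: "sat M e E (row1 n) \<longleftrightarrow> (\<forall>m\<in>dom M. lss M (nmu M n) m \<longrightarrow> prm M m (e (Suc (Suc n))) \<in> E 0)"
  by (simp add: row1_def eval_nat_numeral)

lemma sat_row2: "sat M e E (row2 n) \<longleftrightarrow> (\<forall>s\<in>dom M. lss M (e (Suc n)) s \<longrightarrow> prm M (nmu M n) s \<notin> E 0)"
  by (simp add: row2_def eval_nat_numeral)

lemma sat_cond: "sat M e E (cond \<theta> n) \<longleftrightarrow> (\<forall>x\<in>dom M. lss M x (add M (e (Suc n)) (one M)) \<longrightarrow>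
  (\<exists>y\<in>dom M. lss M y (e (Suc (Suc n))) \<and> (\<forall>z\<in>dom M. sat M (z ## y ## x ## (\<lambda>_. zer M)) (E 0 ## (\<lambda>_. E 1)) \<theta>)))"
  by (simp add: cond_def eval_nat_numeral val_clo two_env)

lemma seq_theory_mono: "seq_theory M A k \<subseteq> seq_theory M A (Suc k)"
  unfolding seq_theory_def
  by (intro Un_mono image_mono Sigma_mono) auto

lemma (in base) nmu_mono: "n < k \<Longrightarrow> nmu M n \<prec> nmu M k"
  by (induction k) (auto simp: less_Suc_eq lt_succ intro: lt_trans)

lemma (in base) consistent_seq_theory:
  assumes A: "A \<in> sets M"
  shows "consistent (seq_theory M A k)"
proof -
  let ?\<Theta> = "{\<theta> \<in> valid1 M A. to_nat \<theta> < k}"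
  have "finite ?\<Theta>"
  proof (rule finite_subset)
    show "?\<Theta> \<subseteq> from_nat ` {..<k}" by (auto simp: image_iff) (metis from_nat_to_nat lessThan_iff)
  qed simp
  \<comment> \<open>The start \<open>nmu M k\<close> exceeds the finitely many numerals mentioned,
    and \<open>c k\<close> will serve as \<open>d\<close>.\<close>
  then obtain P c where P: "P \<in> sets M" and c: "c 0 = nmu M k" "\<And>n. c n \<prec> c (Suc n)"
    "\<And>n m. nmu M n \<prec> m \<Longrightarrow> pr m (c (Suc n)) \<in> P" "\<And>n s. c n \<prec> s \<Longrightarrow> pr (nmu M n) s \<notin> P"
    "\<And>n \<theta> x. \<theta> \<in> ?\<Theta> \<Longrightarrow> x \<preceq> c n \<Longrightarrow> \<exists>y. y \<prec> c (Suc n) \<and> (\<forall>z. sat M (z ## y ## x ## (\<lambda>_. zer M)) (P ## (\<lambda>_. A)) \<theta>)"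
    by (rule ex_rows[OF A]) (auto simp: valid1_def)
  note c = c[unfolded pr_prm]
  have cm: "c n \<prec> c k" if "n < k" for n
    using that by (induction k) (auto simp: less_Suc_eq intro: lt_trans c)
  let ?e = "c k ## c"
  let ?E = "P ## (\<lambda>_. A)"
  have "\<forall>\<phi>\<in>seq_theory M A k. sat M ?e ?E \<phi>"
    unfolding seq_theory_def ball_Un ball_simps(9)
  proof (intro conjI ballI)
    have "?E \<circ> two = ?E" by (auto simp: fun_eq_iff two_def split: nat.split)
    then show "sat M ?e ?E (sub Var two ((All ^^ nbound \<phi>) \<phi>))" if "\<phi> \<in> valid M A" for \<phi>
      using that P by (simp add: valid_def sat_All_pow)
    show "sat M ?e ?E (Less (numt n) (Var 1))" if "n \<in> {..<k}" for n
      using c(1) that nmu_mono by simp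
    show "sat M ?e ?E (Less (Var (Suc n)) (Var (Suc (Suc n))))" for n
      using c(2) by simp
    show "sat M ?e ?E (Less (Var (Suc n)) (Var 0))" if "n \<in> {..<k}" for n
      using cm that by simp
    show "sat M ?e ?E (row1 n)" "sat M ?e ?E (row2 n)" for n
      using c(3,4) by (simp_all add: sat_row1 sat_row2)
    show "sat M ?e ?E (case x of (\<theta>, n) \<Rightarrow> cond \<theta> n)" if xx: "x \<in> ?\<Theta> \<times> {..<k}" for x
    proof -
      obtain \<theta> n where x: "x = (\<theta>, n)" "\<theta> \<in> ?\<Theta>" using xx by blast
      show ?thesis using c(5)[OF x(2)] by (simp add: x(1) sat_cond lt_succ_iff)
    qed
  qed
  moreover have "range ?E \<subseteq> sets M" using P A by auto
  ultimately show ?thesis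
    unfolding consistent_def using soundness[OF _ wfm_M, of "seq_theory M A k" Fls ?e ?E] by auto
qed

lemma ind_inst_sub: "sat M e E (ind_inst (sub Var \<rho> \<phi>)) \<longleftrightarrow> sat M e (E \<circ> \<rho>) (ind_inst \<phi>)"
  by (simp add: sat_ind_inst)

lemma bnd_inst_sub: "sat M e E (bnd_inst (sub Var \<rho> \<phi>)) \<longleftrightarrow> sat M e (E \<circ> \<rho>) (bnd_inst \<phi>)"
  by (simp add: sat_bnd_inst)

lemma (in arith) basic_sat: "\<phi> \<in> basic_fms \<Longrightarrow> sat M e E \<phi>"
  unfolding basic_fms_def using ax2 by (auto simp: ax1 ax3 ax4 ax5 ax6 ax7 ax8)

lemma (in arith) ind_sat: "bounded \<phi> \<Longrightarrow> range E \<subseteq> Ss \<Longrightarrow> sat M e E (ind_inst \<phi>)"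
  unfolding sat_ind_inst by (intro impI ballI, rule bind) (auto simp: dom)

lemma (in arith) bnd_sat: "bounded \<phi> \<Longrightarrow> range E \<subseteq> Ss \<Longrightarrow> sat M e E (bnd_inst \<phi>)"
  unfolding sat_bnd_inst
proof (intro impI ballI)
  fix m assume \<phi>: "bounded \<phi>" "range E \<subseteq> Ss" and "\<forall>i\<in>dom M. \<exists>j\<in>dom M. sat M (j ## i ## e) E \<phi>"
  then have "\<exists>n. \<forall>x. x \<prec> m \<longrightarrow> (\<exists>y. y \<prec> n \<and> sat M (y ## x ## e) E \<phi>)"
    by (intro bcoll) auto
  then show "\<exists>n\<in>dom M. \<forall>i\<in>dom M. i \<prec> m \<longrightarrow> (\<exists>j\<in>dom M. j \<prec> n \<and> sat M (j ## i ## e) E \<phi>)" by simp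
qed

theorem ex_seq_model:
  fixes M :: "'m mdl"
  assumes "base M" and A: "A \<in> sets M"
  shows "\<exists>(M1 :: nat mdl) P1 A1 c d. arith M1 {P1, A1} \<and> (\<forall>n. lss M1 (nmu M1 n) (c 0)) \<and>
    (\<forall>n. lss M1 (c n) (c (Suc n))) \<and> (\<forall>n. lss M1 (c n) d) \<and>
    (\<forall>n m. lss M1 (nmu M1 n) m \<longrightarrow> prm M1 m (c (Suc n)) \<in> P1) \<and>
    (\<forall>n s. lss M1 (c n) s \<longrightarrow> prm M1 (nmu M1 n) s \<notin> P1) \<and>
    (\<forall>\<theta> n e. bounded \<theta> \<longrightarrow> (\<forall>X\<in>sets M. \<forall>e. \<exists>y. \<forall>z. sat M (z ## y ## e) (X ## (\<lambda>_. A)) \<theta>) \<longrightarrow>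
      (\<forall>i. lss M1 (e i) (add M1 (c n) (one M1))) \<longrightarrow>
      (\<exists>y. lss M1 y (c (Suc n)) \<and> (\<forall>z. sat M1 (z ## y ## e) (P1 ## (\<lambda>_. A1)) \<theta>)))"
proof -
  interpret base M by fact
  let ?\<Gamma> = "\<Union>k. seq_theory M A k"
  have cons: "consistent ?\<Gamma>" by (rule consistent_chain) (auto intro: consistent_seq_theory A dest: subsetD[OF seq_theory_mono])
  have PA: "range (X ## (\<lambda>_. A)) \<subseteq> sets M" if "X \<in> sets M" for X using that A by auto
  have basv: "\<phi> \<in> valid M A" if "\<phi> \<in> basic_fms" for \<phi> using basic_sat[OF that] by (simp add: valid_def)
  have indv: "ind_inst \<phi> \<in> valid M A" if "bounded \<phi>" for \<phi> using ind_sat[OF that] PA by (simp add: valid_def)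
  have bndv: "bnd_inst \<phi> \<in> valid M A" if "bounded \<phi>" for \<phi> using bnd_sat[OF that] PA by (simp add: valid_def)
  have inv: "sub Var two ((All ^^ nbound \<phi>) \<phi>) \<in> ?\<Gamma>" if "\<phi> \<in> valid M A" for \<phi>
    using that unfolding seq_theory_def by blast
  have succ: "succ_axioms \<subseteq> ?\<Gamma>"
  proof -
    let ?a = "Neg (Eq (Add (Var 0) One) Zero)" and ?b = "Imp (Eq (Add (Var 0) One) (Add (Var 1) One)) (Eq (Var 0) (Var 1))"
    have "sub Var two ((All ^^ nbound ?a) ?a) \<in> ?\<Gamma>" "sub Var two ((All ^^ nbound ?b) ?b) \<in> ?\<Gamma>"
      by (intro inv basv; simp add: basic_fms_def)+
    then show ?thesis unfolding succ_axioms_def by (simp add: numeral_2_eq_2)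
  qed
  from model_existence[OF cons succ] obtain M1 :: "nat mdl" and e E
    where M1: "dom M1 = UNIV" and sat': "\<forall>\<phi>\<in>?\<Gamma>. sat M1 e E \<phi>"
    by (elim exE conjE) (rule that)
  have sat: "\<And>\<phi> k. \<phi> \<in> seq_theory M A k \<Longrightarrow> sat M1 e E \<phi>" using sat' by blast
  define P1 where "P1 = E 0"
  define A1 where "A1 = E 1"
  have trans: "sat M1 e' (P1 ## (\<lambda>_. A1)) \<phi>" if "\<phi> \<in> valid M A" for \<phi> e'
  proof -
    have "sat M1 e (E \<circ> two) ((All ^^ nbound \<phi>) \<phi>)"
      using sat[of "sub Var two ((All ^^ nbound \<phi>) \<phi>)"] that unfolding seq_theory_def by auto
    then have all: "\<And>e''. (\<forall>n. e'' (n + nbound \<phi>) = e n) \<Longrightarrow> sat M1 e'' (E \<circ> two) \<phi>"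
      by (simp add: sat_All_pow M1)
    let ?e = "\<lambda>n. if n < nbound \<phi> then e' n else e (n - nbound \<phi>)"
    have "sat M1 ?e (E \<circ> two) \<phi>" by (rule all) simp
    moreover have "sat M1 ?e (E \<circ> two) \<phi> \<longleftrightarrow> sat M1 e' (E \<circ> two) \<phi>"
      by (rule sat_cong) (auto dest: fvn_nbound)
    ultimately show ?thesis unfolding two_env P1_def A1_def by simp
  qed
  \<comment> \<open>Every set environment over \<open>P1\<close> and \<open>A1\<close> is a renaming
    of the fixed one, so induction and collection for \<open>\<phi>\<close> reduce to the renamed
    formula, whose instance is valid in \<open>M\<close>.\<close>
  have ren: "\<exists>\<rho>. E' = (P1 ## (\<lambda>_. A1)) \<circ> \<rho>" if "range E' \<subseteq> {P1, A1}" for E' :: "nat \<Rightarrow> nat set"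
  proof (intro exI[of _ "\<lambda>X. if E' X = P1 then 0 else 1"] ext)
    fix X show "E' X = ((P1 ## (\<lambda>_. A1)) \<circ> (\<lambda>X. if E' X = P1 then 0 else 1)) X" using that by auto
  qed
  have ar: "arith M1 {P1, A1}"
  proof (rule arithI[OF M1])
    show "sat M1 e' (P1 ## (\<lambda>_. A1)) \<phi>" if "\<phi> \<in> basic_fms" for \<phi> e' using trans basv that by blast
    fix \<phi> e' and E' :: "nat \<Rightarrow> nat set" assume \<phi>: "bounded \<phi>" "range E' \<subseteq> {P1, A1}"
    obtain \<rho> where \<rho>: "E' = (P1 ## (\<lambda>_. A1)) \<circ> \<rho>" using ren[OF \<phi>(2)] by blast
    show "sat M1 e' E' (ind_inst \<phi>)"
      using trans[OF indv, of "sub Var \<rho> \<phi>"] \<phi>(1) bounded_sub unfolding ind_inst_sub \<rho> by blast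
    show "sat M1 e' E' (bnd_inst \<phi>)"
      using trans[OF bndv, of "sub Var \<rho> \<phi>"] \<phi>(1) bounded_sub unfolding bnd_inst_sub \<rho> by blast
  qed simp
  define c where "c n = e (Suc n)" for n
  have 1: "lss M1 (nmu M1 n) (c 0)" for n
    using sat[of "Less (numt n) (Var 1)" "Suc n"] by (simp add: seq_theory_def c_def)
  have 2: "lss M1 (c n) (c (Suc n))" for n
    using sat[of "Less (Var (Suc n)) (Var (Suc (Suc n)))" "Suc n"] by (simp add: seq_theory_def c_def)
  have 3: "lss M1 (c n) (e 0)" for n
    using sat[of "Less (Var (Suc n)) (Var 0)" "Suc n"] by (simp add: seq_theory_def c_def)
  have 4: "prm M1 m (c (Suc n)) \<in> P1" if "lss M1 (nmu M1 n) m" for n m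
    using sat[of "row1 n" "Suc n"] that unfolding sat_row1 by (simp add: seq_theory_def c_def P1_def M1)
  have 5: "prm M1 (nmu M1 n) s \<notin> P1" if "lss M1 (c n) s" for n s
    using sat[of "row2 n" "Suc n"] that unfolding sat_row2 by (simp add: seq_theory_def c_def P1_def M1)
  have 6: "\<exists>y. lss M1 y (c (Suc n)) \<and> (\<forall>z. sat M1 (z ## y ## x ## (\<lambda>_. zer M1)) (P1 ## (\<lambda>_. A1)) \<theta>)"
    if "\<theta> \<in> valid1 M A" "lss M1 x (add M1 (c n) (one M1))" for \<theta> n x
  proof -
    have "cond \<theta> n \<in> seq_theory M A (Suc (max n (to_nat \<theta>)))"
      using that(1) unfolding seq_theory_def by force
    from sat[OF this] that(2) show ?thesis unfolding sat_cond by (simp add: c_def P1_def A1_def M1)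
  qed
  interpret M1: arith M1 "{P1, A1}" by (rule ar)
  have 7: "\<exists>y. lss M1 y (c (Suc n)) \<and> (\<forall>z. sat M1 (z ## y ## e) (P1 ## (\<lambda>_. A1)) \<theta>)"
    if b: "bounded \<theta>" and h: "\<forall>X\<in>sets M. \<forall>e. \<exists>y. \<forall>z. sat M (z ## y ## e) (X ## (\<lambda>_. A)) \<theta>"
      and e: "\<forall>i. lss M1 (e i) (add M1 (c n) (one M1))" for \<theta> n e
  proof -
    have "block \<theta> \<in> valid1 M A"
      unfolding valid1_def using bounded_block[OF b] block_valid[OF b PA] h by blast
    \<comment> \<open>Taking \<open>x = c n\<close> covers all parameters up to \<open>c n\<close>;
      \<open>coll_swap\<close> then removes the bound on \<open>z\<close>.\<close>
    from 6[OF this M1.lt_succ] obtain y where y: "lss M1 y (c (Suc n))"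
      "\<And>z. sat M1 (z ## y ## c n ## (\<lambda>_. zer M1)) (P1 ## (\<lambda>_. A1)) (block \<theta>)" by blast
    have "\<exists>y'. lss M1 y' y \<and> (\<forall>z. sat M1 (z ## y' ## e) (P1 ## (\<lambda>_. A1)) \<theta>)"
    proof (rule M1.coll_swap[OF b])
      show "range (P1 ## (\<lambda>_. A1)) \<subseteq> {P1, A1}" by auto
      show "\<exists>y'. lss M1 y' y \<and> (\<forall>z'. lss M1 z' z \<longrightarrow> sat M1 (z' ## y' ## e) (P1 ## (\<lambda>_. A1)) \<theta>)" for z
        using y(2)[of z] e unfolding M1.sat_block M1.lt_succ_iff by blast
    qed
    then show ?thesis using y(1) M1.lt_trans by blast
  qed
  show ?thesis
    by (rule exI[of _ M1], rule exI[of _ P1], rule exI[of _ A1], rule exI[of _ c], rule exI[of _ "e 0"])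
      (use ar 1 2 3 4 5 7 in blast)
qed

section \<open>The cut\<close>

text \<open>The first model is kept as the source of the true statements in \<open>wit\<close>. The
  witness \<open>y\<close> there is good for all \<open>z\<close> of the big model, not just for
  those of the cut.\<close>

locale cut = arith M "{P, A}" for M :: "'m mdl" and P A +
  fixes M0 :: "'m mdl" and A0 :: "'m set" and c :: "nat \<Rightarrow> 'm" and d :: 'm
  assumes base0: "base M0" and A0: "A0 \<in> sets M0"
    and c_nonstd: "\<And>n. lss M (nmu M n) (c 0)"
    and c_Suc: "\<And>n. lss M (c n) (c (Suc n))" and c_d: "\<And>n. lss M (c n) d"
    and row1: "\<And>n m. lss M (nmu M n) m \<Longrightarrow> prm M m (c (Suc n)) \<in> P"
    and row2: "\<And>n s. lss M (c n) s \<Longrightarrow> prm M (nmu M n) s \<notin> P"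
    and wit: "\<And>\<theta> n e. bounded \<theta> \<Longrightarrow> (\<And>X e. X \<in> sets M0 \<Longrightarrow> \<exists>y. \<forall>z. sat M0 (z ## y ## e) (X ## (\<lambda>_. A0)) \<theta>) \<Longrightarrow>
      (\<And>i. lss M (e i) (add M (c n) (one M))) \<Longrightarrow>
      \<exists>y. lss M y (c (Suc n)) \<and> (\<forall>z. sat M (z ## y ## e) (P ## (\<lambda>_. A)) \<theta>)"
begin

abbreviation EA :: "nat \<Rightarrow> 'm set" where "EA \<equiv> P ## (\<lambda>_. A)"

lemma EA: "range EA \<subseteq> {P, A}" by auto

definition I :: "'m set" where "I = {x. \<exists>n. x \<preceq> c n}"

lemma I_down: "x \<in> I \<Longrightarrow> y \<preceq> x \<Longrightarrow> y \<in> I"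
  unfolding I_def using L.order_trans by blast

lemma I_down_lt: "x \<in> I \<Longrightarrow> y \<prec> x \<Longrightarrow> y \<in> I"
  using I_down L.less_imp_le by blast

lemma c_I: "c n \<in> I" unfolding I_def by blast

lemma zero_I: "\<zero> \<in> I" using I_down[OF c_I zero_le] .

lemma lt_outside: "x \<in> I \<Longrightarrow> w \<notin> I \<Longrightarrow> x \<prec> w"
  using I_down by (meson L.not_le)

lemma d_I: "d \<notin> I" 
proof
  assume "d \<in> I"
  then obtain n where "d \<preceq> c n" by (auto simp: I_def)
  then show False using c_d[of n] L.leD by blast
qed

lemma c_le: "m \<le> n \<Longrightarrow> c m \<preceq> c n"
proof (induction n)
  case (Suc n)
  then show ?case using L.order_trans[OF _ L.less_imp_le[OF c_Suc]] by (cases "m = Suc n") auto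
qed simp

text \<open>Only finitely many entries of \<open>e\<close> matter, so one \<open>c n\<close> bounds
  them; the others are set to zero to meet the hypothesis of \<open>wit\<close>.\<close>

lemma witI:
  assumes "bounded \<theta>" "\<And>X e. X \<in> sets M0 \<Longrightarrow> \<exists>y. \<forall>z. sat M0 (z ## y ## e) (X ## (\<lambda>_. A0)) \<theta>" "range e \<subseteq> I"
  shows "\<exists>y\<in>I. \<forall>z. sat M (z ## y ## e) EA \<theta>"
proof -
  let ?K = "nbound \<theta>"
  have "\<exists>n. \<forall>i<k. e i \<preceq> c n" for k
  proof (induction k)
    case (Suc k)
    then obtain n where n: "\<forall>i<k. e i \<preceq> c n" by blast
    obtain m where "e k \<preceq> c m" using assms(3) unfolding I_def by blast
    then have "\<forall>i<Suc k. e i \<preceq> c (max m n)"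
      using n c_le[of m "max m n"] c_le[of n "max m n"] L.order_trans by (auto simp: less_Suc_eq)
    then show ?case by blast
  qed simp
  then obtain n where n: "\<forall>i<?K. e i \<preceq> c n" by blast
  let ?e = "\<lambda>i. if i < ?K then e i else \<zero>"
  have "?e i \<prec> c n \<oplus> \<one>" for i using n by (auto simp: lt_succ_iff)
  then have "\<exists>y. y \<prec> c (Suc n) \<and> (\<forall>z. sat M (z ## y ## ?e) EA \<theta>)"
    using assms(1,2) by (intro wit)
  then obtain y where y: "y \<prec> c (Suc n)" "\<And>z. sat M (z ## y ## ?e) EA \<theta>" by blast
  have "sat M (z ## y ## ?e) EA \<theta> \<longleftrightarrow> sat M (z ## y ## e) EA \<theta>" for z
    by (rule sat_cong) (use fvn_nbound in \<open>force split: nat.split\<close>)+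
  then show ?thesis using y I_down_lt[OF c_I] by blast
qed

text \<open>Closure under an operation is \<open>witI\<close> for the statement that its value
  exists, with a dummy \<open>z\<close> at index 0.\<close>

lemma add_I: "x \<in> I \<Longrightarrow> y \<in> I \<Longrightarrow> x \<oplus> y \<in> I"
  using witI[of "Eq (Var 1) (Add (Var 2) (Var 3))" "x ## (\<lambda>_. y)"]
  by (auto simp: bounded.intros eval_nat_numeral)

lemma mul_I: "x \<in> I \<Longrightarrow> y \<in> I \<Longrightarrow> x \<otimes> y \<in> I"
  using witI[of "Eq (Var 1) (Mul (Var 2) (Var 3))" "x ## (\<lambda>_. y)"]
  by (auto simp: bounded.intros eval_nat_numeral)

lemma one_I: "\<one> \<in> I"
  using witI[of "Eq (Var 1) One" "\<lambda>_. \<zero>"] zero_I by (auto simp: bounded.intros)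

lemma val_I: "range e \<subseteq> I \<Longrightarrow> val M e t \<in> I"
  by (induction t) (auto intro: zero_I one_I add_I mul_I)

text \<open>The \<open>\<Sigma>\<^sub>1\<close>-elementarity of the cut comes from the tautology \<open>\<forall>x \<exists>y \<forall>z (\<theta>(x,z) \<longrightarrow> \<theta>(x,y))\<close>.\<close>

lemma elem:
  assumes "bounded \<theta>" "range e \<subseteq> I" "sat M (y ## e) EA \<theta>"
  shows "\<exists>y\<in>I. sat M (y ## e) EA \<theta>"
proof -
  let ?\<theta> = "Imp (ren (0 ## (\<lambda>n. n + 2)) \<theta>) (ren Suc \<theta>)"
  have *: "(\<lambda>n. (z ## y ## e) ((0 ## (\<lambda>n. n + 2)) n)) = z ## e" for z y :: 'm and e
    by (auto simp: fun_eq_iff split: nat.split)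
  have s: "sat N (z ## y ## e) E ?\<theta> \<longleftrightarrow> (sat N (z ## e) E \<theta> \<longrightarrow> sat N (y ## e) E \<theta>)" for N :: "'m mdl" and z y e E
    using *[of z y e] by simp
  have "bounded ?\<theta>" using assms(1) by (intro bounded_rules bounded_sub)
  then have "\<exists>y\<in>I. \<forall>z. sat M (z ## y ## e) EA ?\<theta>" by (rule witI) (use assms(2) in \<open>auto simp only: s\<close>)
  then show ?thesis unfolding s using assms(3) by blast
qed

subsection \<open>Definability over the cut\<close>

definition look :: "(nat \<Rightarrow> nat + 'm) \<Rightarrow> (nat \<Rightarrow> 'm) \<Rightarrow> nat \<Rightarrow> 'm" where
  "look \<sigma> e n = (case \<sigma> n of Inl i \<Rightarrow> e i | Inr a \<Rightarrow> a)"

text \<open>Definability as a property of relations on environments replaces most work with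
  formulas: each variable is read from the environment or is a parameter. \<open>C\<close> is
  \<open>I\<close> for definitions over the cut and \<open>UNIV\<close> where \<open>d\<close>
  occurs.\<close>

definition Bd :: "'m set \<Rightarrow> ((nat \<Rightarrow> 'm) \<Rightarrow> bool) \<Rightarrow> bool" where
  "Bd C R \<longleftrightarrow> (\<exists>\<phi> \<sigma>. bounded \<phi> \<and> (\<forall>n a. \<sigma> n = Inr a \<longrightarrow> a \<in> C) \<and> (\<forall>e. R e \<longleftrightarrow> sat M (look \<sigma> e) EA \<phi>))"

lemma BdI: "bounded \<phi> \<Longrightarrow> (\<And>n a. \<sigma> n = Inr a \<Longrightarrow> a \<in> C) \<Longrightarrow> (\<And>e. R e \<longleftrightarrow> sat M (look \<sigma> e) EA \<phi>) \<Longrightarrow> Bd C R"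
  unfolding Bd_def by blast

lemma BdD: "Bd C R \<Longrightarrow> \<exists>\<phi> \<sigma>. bounded \<phi> \<and> (\<forall>n a. \<sigma> n = Inr a \<longrightarrow> a \<in> C) \<and> R = (\<lambda>e. sat M (look \<sigma> e) EA \<phi>)"
  unfolding Bd_def fun_eq_iff by blast

lemma Bd_mono: "Bd C R \<Longrightarrow> C \<subseteq> D \<Longrightarrow> Bd D R"
  unfolding Bd_def by (meson subsetD)

lemma Bd_atom: "bounded \<phi> \<Longrightarrow> Bd C (\<lambda>e. sat M e EA \<phi>)"
  by (rule BdI[of \<phi> Inl]) (auto simp: look_def[abs_def])

lemma Bd_Imp: "Bd C R \<Longrightarrow> Bd C R' \<Longrightarrow> Bd C (\<lambda>e. R e \<longrightarrow> R' e)"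
proof -
  assume "Bd C R" "Bd C R'"
  from BdD[OF this(1)] BdD[OF this(2)] obtain \<phi> \<sigma> \<psi> \<tau>
    where *: "bounded \<phi>" "\<forall>n a. \<sigma> n = Inr a \<longrightarrow> a \<in> C" "R = (\<lambda>e. sat M (look \<sigma> e) EA \<phi>)"
    "bounded \<psi>" "\<forall>n a. \<tau> n = Inr a \<longrightarrow> a \<in> C" "R' = (\<lambda>e. sat M (look \<tau> e) EA \<psi>)"
    by (elim exE conjE) (rule that)
  \<comment> \<open>Even indices carry the assignment of \<open>\<phi>\<close> and odd ones that of
    \<open>\<psi>\<close>, so the two families of parameters do not clash.\<close>
  let ?\<sigma> = "\<lambda>n. if even n then \<sigma> (n div 2) else \<tau> (n div 2)"
  have "(\<lambda>n. look ?\<sigma> e (2 * n)) = look \<sigma> e" "(\<lambda>n. look ?\<sigma> e (2 * n + 1)) = look \<tau> e" for e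
    by (auto simp: look_def fun_eq_iff)
  then show ?thesis unfolding *(3,6)
    by (intro BdI[of "Imp (ren (\<lambda>n. 2 * n) \<phi>) (ren (\<lambda>n. 2 * n + 1) \<psi>)" ?\<sigma>])
      (use * in \<open>auto intro!: bounded_rules bounded_sub split: if_splits\<close>)
qed

lemma Bd_Neg: "Bd C R \<Longrightarrow> Bd C (\<lambda>e. \<not> R e)"
  using Bd_Imp[of C R "\<lambda>_. False"] Bd_atom[OF bounded.intros(4)] by simp

lemma Bd_Or: "Bd C R \<Longrightarrow> Bd C R' \<Longrightarrow> Bd C (\<lambda>e. R e \<or> R' e)"
  using Bd_Imp[OF Bd_Neg, of C R R'] by (simp add: imp_conv_disj)

lemma Bd_And: "Bd C R \<Longrightarrow> Bd C R' \<Longrightarrow> Bd C (\<lambda>e. R e \<and> R' e)"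
  using Bd_Neg[OF Bd_Imp[OF _ Bd_Neg], of C R R'] by simp

lemma Bd_tsub: "Bd C R \<Longrightarrow> Bd C (\<lambda>e. R (\<lambda>i. val M e (\<tau> i)))"
proof -
  assume "Bd C R"
  from BdD[OF this] obtain \<phi> \<sigma> where *: "bounded \<phi>" "\<forall>n a. \<sigma> n = Inr a \<longrightarrow> a \<in> C" "R = (\<lambda>e. sat M (look \<sigma> e) EA \<phi>)"
    by (elim exE conjE) (rule that)
  let ?\<sigma> = "\<lambda>n. if even n then Inl (n div 2) else case \<sigma> (n div 2) of Inl i \<Rightarrow> Inl i | Inr a \<Rightarrow> Inr a"
  let ?s = "\<lambda>n. case \<sigma> n of Inl i \<Rightarrow> sub_tm (\<lambda>k. Var (2 * k)) (\<tau> i) | Inr a \<Rightarrow> Var (2 * n + 1)"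
  have "(\<lambda>n. val M (look ?\<sigma> e) (?s n)) = look \<sigma> (\<lambda>i. val M e (\<tau> i))" for e
    by (auto simp: look_def fun_eq_iff split: sum.split)
  then show ?thesis unfolding *(3)
    by (intro BdI[of "sub ?s id \<phi>" ?\<sigma>]) (use * in \<open>auto intro!: bounded_sub split: if_splits sum.splits\<close>)
qed

lemma Bd_ren: "Bd C R \<Longrightarrow> Bd C (\<lambda>e. R (\<lambda>i. e (f i)))"
  using Bd_tsub[of C R "\<lambda>i. Var (f i)"] by simp

lemma Bd_par: "Bd C R \<Longrightarrow> a \<in> C \<Longrightarrow> Bd C (\<lambda>e. R (a ## e))"
proof -
  assume "Bd C R" and a: "a \<in> C"
  from BdD[OF this(1)] obtain \<phi> \<sigma> where *: "bounded \<phi>" "\<forall>n a. \<sigma> n = Inr a \<longrightarrow> a \<in> C" "R = (\<lambda>e. sat M (look \<sigma> e) EA \<phi>)"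
    by (elim exE conjE) (rule that)
  let ?\<sigma> = "\<lambda>n. case \<sigma> n of Inl i \<Rightarrow> (case i of 0 \<Rightarrow> Inr a | Suc k \<Rightarrow> Inl k) | Inr b \<Rightarrow> Inr b"
  have "look ?\<sigma> e = look \<sigma> (a ## e)" for e
    by (auto simp: look_def fun_eq_iff split: sum.split nat.split)
  then show ?thesis unfolding *(3)
    by (intro BdI[of \<phi> ?\<sigma>]) (use * a in \<open>auto split: sum.splits nat.splits\<close>)
qed

lemma Bd_AllB: "Bd C R \<Longrightarrow> Bd C (\<lambda>e. \<forall>x. x \<prec> val M e t \<longrightarrow> R (x ## e))"
proof -
  assume "Bd C R"
  from BdD[OF this] obtain \<phi> \<sigma> where *: "bounded \<phi>" "\<forall>n a. \<sigma> n = Inr a \<longrightarrow> a \<in> C" "R = (\<lambda>e. sat M (look \<sigma> e) EA \<phi>)"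
    by (elim exE conjE) (rule that)
  \<comment> \<open>Even indices read \<open>e\<close> for the term \<open>t\<close>, odd ones read
    \<open>\<sigma>\<close> without the new variable; where \<open>\<sigma>\<close> names that
    variable, \<open>?f\<close> points to the bound one.\<close>
  let ?\<sigma> = "\<lambda>n. if even n then Inl (n div 2) else case \<sigma> (n div 2) of Inl i \<Rightarrow> (case i of 0 \<Rightarrow> Inl 0 | Suc k \<Rightarrow> Inl k) | Inr a \<Rightarrow> Inr a"
  let ?f = "\<lambda>n. if \<sigma> n = Inl 0 then 0 else Suc (2 * n + 1)"
  let ?t = "sub_tm (\<lambda>k. Var (2 * k)) t"
  have "(\<lambda>n. (x ## look ?\<sigma> e) (?f n)) = look \<sigma> (x ## e)" for e x
    by (auto simp: look_def fun_eq_iff split: sum.split nat.split)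
  moreover have "(\<lambda>k. look ?\<sigma> e (2 * k)) = e" for e by (auto simp: look_def fun_eq_iff)
  ultimately have "sat M (look ?\<sigma> e) EA (AllB ?t (ren ?f \<phi>)) \<longleftrightarrow> (\<forall>x. x \<prec> val M e t \<longrightarrow> sat M (look \<sigma> (x ## e)) EA \<phi>)" for e
    unfolding sat_AllB by simp
  moreover have "bounded (AllB ?t (ren ?f \<phi>))" by (intro bounded_rules bounded_sub *)
  ultimately show ?thesis unfolding *(3)
    by (intro BdI[of "AllB ?t (ren ?f \<phi>)" ?\<sigma>]) (use * in \<open>auto split: if_splits sum.splits nat.splits\<close>)
qed

lemma Bd_ExB: "Bd C R \<Longrightarrow> Bd C (\<lambda>e. \<exists>x. x \<prec> val M e t \<and> R (x ## e))"
  using Bd_Neg[OF Bd_AllB[OF Bd_Neg], of C R t] by simp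

text \<open>The way back from relations to formulas: the tail of the environment becomes parameters,
  and two variables remain in front for a witness and its argument.\<close>

lemma Bd_conv:
  assumes "Bd C R" "range e \<subseteq> C" "\<zero> \<in> C"
  shows "\<exists>\<phi> e'. bounded \<phi> \<and> range e' \<subseteq> C \<and> (\<forall>x y. R (x ## y ## e) \<longleftrightarrow> sat M (x ## y ## e') EA \<phi>)"
proof -
  obtain \<phi> \<sigma> where *: "bounded \<phi>" "\<forall>n a. \<sigma> n = Inr a \<longrightarrow> a \<in> C" "R = (\<lambda>e. sat M (look \<sigma> e) EA \<phi>)"
    using BdD[OF assms(1)] by (elim exE conjE) (rule that)
  let ?f = "\<lambda>n. if \<sigma> n = Inl 0 then 0 else if \<sigma> n = Inl 1 then 1 else n + 2"
  let ?e = "\<lambda>n. case \<sigma> n of Inl i \<Rightarrow> e (i - 2) | Inr a \<Rightarrow> a"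
  have e: "?e n \<in> C" for n
    using *(2) range_subsetD[OF assms(2)] by (cases "\<sigma> n") auto
  have "(\<lambda>n. (x ## y ## ?e) (?f n)) = look \<sigma> (x ## y ## e)" for x y
    by (auto simp: look_def fun_eq_iff numeral_2_eq_2 split: sum.split nat.split)
  then show ?thesis unfolding *(3)
    by (intro exI[of _ "ren ?f \<phi>"] exI[of _ ?e]) (use * e in \<open>auto intro!: bounded_sub\<close>)
qed

lemma Bd_conv1:
  assumes "Bd C R" "range e \<subseteq> C" "\<zero> \<in> C"
  shows "\<exists>\<phi> e'. bounded \<phi> \<and> range e' \<subseteq> C \<and> (\<forall>y. R (y ## e) \<longleftrightarrow> sat M (y ## e') EA \<phi>)"
proof -
  obtain \<phi> e' where *: "bounded \<phi>" "range e' \<subseteq> C" "\<And>x y. R (y ## e) \<longleftrightarrow> sat M (x ## y ## e') EA \<phi>"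
    using Bd_conv[OF Bd_ren[OF assms(1), of Suc] assms(2,3)] by auto
  have "sat M (y ## e') EA (inst \<phi> Zero) \<longleftrightarrow> R (y ## e)" for y using *(3) by simp
  moreover have "bounded (inst \<phi> Zero)" unfolding inst_def by (intro bounded_sub *)
  ultimately show ?thesis using *(2) by blast
qed

lemma Bd_elem: "Bd I Q \<Longrightarrow> range e \<subseteq> I \<Longrightarrow> Q (y ## e) \<Longrightarrow> \<exists>y\<in>I. Q (y ## e)"
  using Bd_conv1[of I Q e] zero_I elem by metis

lemma Bd_least: "Bd UNIV Q \<Longrightarrow> Q (x ## e) \<Longrightarrow> \<exists>x. Q (x ## e) \<and> (\<forall>y. y \<prec> x \<longrightarrow> \<not> Q (y ## e))"
proof -
  assume *: "Bd UNIV Q" "Q (x ## e)"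
  obtain \<phi> e' where "bounded \<phi>" "\<And>y. Q (y ## e) \<longleftrightarrow> sat M (y ## e') EA \<phi>"
    using Bd_conv1[OF *(1), of e] by auto
  then show ?thesis using bounded_least[OF _ EA, of \<phi> x e'] *(2) by simp
qed

text \<open>A least solution outside \<open>I\<close> would have a predecessor outside
  \<open>I\<close>, which is a solution too. So no bounded formula defines the complement of the
  cut, even with parameters from the whole model.\<close>

lemma overspill:
  assumes "Bd UNIV R" "\<And>w. w \<notin> I \<Longrightarrow> R (w ## e)"
  shows "\<exists>w\<in>I. R (w ## e)"
proof -
  obtain w where w: "R (w ## e)" "\<And>y. y \<prec> w \<Longrightarrow> \<not> R (y ## e)"
    using Bd_least[OF assms(1)] assms(2)[OF d_I] by blast
  have "w \<in> I"
  proof (rule ccontr)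
    assume n: "w \<notin> I"
    then obtain v where v: "w = v \<oplus> \<one>" using zero_or_succ zero_I by metis
    then have "v \<notin> I" using n add_I one_I by blast
    then show False using assms(2) w(2) v lt_succ by blast
  qed
  then show ?thesis using w by blast
qed

text \<open>The matrix is evaluated in the big model; with environment and parameters in
  \<open>I\<close> its bounded quantifiers stay in the cut.\<close>

definition Sig1 :: "((nat \<Rightarrow> 'm) \<Rightarrow> bool) \<Rightarrow> bool" where
  "Sig1 R \<longleftrightarrow> (\<exists>Q. Bd I Q \<and> (\<forall>e. range e \<subseteq> I \<longrightarrow> (R e \<longleftrightarrow> (\<exists>u\<in>I. Q (u ## e)))))"

lemma Sig1I: "Bd I Q \<Longrightarrow> (\<And>e. range e \<subseteq> I \<Longrightarrow> R e \<longleftrightarrow> (\<exists>u\<in>I. Q (u ## e))) \<Longrightarrow> Sig1 R"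
  unfolding Sig1_def by blast

lemma Sig1D: "Sig1 R \<Longrightarrow> \<exists>Q. Bd I Q \<and> (\<forall>e. range e \<subseteq> I \<longrightarrow> (R e \<longleftrightarrow> (\<exists>u\<in>I. Q (u ## e))))"
  unfolding Sig1_def .

lemma Sig1_cong: "Sig1 R \<Longrightarrow> (\<And>e. range e \<subseteq> I \<Longrightarrow> R' e \<longleftrightarrow> R e) \<Longrightarrow> Sig1 R'"
  unfolding Sig1_def by metis

lemma Sig1_Bd: "Bd I R \<Longrightarrow> Sig1 R"
  by (rule Sig1I[of "\<lambda>e. R (\<lambda>i. e (Suc i))"]) (use zero_I in \<open>auto intro: Bd_ren\<close>)

lemma ex_above: "x \<in> I \<Longrightarrow> y \<in> I \<Longrightarrow> \<exists>z\<in>I. x \<prec> z \<and> y \<prec> z"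
  by (rule bexI[of _ "x \<oplus> y \<oplus> \<one>"]) (auto simp: lt_succ_iff add_I one_I)

lemma Bd_Ex_bounded: "Bd C Q \<Longrightarrow> Bd C (\<lambda>e. \<exists>u. u \<prec> e 0 \<and> Q (u ## (\<lambda>i. e (Suc i))))"
proof -
  assume "Bd C Q"
  from Bd_ExB[OF Bd_ren[OF this, of "0 ## (\<lambda>i. i + 2)"], of "Var 0"]
  have "Bd C (\<lambda>e. \<exists>x. x \<prec> e 0 \<and> Q (\<lambda>i. (x ## e) ((0 ## (\<lambda>i. i + 2)) i)))" by simp
  moreover have "(\<lambda>i. (x ## e) ((0 ## (\<lambda>i. i + 2)) i)) = x ## (\<lambda>i. e (Suc i))" for x and e :: "nat \<Rightarrow> 'm"
    by (auto simp: fun_eq_iff split: nat.split)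
  ultimately show ?thesis by simp
qed

lemma Sig1_And: "Sig1 R \<Longrightarrow> Sig1 R' \<Longrightarrow> Sig1 (\<lambda>e. R e \<and> R' e)"
proof -
  assume "Sig1 R" "Sig1 R'"
  from Sig1D[OF this(1)] Sig1D[OF this(2)] obtain Q Q' where Q: "Bd I Q" "\<forall>e. range e \<subseteq> I \<longrightarrow> (R e \<longleftrightarrow> (\<exists>u\<in>I. Q (u ## e)))"
    and Q': "Bd I Q'" "\<forall>e. range e \<subseteq> I \<longrightarrow> (R' e \<longleftrightarrow> (\<exists>u\<in>I. Q' (u ## e)))"
    by (elim exE conjE) (rule that)
  show ?thesis
  proof (rule Sig1I[OF Bd_And[OF Bd_Ex_bounded[OF Q(1)] Bd_Ex_bounded[OF Q'(1)]]])
    fix e :: "nat \<Rightarrow> 'm" assume "range e \<subseteq> I"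
    then show "R e \<and> R' e \<longleftrightarrow> (\<exists>u\<in>I. (\<exists>ua. ua \<prec> (u ## e) 0 \<and> Q (ua ## (\<lambda>i. (u ## e) (Suc i)))) \<and>
        (\<exists>ua. ua \<prec> (u ## e) 0 \<and> Q' (ua ## (\<lambda>i. (u ## e) (Suc i)))))"
      using Q(2) Q'(2) ex_above I_down_lt by simp meson
  qed
qed

lemma Sig1_Or: "Sig1 R \<Longrightarrow> Sig1 R' \<Longrightarrow> Sig1 (\<lambda>e. R e \<or> R' e)"
proof -
  assume "Sig1 R" "Sig1 R'"
  from Sig1D[OF this(1)] Sig1D[OF this(2)] obtain Q Q' where Q: "Bd I Q" "\<forall>e. range e \<subseteq> I \<longrightarrow> (R e \<longleftrightarrow> (\<exists>u\<in>I. Q (u ## e)))"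
    and Q': "Bd I Q'" "\<forall>e. range e \<subseteq> I \<longrightarrow> (R' e \<longleftrightarrow> (\<exists>u\<in>I. Q' (u ## e)))"
    by (elim exE conjE) (rule that)
  show ?thesis by (rule Sig1I[OF Bd_Or[OF Q(1) Q'(1)]]) (use Q(2) Q'(2) in auto)
qed

lemma Sig1_tsub: "Sig1 R \<Longrightarrow> Sig1 (\<lambda>e. R (\<lambda>i. val M e (\<tau> i)))"
proof -
  assume "Sig1 R"
  from Sig1D[OF this] obtain Q where Q: "Bd I Q" "\<forall>e. range e \<subseteq> I \<longrightarrow> (R e \<longleftrightarrow> (\<exists>u\<in>I. Q (u ## e)))"
    by (elim exE conjE) (rule that)
  have env: "(\<lambda>i. val M (u ## e) ((Var 0 ## (\<lambda>i. sub_tm shift (\<tau> i))) i)) = u ## (\<lambda>i. val M e (\<tau> i))" for u e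
    by (auto simp: fun_eq_iff split: nat.split)
  show ?thesis
  proof (rule Sig1I[OF Bd_tsub[OF Q(1), of "Var 0 ## (\<lambda>i. sub_tm shift (\<tau> i))"]])
    fix e :: "nat \<Rightarrow> 'm" assume "range e \<subseteq> I"
    then have "range (\<lambda>i. val M e (\<tau> i)) \<subseteq> I" using val_I by blast
    then show "R (\<lambda>i. val M e (\<tau> i)) \<longleftrightarrow> (\<exists>u\<in>I. Q (\<lambda>i. val M (u ## e) ((Var 0 ## (\<lambda>i. sub_tm shift (\<tau> i))) i)))"
      unfolding env using Q(2) by simp
  qed
qed

lemma Sig1_Ex: "Sig1 R \<Longrightarrow> Sig1 (\<lambda>e. \<exists>y\<in>I. R (y ## e))"
proof -
  assume "Sig1 R"
  from Sig1D[OF this] obtain Q where Q: "Bd I Q" "\<forall>e. range e \<subseteq> I \<longrightarrow> (R e \<longleftrightarrow> (\<exists>u\<in>I. Q (u ## e)))"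
    by (elim exE conjE) (rule that)
  have 1: "Bd I (\<lambda>e. \<exists>u. u \<prec> e 1 \<and> Q (u ## e 0 ## (\<lambda>i. e (Suc (Suc i)))))"
  proof -
    have env: "(\<lambda>i. (x ## e) ((0 ## 1 ## (\<lambda>i. i + 3)) i)) = x ## e 0 ## (\<lambda>i. e (Suc (Suc i)))" for x and e :: "nat \<Rightarrow> 'm"
      by (auto simp: fun_eq_iff eval_nat_numeral split: nat.split)
    show ?thesis using Bd_ExB[OF Bd_ren[OF Q(1), of "0 ## 1 ## (\<lambda>i. i + 3)"], of "Var 1"] unfolding env by simp
  qed
  have 2: "Bd I (\<lambda>e. \<exists>y. y \<prec> e 0 \<and> (\<exists>u. u \<prec> e 0 \<and> Q (u ## y ## (\<lambda>i. e (Suc i)))))"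
    using Bd_ExB[OF 1, of "Var 0"] by simp
  show ?thesis
  proof (rule Sig1I[OF 2])
    fix e :: "nat \<Rightarrow> 'm" assume e: "range e \<subseteq> I"
    have "(\<exists>y\<in>I. R (y ## e)) \<longleftrightarrow> (\<exists>y\<in>I. \<exists>u\<in>I. Q (u ## y ## e))" using Q(2) e by simp
    also have "\<dots> \<longleftrightarrow> (\<exists>w\<in>I. \<exists>y. y \<prec> w \<and> (\<exists>u. u \<prec> w \<and> Q (u ## y ## e)))"
      using ex_above I_down_lt by meson
    finally show "(\<exists>y\<in>I. R (y ## e)) \<longleftrightarrow> (\<exists>w\<in>I. \<exists>y. y \<prec> (w ## e) 0 \<and> (\<exists>u. u \<prec> (w ## e) 0 \<and> Q (u ## y ## (\<lambda>i. (w ## e) (Suc i)))))"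
      by simp
  qed
qed

text \<open>Any \<open>w\<close> outside the cut bounds all witnesses in the cut. This is a bounded
  property of \<open>w\<close>, so \<open>overspill\<close> finds such a bound inside.\<close>

lemma Sig1_coll:
  assumes "Sig1 R" "m \<in> I" "range e \<subseteq> I" "\<And>x. x \<prec> m \<Longrightarrow> \<exists>y\<in>I. R (y ## x ## e)"
  shows "\<exists>w\<in>I. \<forall>x. x \<prec> m \<longrightarrow> (\<exists>y. y \<prec> w \<and> R (y ## x ## e))"
proof -
  obtain Q where Q: "Bd I Q" "\<forall>e. range e \<subseteq> I \<longrightarrow> (R e \<longleftrightarrow> (\<exists>u\<in>I. Q (u ## e)))"
    using Sig1D[OF assms(1)] by (elim exE conjE) (rule that)
  let ?S = "\<lambda>e. \<forall>x. x \<prec> e 1 \<longrightarrow> (\<exists>y. y \<prec> e 0 \<and> (\<exists>u. u \<prec> e 0 \<and> Q (u ## y ## x ## (\<lambda>i. e (Suc (Suc i))))))"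
  have "Bd I ?S"
  proof -
    have env: "(\<lambda>i. (u ## y ## x ## e) ((0 ## 1 ## 2 ## (\<lambda>i. i + 5)) i)) = u ## y ## x ## (\<lambda>i. e (Suc (Suc i)))" for u y x and e :: "nat \<Rightarrow> 'm"
      by (auto simp: fun_eq_iff eval_nat_numeral split: nat.split)
    show ?thesis
      using Bd_AllB[OF Bd_ExB[OF Bd_ExB[OF Bd_ren[OF Q(1), of "0 ## 1 ## 2 ## (\<lambda>i. i + 5)"], of "Var 2"], of "Var 1"], of "Var 1"]
      unfolding env by (simp add: numeral_2_eq_2)
  qed
  then have "\<exists>w\<in>I. ?S (w ## m ## e)"
  proof (intro overspill)
    show "Bd UNIV ?S" using \<open>Bd I ?S\<close> Bd_mono by blast
    fix w assume w: "w \<notin> I"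
    have "\<exists>y. y \<prec> w \<and> (\<exists>u. u \<prec> w \<and> Q (u ## y ## x ## e))" if x: "x \<prec> m" for x
    proof -
      have "x \<in> I" using x assms(2) I_down_lt by blast
      then obtain y u where "y \<in> I" "u \<in> I" "Q (u ## y ## x ## e)" using assms(4)[OF x] Q(2) assms(3) by auto
      then show ?thesis using lt_outside w by blast
    qed
    then show "?S (w ## m ## e)" by simp
  qed
  then obtain w where w: "w \<in> I" "\<And>x. x \<prec> m \<Longrightarrow> \<exists>y. y \<prec> w \<and> (\<exists>u. u \<prec> w \<and> Q (u ## y ## x ## e))" by auto
  have "\<exists>y. y \<prec> w \<and> R (y ## x ## e)" if x: "x \<prec> m" for x
  proof -
    obtain y u where "y \<prec> w" "u \<prec> w" "Q (u ## y ## x ## e)" using w(2)[OF x] by blast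
    moreover from this have "y \<in> I" "u \<in> I" "x \<in> I" using w(1) x assms(2) I_down_lt by blast+
    moreover from this have "range (y ## x ## e) \<subseteq> I" using assms(3) by simp
    ultimately show ?thesis using Q(2) by blast
  qed
  then show ?thesis using w(1) by blast
qed

lemma Sig1_ExB: "Sig1 R \<Longrightarrow> Sig1 (\<lambda>e. \<exists>x. x \<prec> val M e t \<and> R (x ## e))"
proof -
  assume R: "Sig1 R"
  have "Sig1 (\<lambda>e. e 0 \<prec> val M (\<lambda>i. e (Suc i)) t)"
    using Sig1_Bd[OF Bd_atom[OF bounded.intros(2)], of "Var 0" "sub_tm shift t"] by (simp add: shift_def)
  from Sig1_Ex[OF Sig1_And[OF this R]] show ?thesis
  proof (rule Sig1_cong)
    fix e :: "nat \<Rightarrow> 'm" assume "range e \<subseteq> I"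
    then have "x \<in> I" if "x \<prec> val M e t" for x using that I_down_lt val_I by blast
    then show "(\<exists>x. x \<prec> val M e t \<and> R (x ## e)) \<longleftrightarrow> (\<exists>y\<in>I. (y ## e) 0 \<prec> val M (\<lambda>i. (y ## e) (Suc i)) t \<and> R (y ## e))"
      by auto
  qed
qed

text \<open>Collection pulls the unbounded witness in front of the bounded quantifier.\<close>

lemma Sig1_AllB: "Sig1 R \<Longrightarrow> Sig1 (\<lambda>e. \<forall>x. x \<prec> val M e t \<longrightarrow> R (x ## e))"
proof -
  assume "Sig1 R"
  from Sig1D[OF this] obtain Q where Q: "Bd I Q" "\<forall>e. range e \<subseteq> I \<longrightarrow> (R e \<longleftrightarrow> (\<exists>u\<in>I. Q (u ## e)))"
    by (elim exE conjE) (rule that)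
  have env: "(\<lambda>i. (u ## x ## e) ((0 ## 1 ## (\<lambda>i. i + 3)) i)) = u ## x ## (\<lambda>i. e (Suc i))" for u x and e :: "nat \<Rightarrow> 'm"
    by (auto simp: fun_eq_iff eval_nat_numeral split: nat.split)
  have B: "Bd I (\<lambda>e. \<forall>x. x \<prec> val M (\<lambda>i. e (Suc i)) t \<longrightarrow> (\<exists>u. u \<prec> e 0 \<and> Q (u ## x ## (\<lambda>i. e (Suc i)))))"
    using Bd_AllB[OF Bd_ExB[OF Bd_ren[OF Q(1), of "0 ## 1 ## (\<lambda>i. i + 3)"], of "Var 1"], of "sub_tm shift t"]
    unfolding env by (simp add: shift_def)
  show ?thesis
  proof (rule Sig1I[OF B])
    fix e :: "nat \<Rightarrow> 'm" assume e: "range e \<subseteq> I"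
    have R: "R (x ## e) \<longleftrightarrow> (\<exists>u\<in>I. Q (u ## x ## e))" if "x \<prec> val M e t" for x
      using Q(2) e I_down_lt[OF val_I[OF e] that] by simp
    have "(\<forall>x. x \<prec> val M e t \<longrightarrow> R (x ## e)) \<longleftrightarrow> (\<exists>w\<in>I. \<forall>x. x \<prec> val M e t \<longrightarrow> (\<exists>u. u \<prec> w \<and> Q (u ## x ## e)))"
    proof
      assume "\<forall>x. x \<prec> val M e t \<longrightarrow> R (x ## e)"
      then show "\<exists>w\<in>I. \<forall>x. x \<prec> val M e t \<longrightarrow> (\<exists>u. u \<prec> w \<and> Q (u ## x ## e))"
        using R by (intro Sig1_coll[OF Sig1_Bd[OF Q(1)] val_I[OF e] e]) blast
    next
      assume "\<exists>w\<in>I. \<forall>x. x \<prec> val M e t \<longrightarrow> (\<exists>u. u \<prec> w \<and> Q (u ## x ## e))"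
      then show "\<forall>x. x \<prec> val M e t \<longrightarrow> R (x ## e)" using R I_down_lt by blast
    qed
    then show "(\<forall>x. x \<prec> val M e t \<longrightarrow> R (x ## e)) \<longleftrightarrow> (\<exists>w\<in>I. \<forall>x. x \<prec> val M (\<lambda>i. (w ## e) (Suc i)) t \<longrightarrow>
        (\<exists>u. u \<prec> (w ## e) 0 \<and> Q (u ## x ## (\<lambda>i. (w ## e) (Suc i)))))" by simp
  qed
qed

text \<open>Comprehension has number parameters, while a set in \<open>S\<close> is given by a
  relation in \<open>e 0\<close> alone; the tail \<open>e\<close> is absorbed into the parameters of
  the definition.\<close>

lemma Sig1_fix: "Sig1 R \<Longrightarrow> range e \<subseteq> I \<Longrightarrow> Sig1 (\<lambda>e'. R (e' 0 ## e))"
proof -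
  assume "Sig1 R" and e: "range e \<subseteq> I"
  from Sig1D[OF this(1)] obtain Q where Q: "Bd I Q" "\<forall>e. range e \<subseteq> I \<longrightarrow> (R e \<longleftrightarrow> (\<exists>u\<in>I. Q (u ## e)))"
    by (elim exE conjE) (rule that)
  obtain \<phi> p where p: "bounded \<phi>" "range p \<subseteq> I" "\<forall>x y. Q (x ## y ## e) \<longleftrightarrow> sat M (x ## y ## p) EA \<phi>"
    using Bd_conv[OF Q(1) e zero_I] by blast
  let ?\<sigma> = "Inl 0 ## Inl 1 ## (\<lambda>n. Inr (p n))"
  have "look ?\<sigma> e' = e' 0 ## e' 1 ## p" for e' by (auto simp: look_def fun_eq_iff split: nat.split)
  then have "Bd I (\<lambda>e'. Q (e' 0 ## e' 1 ## e))"
    by (intro BdI[of \<phi> ?\<sigma>]) (use p in \<open>auto split: nat.splits\<close>)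
  then show ?thesis
  proof (rule Sig1I)
    fix e' :: "nat \<Rightarrow> 'm" assume "range e' \<subseteq> I"
    then have "range (e' 0 ## e) \<subseteq> I" using e by (simp add: range_subsetD)
    then show "R (e' 0 ## e) \<longleftrightarrow> (\<exists>u\<in>I. Q ((u ## e') 0 ## (u ## e') 1 ## e))" using Q(2) by simp
  qed
qed

lemma Bd_sat2: "bounded \<phi> \<Longrightarrow> range p \<subseteq> C \<Longrightarrow> Bd C (\<lambda>e. sat M (e 0 ## e 1 ## p) EA \<phi>)"
proof -
  assume *: "bounded \<phi>" "range p \<subseteq> C"
  let ?\<sigma> = "Inl 0 ## Inl 1 ## (\<lambda>n. Inr (p n))"
  have "look ?\<sigma> e' = e' 0 ## e' 1 ## p" for e' by (auto simp: look_def fun_eq_iff split: nat.split)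
  then show ?thesis by (intro BdI[of \<phi> ?\<sigma>]) (use * in \<open>auto split: nat.splits\<close>)
qed

subsection \<open>The second-order structure on the cut\<close>

definition Del1 :: "((nat \<Rightarrow> 'm) \<Rightarrow> bool) \<Rightarrow> bool" where
  "Del1 R \<longleftrightarrow> Sig1 R \<and> Sig1 (\<lambda>e. \<not> R e)"

definition S :: "'m set set" where
  "S = {Y. Y \<subseteq> I \<and> Del1 (\<lambda>e. e 0 \<in> Y)}"

definition N :: "'m mdl" where
  "N = M\<lparr>dom := I, sets := S\<rparr>"

lemma N_simps [simp]: "mdl.dom N = I" "sets N = S" "zer N = \<zero>" "one N = \<one>" "add N = add M" "mul N = mul M" "lss N = lss M"
  by (simp_all add: N_def)

lemma val_N [simp]: "val N e t = val M e t"
  by (induction t) auto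

lemma prm_N [simp]: "prm N = prm M"
  by (simp add: prm_def fun_eq_iff)

lemma wfm_N: "wfm N"
  using zero_I one_I add_I mul_I by (simp add: wfm_def)

lemma Del1_Bd: "Bd I R \<Longrightarrow> Del1 R"
  unfolding Del1_def by (auto intro: Sig1_Bd Bd_Neg)

lemma Del1_cong: "Del1 R \<Longrightarrow> (\<And>e. range e \<subseteq> I \<Longrightarrow> R' e \<longleftrightarrow> R e) \<Longrightarrow> Del1 R'"
  unfolding Del1_def using Sig1_cong[of R R'] Sig1_cong[of "\<lambda>e. \<not> R e" "\<lambda>e. \<not> R' e"] by blast

lemma Del1_tsub: "Del1 R \<Longrightarrow> Del1 (\<lambda>e. R (\<lambda>i. val M e (\<tau> i)))"
  unfolding Del1_def using Sig1_tsub[of R \<tau>] Sig1_tsub[of "\<lambda>e. \<not> R e" \<tau>] by blast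

lemma Del1_Imp: "Del1 R \<Longrightarrow> Del1 R' \<Longrightarrow> Del1 (\<lambda>e. R e \<longrightarrow> R' e)"
proof -
  assume R: "Del1 R" "Del1 R'"
  have "Sig1 (\<lambda>e. \<not> R e \<or> R' e)" using R by (intro Sig1_Or) (simp_all add: Del1_def)
  moreover have "Sig1 (\<lambda>e. R e \<and> \<not> R' e)" using R by (intro Sig1_And) (simp_all add: Del1_def)
  moreover have "(\<lambda>e. R e \<longrightarrow> R' e) = (\<lambda>e. \<not> R e \<or> R' e)" "(\<lambda>e. \<not> (R e \<longrightarrow> R' e)) = (\<lambda>e. R e \<and> \<not> R' e)" by auto
  ultimately show ?thesis unfolding Del1_def by (simp only: simp_thms)
qed

lemma Del1_Neg: "Del1 R \<Longrightarrow> Del1 (\<lambda>e. \<not> R e)"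
  unfolding Del1_def by simp

lemma Del1_AllB: "Del1 R \<Longrightarrow> Del1 (\<lambda>e. \<forall>x. x \<prec> val M e t \<longrightarrow> R (x ## e))"
  using Sig1_AllB[of R t] Sig1_ExB[of "\<lambda>e. \<not> R e" t] by (simp add: Del1_def)

lemma S_inter: "P \<inter> I \<in> S" "A \<inter> I \<in> S"
proof -
  have "Del1 (\<lambda>e. e 0 \<in> P \<inter> I)"
    by (rule Del1_cong[OF Del1_Bd[OF Bd_atom[OF bounded.intros(3)], of "Var 0" 0]]) (auto simp: range_subsetD)
  moreover have "Del1 (\<lambda>e. e 0 \<in> A \<inter> I)"
    by (rule Del1_cong[OF Del1_Bd[OF Bd_atom[OF bounded.intros(3)], of "Var 0" 1]]) (auto simp: range_subsetD)
  ultimately show "P \<inter> I \<in> S" "A \<inter> I \<in> S" unfolding S_def by auto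
qed

lemma sat_N_AllB: "range e \<subseteq> I \<Longrightarrow> sat N e E (AllB t \<phi>) \<longleftrightarrow> (\<forall>x. x \<prec> val M e t \<longrightarrow> sat N (x ## e) E \<phi>)"
  using I_down_lt[OF val_I] by auto

lemma sat_N_ExB: "range e \<subseteq> I \<Longrightarrow> sat N e E (ExB t \<phi>) \<longleftrightarrow> \<not> (\<forall>x. x \<prec> val M e t \<longrightarrow> \<not> sat N (x ## e) E \<phi>)"
  using I_down_lt[OF val_I] by auto

text \<open>Delta_1 relations are closed under bounded quantifiers, which rests on
  \<open>Sig1_coll\<close>. In this way set parameters from \<open>S\<close> are eliminated in
  favour of \<open>P\<close> and \<open>A\<close>.\<close>

lemma Del1_sat: "bounded \<phi> \<Longrightarrow> range E \<subseteq> S \<Longrightarrow> Del1 (\<lambda>e. sat N e E \<phi>)"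
proof (induction rule: bounded.induct)
  case (1 s t)
  then show ?case using Del1_Bd[OF Bd_atom[OF bounded.intros(1)], of s t] by simp
next
  case (2 s t)
  then show ?case using Del1_Bd[OF Bd_atom[OF bounded.intros(2)], of s t] by simp
next
  case (3 t X)
  then have "Del1 (\<lambda>e. e 0 \<in> E X)" unfolding S_def by blast
  from Del1_tsub[OF this, of "\<lambda>_. t"] show ?case by simp
next
  case 4
  then show ?case using Del1_Bd[OF Bd_atom[OF bounded.intros(4)]] by simp
next
  case (5 \<phi> \<psi>)
  then show ?case using Del1_Imp by simp
next
  case (6 \<phi> t)
  show ?case by (rule Del1_cong[OF Del1_AllB[OF 6(2)[OF 6(3)], of t]]) (rule sat_N_AllB)
next
  case (7 \<phi> t)
  show ?case by (rule Del1_cong[OF Del1_Neg[OF Del1_AllB[OF Del1_Neg[OF 7(2)[OF 7(3)]], of t]]]) (rule sat_N_ExB)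
qed

lemma sat_N_bounded:
  "bounded \<phi> \<Longrightarrow> (\<And>X. E X \<inter> I = E' X \<inter> I) \<Longrightarrow> range e \<subseteq> I \<Longrightarrow> sat N e E \<phi> \<longleftrightarrow> sat M e E' \<phi>"
proof (induction arbitrary: e rule: bounded.induct)
  case (3 t X)
  then show ?case using val_I[of e t] by auto
next
  case (6 \<phi> t)
  have "sat N (x ## e) E \<phi> \<longleftrightarrow> sat M (x ## e) E' \<phi>" if "x \<prec> val M e t" for x
    using 6 I_down_lt[OF val_I that] by simp
  then show ?case unfolding sat_N_AllB[OF 6(4)] sat_AllB by blast
next
  case (7 \<phi> t)
  have "sat N (x ## e) E \<phi> \<longleftrightarrow> sat M (x ## e) E' \<phi>" if "x \<prec> val M e t" for x
    using 7 I_down_lt[OF val_I that] by simp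
  then show ?case unfolding sat_N_ExB[OF 7(4)] sat_ExB by blast
qed auto

lemma coll_model_N: "coll_model N"
proof -
  have "collects N"
    unfolding collects_def
  proof (intro allI ballI impI)
    fix \<phi> e E m
    assume *: "m \<in> mdl.dom N" "bounded \<phi>" "range e \<subseteq> mdl.dom N" "range E \<subseteq> sets N"
      "\<forall>x\<in>mdl.dom N. lss N x m \<longrightarrow> (\<exists>y\<in>mdl.dom N. sat N (y ## x ## e) E \<phi>)"
    have "Sig1 (\<lambda>e. sat N e E \<phi>)" using Del1_sat *(2,4) by (auto simp: Del1_def)
    then have "\<exists>w\<in>I. \<forall>x. x \<prec> m \<longrightarrow> (\<exists>y. y \<prec> w \<and> sat N (y ## x ## e) E \<phi>)"
      by (rule Sig1_coll) (use * I_down_lt in auto)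
    then show "\<exists>n\<in>mdl.dom N. \<forall>x\<in>mdl.dom N. lss N x m \<longrightarrow> (\<exists>y\<in>mdl.dom N. lss N y n \<and> sat N (y ## x ## e) E \<phi>)"
      using I_down_lt by (simp, meson)
  qed
  then show ?thesis unfolding coll_model_def using wfm_N ex_above lt_trans by auto
qed

lemma Sig1_sat: "Sigma0 1 \<phi> \<Longrightarrow> range E \<subseteq> S \<Longrightarrow> Sig1 (\<lambda>e. sat N e E \<phi>)"
proof -
  assume "Sigma0 1 \<phi>" and E: "range E \<subseteq> S"
  from Sigma0_1_normal[OF this(1)] obtain \<theta> where \<theta>: "nfS1 TYPE('m) \<phi> \<theta>" by blast
  have "Sig1 (\<lambda>e. sat N e E \<theta>)" using Del1_sat[OF nfD(1)[OF \<theta>] E] by (simp add: Del1_def)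
  from Sig1_Ex[OF this] show ?thesis
    by (rule Sig1_cong) (use nfD(2)[OF \<theta> coll_model_N] E in simp)
qed

lemma Sig1_sat_Neg: "Pi0 1 \<phi> \<Longrightarrow> range E \<subseteq> S \<Longrightarrow> Sig1 (\<lambda>e. \<not> sat N e E \<phi>)"
proof -
  assume "Pi0 1 \<phi>" and E: "range E \<subseteq> S"
  from Pi0_1_normal[OF this(1)] obtain \<theta> where \<theta>: "nfP1 TYPE('m) \<phi> \<theta>" by blast
  have "Sig1 (\<lambda>e. \<not> sat N e E \<theta>)" using Del1_sat[OF nfD(1)[OF \<theta>] E] by (simp add: Del1_def)
  from Sig1_Ex[OF this] show ?thesis
    by (rule Sig1_cong) (use nfD(2)[OF \<theta> coll_model_N] E in simp)
qed

text \<open>By elementarity a witness below \<open>d\<close> exists iff one exists in the cut. So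
  failure of \<open>R\<close> is, on the cut, a bounded property with parameter \<open>d\<close>,
  and it has a least element in the big model.\<close>

lemma Sig1_induct:
  assumes R: "Sig1 R" and e: "range e \<subseteq> I" and "R (\<zero> ## e)"
    "\<And>x. x \<in> I \<Longrightarrow> R (x ## e) \<Longrightarrow> R ((x \<oplus> \<one>) ## e)" "x \<in> I"
  shows "R (x ## e)"
proof (rule ccontr)
  assume neg: "\<not> R (x ## e)"
  obtain Q where Q: "Bd I Q" "\<forall>e. range e \<subseteq> I \<longrightarrow> (R e \<longleftrightarrow> (\<exists>u\<in>I. Q (u ## e)))"
    using Sig1D[OF R] by (elim exE conjE) (rule that)
  let ?T = "\<lambda>e. \<not> (\<exists>u. u \<prec> d \<and> Q (u ## e))"
  have "Bd UNIV ?T"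
  proof -
    have env: "(\<lambda>i. (x ## e) ((0 ## (\<lambda>i. i + 2)) i)) = x ## (\<lambda>i. e (Suc i))" for x and e :: "nat \<Rightarrow> 'm"
      by (auto simp: fun_eq_iff split: nat.split)
    from Bd_par[OF Bd_ExB[OF Bd_ren[OF Bd_mono[OF Q(1), of UNIV], of "0 ## (\<lambda>i. i + 2)"], of "Var 0"], of d]
    show ?thesis unfolding env by (intro Bd_Neg) simp
  qed
  moreover have T: "?T (y ## e) \<longleftrightarrow> \<not> R (y ## e)" if "y \<in> I" for y
  proof -
    have ye: "range (y ## e) \<subseteq> I" using that e by simp
    have "(\<exists>u. u \<prec> d \<and> Q (u ## y ## e)) \<longleftrightarrow> (\<exists>u\<in>I. Q (u ## y ## e))"
      using Bd_elem[OF Q(1) ye] lt_outside[OF _ d_I] by blast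
    then show ?thesis using Q(2) ye by simp
  qed
  ultimately obtain y where y: "?T (y ## e)" "\<And>z. z \<prec> y \<Longrightarrow> \<not> ?T (z ## e)"
    using Bd_least[of ?T x e] neg assms(5) by blast
  have "y \<preceq> x" using y(2)[of x] T[OF assms(5)] neg by (meson L.not_le)
  then have yI: "y \<in> I" using assms(5) I_down by blast
  then have "y \<noteq> \<zero>" using y(1) T assms(3) by blast
  then obtain z where z: "y = z \<oplus> \<one>" using zero_or_succ by blast
  then have "z \<in> I" "z \<prec> y" using yI lt_succ I_down_lt by blast+
  then show False using y T assms(4) yI z by blast
qed

lemma N_ind: "Sigma0 1 \<phi> \<Longrightarrow> range e \<subseteq> I \<Longrightarrow> range E \<subseteq> S \<Longrightarrow> sat N e E (ind_inst \<phi>)"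
  unfolding sat_ind_inst N_simps
proof (intro impI ballI)
  fix x assume "Sigma0 1 \<phi>" and E: "range E \<subseteq> S" and e: "range e \<subseteq> I" and x: "x \<in> I" and "sat N (\<zero> ## e) E \<phi>"
    "\<forall>x\<in>I. sat N (x ## e) E \<phi> \<longrightarrow> sat N ((x \<oplus> \<one>) ## e) E \<phi>"
  then show "sat N (x ## e) E \<phi>"
    by (intro Sig1_induct[OF Sig1_sat[OF _ E] e _ _ x]) simp_all
qed

lemma N_comp:
  assumes "Sigma0 1 \<phi>" "Pi0 1 \<psi>" "range e \<subseteq> I" "range E \<subseteq> S"
  shows "sat N e E (comp_inst \<phi> \<psi>)"
  unfolding sat_comp_inst N_simps
proof
  assume *: "\<forall>x\<in>I. sat N (x ## e) E \<phi> \<longleftrightarrow> sat N (x ## e) E \<psi>"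
  let ?Y = "{x \<in> I. sat N (x ## e) E \<phi>}"
  have "Sig1 (\<lambda>e. e 0 \<in> ?Y)"
    by (rule Sig1_cong[OF Sig1_fix[OF Sig1_sat[OF assms(1,4)] assms(3)]]) (auto simp: range_subsetD)
  moreover have "Sig1 (\<lambda>e. e 0 \<notin> ?Y)"
    by (rule Sig1_cong[OF Sig1_fix[OF Sig1_sat_Neg[OF assms(2,4)] assms(3)]]) (use * in \<open>auto simp: range_subsetD\<close>)
  ultimately have "?Y \<in> S" unfolding S_def Del1_def by auto
  then show "\<exists>X\<in>S. \<forall>x\<in>I. x \<in> X \<longleftrightarrow> sat N (x ## e) E \<phi>" by (intro bexI[of _ ?Y]) auto
qed

text \<open>A Sigma_2 statement over the cut asks for \<open>u\<close> without counterexample in the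
  cut. By elementarity there is then none below \<open>d\<close> either, and conversely, which makes
  the matrix bounded with parameter \<open>d\<close>. Any \<open>n\<close> outside the cut bounds
  the witnesses, and \<open>overspill\<close> brings \<open>n\<close> into the cut.\<close>

lemma N_bnd:
  assumes "Sigma0 2 \<phi>" "range e \<subseteq> I" "range E \<subseteq> S"
  shows "sat N e E (bnd_inst \<phi>)"
  unfolding sat_bnd_inst N_simps
proof (intro impI ballI)
  fix m assume h: "\<forall>i\<in>I. \<exists>j\<in>I. sat N (j ## i ## e) E \<phi>" and m: "m \<in> I"
  from Sigma0_2_normal[OF assms(1)] obtain \<theta> where \<theta>: "nfS2 TYPE('m) \<phi> \<theta>" by blast
  have "Sig1 (\<lambda>e. \<not> sat N e E \<theta>)" using Del1_sat[OF nfD(1)[OF \<theta>] assms(3)] by (simp add: Del1_def)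
  from Sig1D[OF this] obtain Q where Q: "Bd I Q" "\<forall>e. range e \<subseteq> I \<longrightarrow> (\<not> sat N e E \<theta> \<longleftrightarrow> (\<exists>w\<in>I. Q (w ## e)))"
    by (elim exE conjE) (rule that)
  have s: "sat N (j ## i ## e) E \<phi> \<longleftrightarrow> (\<exists>u\<in>I. \<forall>v\<in>I. \<forall>w\<in>I. \<not> Q (w ## v ## u ## j ## i ## e))" if "i \<in> I" "j \<in> I" for i j
  proof -
    have "sat N (v ## u ## j ## i ## e) E \<theta> \<longleftrightarrow> (\<forall>w\<in>I. \<not> Q (w ## v ## u ## j ## i ## e))" if "v \<in> I" "u \<in> I" for u v
    proof -
      have "range (v ## u ## j ## i ## e) \<subseteq> I" using that \<open>i \<in> I\<close> \<open>j \<in> I\<close> assms(2) by simp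
      then show ?thesis using Q(2) by blast
    qed
    then show ?thesis using nfD(2)[OF \<theta> coll_model_N, of "j ## i ## e" E] that assms(2,3) by simp
  qed
  \<comment> \<open>One bound for the counterexample \<open>v\<close> and its Sigma_1 evidence
    \<open>w\<close>, so that \<open>Bd_elem\<close> applies to a single variable.\<close>
  define Q2 where "Q2 = (\<lambda>e :: nat \<Rightarrow> 'm. \<exists>v. v \<prec> e 0 \<and> (\<exists>w. w \<prec> e 0 \<and> Q (w ## v ## (\<lambda>i. e (Suc i)))))"
  have Q2: "Bd I Q2"
  proof -
    have env: "(\<lambda>i. (w ## v ## e) ((0 ## 1 ## (\<lambda>i. i + 3)) i)) = w ## v ## (\<lambda>i. e (Suc i))" for w v and e :: "nat \<Rightarrow> 'm"
      by (auto simp: fun_eq_iff eval_nat_numeral split: nat.split)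
    show ?thesis
      using Bd_ExB[OF Bd_ExB[OF Bd_ren[OF Q(1), of "0 ## 1 ## (\<lambda>i. i + 3)"], of "Var 1"], of "Var 0"]
      unfolding env Q2_def by simp
  qed
  have up: "\<not> Q2 (d ## u ## j ## i ## e)"
    if "\<forall>v\<in>I. \<forall>w\<in>I. \<not> Q (w ## v ## u ## j ## i ## e)" "i \<in> I" "j \<in> I" "u \<in> I" for i j u
  proof
    have "range (u ## j ## i ## e) \<subseteq> I" using that assms(2) by simp
    moreover assume "Q2 (d ## u ## j ## i ## e)"
    ultimately obtain b where "b \<in> I" "Q2 (b ## u ## j ## i ## e)" using Bd_elem[OF Q2] by blast
    then show False unfolding Q2_def using that(1) I_down_lt by auto
  qed
  let ?T = "\<lambda>e. \<forall>i. i \<prec> e 1 \<longrightarrow> (\<exists>j. j \<prec> e 0 \<and> (\<exists>u. u \<prec> e 0 \<and> \<not> Q2 (d ## u ## j ## i ## (\<lambda>i. e (Suc (Suc i))))))"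
  have "Bd UNIV ?T"
  proof -
    have B: "Bd UNIV (\<lambda>e. \<not> Q2 (d ## e))" using Bd_Neg[OF Bd_par[OF Bd_mono[OF Q2, of UNIV], of d]] by simp
    have env: "(\<lambda>k. (u ## j ## i ## e) ((0 ## 1 ## 2 ## (\<lambda>i. i + 5)) k)) = u ## j ## i ## (\<lambda>i. e (Suc (Suc i)))" for u j i and e :: "nat \<Rightarrow> 'm"
      by (auto simp: fun_eq_iff eval_nat_numeral split: nat.split)
    show ?thesis
      using Bd_AllB[OF Bd_ExB[OF Bd_ExB[OF Bd_ren[OF B, of "0 ## 1 ## 2 ## (\<lambda>i. i + 5)"], of "Var 2"], of "Var 1"], of "Var 1"]
      unfolding env by (simp add: numeral_2_eq_2)
  qed
  then have "\<exists>n\<in>I. ?T (n ## m ## e)"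
  proof (rule overspill)
    fix n assume n: "n \<notin> I"
    have "\<exists>j. j \<prec> n \<and> (\<exists>u. u \<prec> n \<and> \<not> Q2 (d ## u ## j ## i ## e))" if "i \<prec> m" for i
    proof -
      have i: "i \<in> I" using that m I_down_lt by blast
      then obtain j u where "j \<in> I" "u \<in> I" "\<forall>v\<in>I. \<forall>w\<in>I. \<not> Q (w ## v ## u ## j ## i ## e)" using h s by blast
      then show ?thesis using up i lt_outside n by blast
    qed
    then show "?T (n ## m ## e)" by simp
  qed
  then obtain n where n: "n \<in> I" "\<And>i. i \<prec> m \<Longrightarrow> \<exists>j. j \<prec> n \<and> (\<exists>u. u \<prec> n \<and> \<not> Q2 (d ## u ## j ## i ## e))" by auto
  have "\<exists>j\<in>I. j \<prec> n \<and> sat N (j ## i ## e) E \<phi>" if i: "i \<in> I" "i \<prec> m" for i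
  proof -
    obtain j u where ju: "j \<prec> n" "u \<prec> n" "\<not> Q2 (d ## u ## j ## i ## e)" using n(2)[OF i(2)] by blast
    have jI: "j \<in> I" "u \<in> I" using ju n(1) I_down_lt by blast+
    have "\<not> Q (w ## v ## u ## j ## i ## e)" if "v \<in> I" "w \<in> I" for v w
      using ju(3) lt_outside[OF that(1) d_I] lt_outside[OF that(2) d_I] unfolding Q2_def by auto
    then have "sat N (j ## i ## e) E \<phi>" unfolding s[OF i(1) jI(1)] using jI(2) by blast
    then show ?thesis using jI ju by blast
  qed
  then show "\<exists>n\<in>I. \<forall>i\<in>I. i \<prec> m \<longrightarrow> (\<exists>j\<in>I. j \<prec> n \<and> sat N (j ## i ## e) E \<phi>)" using n(1) by blast
qed

lemma basic_fms_bounded: "\<phi> \<in> basic_fms \<Longrightarrow> bounded \<phi>"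
  unfolding basic_fms_def by (auto intro!: bounded_rules)

lemma N_basic: "\<phi> \<in> basic_fms \<Longrightarrow> range e \<subseteq> I \<Longrightarrow> sat N e E \<phi>"
  using sat_N_bounded[OF basic_fms_bounded, of \<phi> E E e] basic_sat by simp

lemma N_axioms:
  assumes "\<phi> \<in> RCA0 \<union> BSigma 2" "range e \<subseteq> I" "range E \<subseteq> S"
  shows "sat N e E \<phi>"
proof -
  have uc: "sat N e E (univ_closure \<psi>)" if "\<And>e E. range e \<subseteq> I \<Longrightarrow> range E \<subseteq> S \<Longrightarrow> sat N e E \<psi>" for \<psi>
    using that assms(2,3) by (subst sat_univ_closure) auto
  consider \<psi> where "\<psi> \<in> basic_fms" "\<phi> = univ_closure \<psi>"
    | \<alpha> \<beta> where "Sigma0 1 \<alpha>" "Pi0 1 \<beta>" "\<phi> = univ_closure (comp_inst \<alpha> \<beta>)"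
    | \<psi> where "Sigma0 1 \<psi>" "\<phi> = univ_closure (ind_inst \<psi>)"
    | \<psi> where "Sigma0 2 \<psi>" "\<phi> = univ_closure (bnd_inst \<psi>)"
    using assms(1) unfolding RCA0_def basic_axioms_eq Delta1_CA_def ISigma_def BSigma_def by blast
  then show ?thesis
    by cases (simp_all only:, (intro uc N_basic N_comp N_ind N_bnd; assumption)+)
qed

subsection \<open>Failure of induction\<close>

definition bdd_row :: fm where
  "bdd_row = Ex (All (Imp (Less (Var 1) (Var 0)) (Neg (Mem (PRt (Var 2) (Var 0)) 0))))"

lemma Sigma0_bdd_row: "Sigma0 2 bdd_row"
proof -
  have "Sigma0 2 (All (Imp (Less (Var 1) (Var 0)) (Neg (Mem (PRt (Var 2) (Var 0)) 0))))"
    by (intro Sigma0_2_All bounded_rules)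
  then show ?thesis unfolding bdd_row_def numeral_2_eq_2 by (rule Sigma0_Pi0.intros(4))
qed

lemma prm_I: "x \<in> I \<Longrightarrow> y \<in> I \<Longrightarrow> prm M x y \<in> I"
  by (simp add: prm_def add_I mul_I)

lemma sat_bdd_row: "x \<in> I \<Longrightarrow> sat N (x ## e) (\<lambda>_. P \<inter> I) bdd_row \<longleftrightarrow> (\<exists>n. x = nmu M n)"
proof
  assume x: "x \<in> I"
  have s: "sat N (x ## e) (\<lambda>_. P \<inter> I) bdd_row \<longleftrightarrow> (\<exists>y\<in>I. \<forall>s\<in>I. y \<prec> s \<longrightarrow> prm M x s \<notin> P)"
    using x prm_I by (auto simp: bdd_row_def numeral_2_eq_2)
  {
    assume "sat N (x ## e) (\<lambda>_. P \<inter> I) bdd_row"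
    then obtain y where y: "y \<in> I" "\<And>s. s \<in> I \<Longrightarrow> y \<prec> s \<Longrightarrow> prm M x s \<notin> P" unfolding s by blast
    show "\<exists>n. x = nmu M n"
    proof (rule ccontr)
      assume n: "\<not> ?thesis"
      \<comment> \<open>A nonstandard \<open>x\<close> lies above all standard numbers, by induction
        outside the model.\<close>
      have gt: "nmu M n \<prec> x" for n
      proof (induction n)
        case 0
        then show ?case using n zero_le[of x] by (metis lq_def nmu.simps(1))
      next
        case (Suc n)
        then have "nmu M n \<oplus> \<one> \<preceq> x" by (simp add: succ_le_iff)
        then show ?case using n by (metis lq_def nmu.simps(2))
      qed
      obtain k where "y \<preceq> c k" using y(1) by (auto simp: I_def)
      then have "y \<prec> c (Suc k)" using c_Suc L.le_less_trans by blast
      then show False using y(2)[OF c_I] row1[OF gt] by blast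
    qed
  next
    assume "\<exists>n. x = nmu M n"
    then obtain n where "x = nmu M n" by blast
    then show "sat N (x ## e) (\<lambda>_. P \<inter> I) bdd_row" unfolding s using c_I row2 by blast
  }
qed

lemma N_not_ind: "range e \<subseteq> I \<Longrightarrow> range E \<subseteq> S \<Longrightarrow> \<not> sat N e E (univ_closure (ind_inst bdd_row))"
proof
  assume e: "range e \<subseteq> I" "range E \<subseteq> S" and "sat N e E (univ_closure (ind_inst bdd_row))"
  then have "sat N e (\<lambda>_. P \<inter> I) (ind_inst bdd_row)"
    using S_inter(1) by (subst (asm) sat_univ_closure) auto
  then have "sat N (\<zero> ## e) (\<lambda>_. P \<inter> I) bdd_row \<longrightarrow>
    (\<forall>x\<in>I. sat N (x ## e) (\<lambda>_. P \<inter> I) bdd_row \<longrightarrow> sat N ((x \<oplus> \<one>) ## e) (\<lambda>_. P \<inter> I) bdd_row) \<longrightarrow>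
    (\<forall>x\<in>I. sat N (x ## e) (\<lambda>_. P \<inter> I) bdd_row)" unfolding sat_ind_inst N_simps .
  moreover have "sat N (\<zero> ## e) (\<lambda>_. P \<inter> I) bdd_row"
    unfolding sat_bdd_row[OF zero_I] by (metis nmu.simps(1))
  moreover have "sat N ((x \<oplus> \<one>) ## e) (\<lambda>_. P \<inter> I) bdd_row" if "x \<in> I" "sat N (x ## e) (\<lambda>_. P \<inter> I) bdd_row" for x
    using that(2) unfolding sat_bdd_row[OF that(1)] sat_bdd_row[OF add_I[OF that(1) one_I]] by (metis nmu.simps(2))
  ultimately have "sat N (c 0 ## e) (\<lambda>_. P \<inter> I) bdd_row" using c_I by blast
  then show False unfolding sat_bdd_row[OF c_I] using c_nonstd lt_irrefl by metis
qed

end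

section \<open>Transfer of the second-order sentence\<close>

text \<open>A set \<open>Y\<close> that is \<open>\<Delta>\<^sub>1\<close> over the cut need not be \<open>\<Delta>\<^sub>1\<close> over the big model: its definitions \<open>\<alpha>\<close> of
  membership and \<open>\<beta>\<close> of non-membership may fail to be complementary there. The formula below says, at stage
  \<open>w\<close>, that \<open>y\<close> is not yet decided, or that an inconsistency shows up below \<open>y\<close>, or that \<open>y\<close> is not
  refuted as a witness for \<open>\<exists>y \<forall>z \<theta>(z,y,Y)\<close> by the part of \<open>Y\<close> known at stage \<open>w\<close>. In every case some
  \<open>y\<close> works for all \<open>w\<close>. The variables are \<open>w\<close>, \<open>y\<close>, then alternately the number parameters of \<open>\<theta>\<close> and
  those of \<open>\<alpha>\<close>, \<open>\<beta>\<close>.\<close>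

definition EV :: "fm \<Rightarrow> nat \<Rightarrow> fm" where
  "EV \<alpha> b = ExB (Var b) (ren (0 ## 1 ## (\<lambda>n. 2 * n + 5)) \<alpha>)"

definition XI :: "fm \<Rightarrow> fm \<Rightarrow> fm \<Rightarrow> tm \<Rightarrow> fm" where
  "XI \<alpha> \<beta> \<theta> q = Or (And (Neg (inst (EV \<alpha> 1) (Var 1))) (Neg (inst (EV \<beta> 1) (Var 1))))
    (Or (ExB (Var 1) (And (EV \<alpha> 2) (EV \<beta> 2)))
      (AllB (Var 0) (Imp
        (AllB (sub_tm (Var 0 ## Var 2 ## (\<lambda>n. Var (2 * n + 3))) q)
          (Or (ren (0 ## (\<lambda>n. n + 2)) (EV \<alpha> 1)) (ren (0 ## (\<lambda>n. n + 2)) (EV \<beta> 1))))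
        (tr 0 (ren (0 ## (\<lambda>n. n + 2)) (EV \<alpha> 1) ## (\<lambda>_. Mem (Var 0) 1)) (ren (0 ## 2 ## (\<lambda>n. 2 * n + 3)) \<theta>)))))"

definition evi :: "'m mdl \<Rightarrow> (nat \<Rightarrow> 'm set) \<Rightarrow> fm \<Rightarrow> (nat \<Rightarrow> 'm) \<Rightarrow> 'm \<Rightarrow> 'm \<Rightarrow> bool" where
  "evi M E \<alpha> p w v \<longleftrightarrow> (\<exists>u. lss M u w \<and> sat M (u ## v ## p) E \<alpha>)"

lemma bounded_EV: "bounded \<alpha> \<Longrightarrow> bounded (EV \<alpha> b)"
  unfolding EV_def by (intro bounded_rules bounded_sub)

lemma bounded_XI: "bounded \<alpha> \<Longrightarrow> bounded \<beta> \<Longrightarrow> bounded \<theta> \<Longrightarrow> bounded (XI \<alpha> \<beta> \<theta> q)"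
proof -
  assume b: "bounded \<alpha>" "bounded \<beta>" "bounded \<theta>"
  have "bounded ((ren (0 ## (\<lambda>n. n + 2)) (EV \<alpha> 1) ## (\<lambda>_. Mem (Var 0) 1)) X)" for X
    by (cases X) (auto intro!: bounded_rules bounded_sub bounded_EV b)
  then show ?thesis unfolding XI_def inst_def by (intro bounded_rules bounded_sub bounded_EV b bounded_tr)
qed

context arith
begin

lemma sat_EV:
  "sat M (v ## w ## y ## g) E (EV \<alpha> 1) \<longleftrightarrow> evi M E \<alpha> (\<lambda>n. g (2 * n + 1)) w v"
  "sat M (v ## w ## y ## g) E (EV \<alpha> 2) \<longleftrightarrow> evi M E \<alpha> (\<lambda>n. g (2 * n + 1)) y v"
proof -
  have env: "(\<lambda>n. (u ## v ## w ## y ## g) ((0 ## 1 ## (\<lambda>n. 2 * n + 5)) n)) = u ## v ## (\<lambda>n. g (2 * n + 1))" for u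
    by (auto simp: fun_eq_iff eval_nat_numeral split: nat.split)
  show "sat M (v ## w ## y ## g) E (EV \<alpha> 1) \<longleftrightarrow> evi M E \<alpha> (\<lambda>n. g (2 * n + 1)) w v"
    "sat M (v ## w ## y ## g) E (EV \<alpha> 2) \<longleftrightarrow> evi M E \<alpha> (\<lambda>n. g (2 * n + 1)) y v"
    unfolding EV_def sat_ExB evi_def sat_sub val.simps env by (simp_all add: numeral_2_eq_2)
qed

lemma sat_XI:
  assumes "bounded \<theta>"
  shows "sat M (w ## y ## g) (X ## (\<lambda>_. B)) (XI \<alpha> \<beta> \<theta> q) \<longleftrightarrow>
    (let a = evi M (X ## (\<lambda>_. B)) \<alpha> (\<lambda>n. g (2 * n + 1)); b = evi M (X ## (\<lambda>_. B)) \<beta> (\<lambda>n. g (2 * n + 1)) in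
      \<not> a w y \<and> \<not> b w y \<or> (\<exists>v. v \<prec> y \<and> a y v \<and> b y v) \<or>
      (\<forall>z. z \<prec> w \<longrightarrow> (\<forall>v. v \<prec> val M (z ## y ## (\<lambda>n. g (2 * n))) q \<longrightarrow> a w v \<or> b w v) \<longrightarrow>
        sat M (z ## y ## (\<lambda>n. g (2 * n))) ({v. a w v} ## (\<lambda>_. B)) \<theta>))"
proof -
  let ?E = "X ## (\<lambda>_. B)"
  have env1: "(\<lambda>n. (v ## z ## w ## y ## g) ((0 ## (\<lambda>n. n + 2)) n)) = v ## w ## y ## g" for v z
    by (auto simp: fun_eq_iff split: nat.split)
  have env2: "(\<lambda>n. (z ## w ## y ## g) ((0 ## 2 ## (\<lambda>n. 2 * n + 3)) n)) = z ## y ## (\<lambda>n. g (2 * n))" for z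
    by (auto simp: fun_eq_iff eval_nat_numeral split: nat.split)
  have env3: "(\<lambda>n. val M (z ## w ## y ## g) ((Var 0 ## Var 2 ## (\<lambda>n. Var (2 * n + 3))) n)) = z ## y ## (\<lambda>n. g (2 * n))" for z
    by (auto simp: fun_eq_iff eval_nat_numeral split: nat.split)
  have r: "sat M (v ## z ## w ## y ## g) ?E (ren (0 ## (\<lambda>n. n + 2)) (EV \<gamma> 1)) \<longleftrightarrow> evi M ?E \<gamma> (\<lambda>n. g (2 * n + 1)) w v" for v z \<gamma>
    unfolding sat_sub val.simps env1 by (simp add: sat_EV del: One_nat_def)
  have set: "(\<lambda>Y. {v. sat M (v ## (\<lambda>n. (z ## w ## y ## g) (n + 0))) ?E ((ren (0 ## (\<lambda>n. n + 2)) (EV \<alpha> 1) ## (\<lambda>_. Mem (Var 0) 1)) Y)})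
    = {v. evi M ?E \<alpha> (\<lambda>n. g (2 * n + 1)) w v} ## (\<lambda>_. B)" for z
    using r by (auto simp: fun_eq_iff split: nat.split)
  have sf: "set_free (ren (0 ## 2 ## (\<lambda>n. 2 * n + 3)) \<theta>)" by (intro bounded_set_free bounded_sub assms)
  have t: "sat M (z ## w ## y ## g) ?E (tr 0 (ren (0 ## (\<lambda>n. n + 2)) (EV \<alpha> 1) ## (\<lambda>_. Mem (Var 0) 1)) (ren (0 ## 2 ## (\<lambda>n. 2 * n + 3)) \<theta>)) \<longleftrightarrow>
    sat M (z ## y ## (\<lambda>n. g (2 * n))) ({v. evi M ?E \<alpha> (\<lambda>n. g (2 * n + 1)) w v} ## (\<lambda>_. B)) \<theta>" for z
    unfolding sat_tr[OF sf] set by (simp only: sat_sub val.simps env2 comp_id)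
  have con: "sat M e E (Or \<phi> \<psi>) \<longleftrightarrow> sat M e E \<phi> \<or> sat M e E \<psi>" "sat M e E (And \<phi> \<psi>) \<longleftrightarrow> sat M e E \<phi> \<and> sat M e E \<psi>"
    "sat M e E (Neg \<phi>) \<longleftrightarrow> \<not> sat M e E \<phi>" for e E \<phi> \<psi> by auto
  have imp: "sat M e E (Imp \<phi> (tr 0 \<delta> \<psi>)) \<longleftrightarrow> (sat M e E \<phi> \<longrightarrow> sat M e E (tr 0 \<delta> \<psi>))" for e E \<phi> \<psi> \<delta> by simp
  have v: "val M (w ## y ## g) (Var 0) = w" "val M (w ## y ## g) (Var 1) = y"
    "val M (z ## w ## y ## g) (sub_tm (Var 0 ## Var 2 ## (\<lambda>n. Var (2 * n + 3))) q) = val M (z ## y ## (\<lambda>n. g (2 * n))) q" for z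
    by (simp, simp, simp only: val_sub_tm env3)
  have i: "sat M (w ## y ## g) ?E (inst (EV \<gamma> 1) (Var 1)) \<longleftrightarrow> evi M ?E \<gamma> (\<lambda>n. g (2 * n + 1)) w y" for \<gamma>
    unfolding sat_inst v by (rule sat_EV)
  show ?thesis
    unfolding XI_def con(1)[of _ _ "And _ _"] con(1)[of _ _ "ExB _ _"] con(2)[of _ _ "Neg _" "Neg _"] con(3)[of _ _ "inst _ _"] i
      sat_ExB sat_AllB imp v con(1)[of _ _ "ren _ _"] con(2)[of _ _ "EV _ _"] r t sat_EV Let_def
    by blast
qed

lemma evi_mono: "evi M E \<alpha> p w v \<Longrightarrow> w \<preceq> w' \<Longrightarrow> evi M E \<alpha> p w' v"
  unfolding evi_def using L.less_le_trans by blast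

end

lemma (in base) XI_valid:
  assumes b: "bounded \<alpha>" "bounded \<beta>" "bounded \<theta>" and q: "query_bound TYPE('m) \<theta> q"
    and X: "X \<in> sets M" and B: "B \<in> sets M"
    and T: "\<And>Y e. Y \<in> sets M \<Longrightarrow> \<exists>y. \<forall>z. sat M (z ## y ## e) (Y ## (\<lambda>_. B)) \<theta>"
  shows "\<exists>y. \<forall>w. sat M (w ## y ## g) (X ## (\<lambda>_. B)) (XI \<alpha> \<beta> \<theta> q)"
proof -
  let ?E = "X ## (\<lambda>_. B)"
  let ?p = "\<lambda>n. g (2 * n + 1)"
  define a where "a = evi M ?E \<alpha> ?p"
  define b' where "b' = evi M ?E \<beta> ?p"
  have s: "sat M (w ## y ## g) ?E (XI \<alpha> \<beta> \<theta> q) \<longleftrightarrow>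
      \<not> a w y \<and> \<not> b' w y \<or> (\<exists>v. v \<prec> y \<and> a y v \<and> b' y v) \<or>
      (\<forall>z. z \<prec> w \<longrightarrow> (\<forall>v. v \<prec> val M (z ## y ## (\<lambda>n. g (2 * n))) q \<longrightarrow> a w v \<or> b' w v) \<longrightarrow>
        sat M (z ## y ## (\<lambda>n. g (2 * n))) ({v. a w v} ## (\<lambda>_. B)) \<theta>)" for w y
    using sat_XI[OF b(3), of w y g X B \<alpha> \<beta> q] unfolding Let_def a_def b'_def .
  consider v where "\<forall>w. \<not> a w v \<and> \<not> b' w v" | v w where "a w v" "b' w v"
    | "\<forall>v. \<exists>w. a w v \<or> b' w v" "\<forall>v w w'. \<not> (a w v \<and> b' w' v)"
  proof -
    have "a (w \<oplus> w') v" "b' (w \<oplus> w') v" if "a w v" "b' w' v" for w w' v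
      using that evi_mono le_add1 le_add2 unfolding a_def b'_def by metis+
    then show thesis using that by blast
  qed
  then show ?thesis
  proof cases
    case 1
    then show ?thesis unfolding s by blast
  next
    case 2
    \<comment> \<open>Beyond both the contradictory number and the stage at which the contradiction
      shows up.\<close>
    let ?y = "v \<oplus> w \<oplus> \<one>"
    have "v \<prec> ?y" "w \<preceq> ?y" by (simp_all add: lt_succ_iff L.less_imp_le)
    then have "v \<prec> ?y" "a ?y v" "b' ?y v" using 2 evi_mono unfolding a_def b'_def by blast+
    then show ?thesis unfolding s by blast
  next
    case 3
    have a: "(\<exists>w. a w v) \<longleftrightarrow> (\<exists>u. sat M (u ## v ## ?p) ?E \<alpha>)" for v
      unfolding a_def evi_def using lt_succ by blast
    have b': "(\<exists>w. b' w v) \<longleftrightarrow> (\<exists>u. sat M (u ## v ## ?p) ?E \<beta>)" for v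
      unfolding b'_def evi_def using lt_succ by blast
    \<comment> \<open>Total and consistent evidence makes the set Delta_1 in this model, so
      \<open>Y\<close> exists and \<open>T\<close> supplies a witness for it.\<close>
    have "\<exists>Y\<in>sets M. \<forall>v. v \<in> Y \<longleftrightarrow> (\<exists>u. sat M (u ## v ## ?p) ?E \<alpha>)"
    proof (rule ca[OF b(1,2)])
      show "range ?E \<subseteq> sets M" using X B by auto
      show "(\<exists>u. sat M (u ## v ## ?p) ?E \<alpha>) \<longleftrightarrow> \<not> (\<exists>u. sat M (u ## v ## ?p) ?E \<beta>)" for v
        unfolding a[symmetric] b'[symmetric] using 3 by blast
    qed
    then obtain Y where Y: "Y \<in> sets M" "\<And>v. v \<in> Y \<longleftrightarrow> (\<exists>w. a w v)" unfolding a by blast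
    obtain y where y: "\<And>z. sat M (z ## y ## (\<lambda>n. g (2 * n))) (Y ## (\<lambda>_. B)) \<theta>" using T[OF Y(1)] by blast
    \<comment> \<open>If everything below the query bound is decided at stage \<open>w\<close>, the
      part known there agrees with \<open>Y\<close> as far as \<open>\<theta>\<close> asks.\<close>
    have "sat M (z ## y ## (\<lambda>n. g (2 * n))) ({v. a w v} ## (\<lambda>_. B)) \<theta>"
      if "\<forall>v. v \<prec> val M (z ## y ## (\<lambda>n. g (2 * n))) q \<longrightarrow> a w v \<or> b' w v" for z w
    proof -
      have "sat M (z ## y ## (\<lambda>n. g (2 * n))) ({v. a w v} ## (\<lambda>_. B)) \<theta> \<longleftrightarrow>
        sat M (z ## y ## (\<lambda>n. g (2 * n))) (Y ## (\<lambda>_. B)) \<theta>"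
        by (rule query_boundD[OF q arith_axioms]) (use that Y(2) 3(2) in \<open>auto split: nat.split\<close>)
      then show ?thesis using y by simp
    qed
    then show ?thesis unfolding s by blast
  qed
qed

context cut
begin

lemma S_definition:
  assumes "Y \<in> S"
  shows "\<exists>\<alpha> \<beta> p. bounded \<alpha> \<and> bounded \<beta> \<and> range p \<subseteq> I \<and>
    (\<forall>v\<in>I. v \<in> Y \<longleftrightarrow> (\<exists>u\<in>I. sat M (u ## v ## p) EA \<alpha>)) \<and>
    (\<forall>v\<in>I. v \<notin> Y \<longleftrightarrow> (\<exists>u\<in>I. sat M (u ## v ## p) EA \<beta>))"
proof -
  have z: "range (\<lambda>_::nat. \<zero>) \<subseteq> I" using zero_I by auto
  have def: "\<exists>\<alpha> p. bounded \<alpha> \<and> range p \<subseteq> I \<and> (\<forall>v\<in>I. R (v ## (\<lambda>_. \<zero>)) \<longleftrightarrow> (\<exists>u\<in>I. sat M (u ## v ## p) EA \<alpha>))"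
    if "Sig1 R" for R
  proof -
    from Sig1D[OF that] obtain Q where Q: "Bd I Q" "\<forall>e. range e \<subseteq> I \<longrightarrow> (R e \<longleftrightarrow> (\<exists>u\<in>I. Q (u ## e)))"
      by (elim exE conjE)
    obtain \<alpha> p where p: "bounded \<alpha>" "range p \<subseteq> I" "\<forall>x y. Q (x ## y ## (\<lambda>_. \<zero>)) \<longleftrightarrow> sat M (x ## y ## p) EA \<alpha>"
      using Bd_conv[OF Q(1) z zero_I] by (elim exE conjE)
    have "R (v ## (\<lambda>_. \<zero>)) \<longleftrightarrow> (\<exists>u\<in>I. sat M (u ## v ## p) EA \<alpha>)" if "v \<in> I" for v
    proof -
      have "range (v ## (\<lambda>_. \<zero>)) \<subseteq> I" using that z by simp
      then show ?thesis using Q(2) p(3) by simp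
    qed
    then show ?thesis using p(1,2) by blast
  qed
  have "Sig1 (\<lambda>e. e 0 \<in> Y)" "Sig1 (\<lambda>e. e 0 \<notin> Y)" using assms by (auto simp: S_def Del1_def)
  from def[OF this(1)] def[OF this(2)] obtain \<alpha> p \<beta> p'
    where *: "bounded \<alpha>" "range p \<subseteq> I" "\<forall>v\<in>I. (v ## (\<lambda>_. \<zero>)) 0 \<in> Y \<longleftrightarrow> (\<exists>u\<in>I. sat M (u ## v ## p) EA \<alpha>)"
      "bounded \<beta>" "range p' \<subseteq> I" "\<forall>v\<in>I. (v ## (\<lambda>_. \<zero>)) 0 \<notin> Y \<longleftrightarrow> (\<exists>u\<in>I. sat M (u ## v ## p') EA \<beta>)"
    by (elim exE conjE)
  \<comment> \<open>Interleaving gives both definitions a common list of parameters, as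
    \<open>XI\<close> expects.\<close>
  let ?p = "\<lambda>n. if even n then p (n div 2) else p' (n div 2)"
  let ?\<alpha> = "ren (0 ## 1 ## (\<lambda>n. 2 * n + 2)) \<alpha>"
  let ?\<beta> = "ren (0 ## 1 ## (\<lambda>n. 2 * n + 3)) \<beta>"
  have 1: "(\<lambda>n. (u ## v ## ?p) ((0 ## 1 ## (\<lambda>n. 2 * n + 2)) n)) = u ## v ## p" for u v
    by (auto simp: fun_eq_iff add_2_eq_Suc' split: nat.split)
  have 2: "(\<lambda>n. (u ## v ## ?p) ((0 ## 1 ## (\<lambda>n. 2 * n + 3)) n)) = u ## v ## p'" for u v
    by (auto simp: fun_eq_iff numeral_3_eq_3 split: nat.split)
  have "sat M (u ## v ## ?p) EA ?\<alpha> \<longleftrightarrow> sat M (u ## v ## p) EA \<alpha>"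
    "sat M (u ## v ## ?p) EA ?\<beta> \<longleftrightarrow> sat M (u ## v ## p') EA \<beta>" for u v
    by (simp_all only: sat_sub val.simps comp_id 1 2)
  moreover have "range ?p \<subseteq> I" using *(2,5) by auto
  moreover have "bounded ?\<alpha>" "bounded ?\<beta>" using * by (auto intro: bounded_sub)
  ultimately show ?thesis using *(3,6)
    by (intro exI[of _ ?\<alpha>] exI[of _ ?\<beta>] exI[of _ ?p]) simp
qed

text \<open>\<open>XI_valid\<close> and \<open>witI\<close> give a \<open>y\<close> in the cut that
  works for all stages \<open>w\<close>. For \<open>w\<close> in the cut evidence is truthful:
  \<open>y\<close> gets decided and no inconsistency shows up below it, so only the last alternative
  of \<open>XI\<close> remains, and at a late stage it says that \<open>\<theta>\<close> holds of
  \<open>Y\<close> itself.\<close>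

lemma N_Pi3:
  assumes b: "bounded \<theta>"
    and T: "\<And>Y e. Y \<in> sets M0 \<Longrightarrow> \<exists>y. \<forall>z. sat M0 (z ## y ## e) (Y ## (\<lambda>_. A0)) \<theta>"
    and Y: "Y \<in> S" and e: "range e \<subseteq> I"
  shows "\<exists>y\<in>I. \<forall>z\<in>I. sat N (z ## y ## e) (Y ## (\<lambda>_. A \<inter> I)) \<theta>"
proof -
  obtain \<alpha> \<beta> p where ab: "bounded \<alpha>" "bounded \<beta>" and p: "range p \<subseteq> I"
    and al: "\<forall>v\<in>I. v \<in> Y \<longleftrightarrow> (\<exists>u\<in>I. sat M (u ## v ## p) EA \<alpha>)"
    and be: "\<forall>v\<in>I. v \<notin> Y \<longleftrightarrow> (\<exists>u\<in>I. sat M (u ## v ## p) EA \<beta>)"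
    using S_definition[OF Y] by (elim exE conjE)
  obtain q where q: "query_bound TYPE('m) \<theta> q" using ex_query_bound[OF b] by blast
  let ?g = "\<lambda>n. if even n then e (n div 2) else p (n div 2)"
  have g: "(\<lambda>n. ?g (2 * n)) = e" "(\<lambda>n. ?g (2 * n + 1)) = p" by auto
  have gI: "range ?g \<subseteq> I" using e p by auto
  interpret M0: base M0 by (rule base0)
  have "\<exists>y\<in>I. \<forall>w. sat M (w ## y ## ?g) EA (XI \<alpha> \<beta> \<theta> q)"
    by (rule witI[OF bounded_XI[OF ab b] _ gI]) (rule M0.XI_valid[OF ab b q _ A0 T])
  then obtain y where y: "y \<in> I" and xi: "\<And>w. sat M (w ## y ## ?g) EA (XI \<alpha> \<beta> \<theta> q)" by blast
  define a where "a = evi M EA \<alpha> p"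
  define b' where "b' = evi M EA \<beta> p"
  have s: "\<not> a w y \<and> \<not> b' w y \<or> (\<exists>v. v \<prec> y \<and> a y v \<and> b' y v) \<or>
      (\<forall>z. z \<prec> w \<longrightarrow> (\<forall>v. v \<prec> val M (z ## y ## e) q \<longrightarrow> a w v \<or> b' w v) \<longrightarrow>
        sat M (z ## y ## e) ({v. a w v} ## (\<lambda>_. A)) \<theta>)" for w
    using xi[of w] unfolding sat_XI[OF b] g Let_def a_def b'_def .
  have aY: "v \<in> Y" if "a w v" "v \<in> I" "w \<in> I" for v w
    using that al I_down_lt unfolding a_def evi_def by blast
  have bY: "v \<notin> Y" if "b' w v" "v \<in> I" "w \<in> I" for v w
    using that be I_down_lt unfolding b'_def evi_def by blast
  have dec: "\<exists>u\<in>I. sat M (u ## v ## p) EA \<alpha> \<or> sat M (u ## v ## p) EA \<beta>" if "v \<in> I" for v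
    using that al be by blast
  obtain u0 where u0: "u0 \<in> I" "sat M (u0 ## y ## p) EA \<alpha> \<or> sat M (u0 ## y ## p) EA \<beta>" using dec[OF y] by blast
  have "sat N (z ## y ## e) (Y ## (\<lambda>_. A \<inter> I)) \<theta>" if z: "z \<in> I" for z
  proof -
    have zye: "range (z ## y ## e) \<subseteq> I" using z y e by simp
    let ?q = "val M (z ## y ## e) q"
    have qI: "?q \<in> I" by (rule val_I[OF zye])
    \<comment> \<open>Collection in the cut yields a stage that decides all numbers below the query
      bound; the projections merely match the shape of \<open>Bd_sat2\<close>.\<close>
    have "\<exists>w\<in>I. \<forall>v. v \<prec> ?q \<longrightarrow> (\<exists>u. u \<prec> w \<and> (sat M ((u ## v ## e) 0 ## (u ## v ## e) 1 ## p) EA \<alpha> \<or> sat M ((u ## v ## e) 0 ## (u ## v ## e) 1 ## p) EA \<beta>))"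
      by (rule Sig1_coll[OF Sig1_Bd[OF Bd_Or[OF Bd_sat2[OF ab(1) p] Bd_sat2[OF ab(2) p]]] qI e])
        (use dec I_down_lt[OF qI] in simp)
    then obtain w1 where w1: "w1 \<in> I" "\<And>v. v \<prec> ?q \<Longrightarrow> \<exists>u. u \<prec> w1 \<and> (sat M (u ## v ## p) EA \<alpha> \<or> sat M (u ## v ## p) EA \<beta>)"
      by auto
    \<comment> \<open>Late enough to decide \<open>y\<close>, to include \<open>z\<close> and to
      decide every query.\<close>
    let ?w = "u0 \<oplus> z \<oplus> w1 \<oplus> \<one>"
    have wI: "?w \<in> I" by (intro add_I u0 z w1 one_I)
    have "u0 \<preceq> u0 \<oplus> z \<oplus> w1" "z \<preceq> u0 \<oplus> z \<oplus> w1" "w1 \<preceq> ?w"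
      by (meson L.order_trans le_add1 le_add2)+
    then have w: "u0 \<prec> ?w" "z \<prec> ?w" "w1 \<preceq> ?w" by (auto simp: lt_succ_iff)
    have "a ?w y \<or> b' ?w y" using u0(2) w(1) unfolding a_def b'_def evi_def by blast
    moreover have "\<not> (v \<prec> y \<and> a y v \<and> b' y v)" for v
      using aY[of y v] bY[of y v] y I_down_lt[OF y] by blast
    moreover have d: "a ?w v \<or> b' ?w v" if "v \<prec> ?q" for v
      using w1(2)[OF that] w(3) L.less_le_trans unfolding a_def b'_def evi_def by blast
    ultimately have sat: "sat M (z ## y ## e) ({v. a ?w v} ## (\<lambda>_. A)) \<theta>" using s[of ?w] w(2) by blast
    have "sat M (z ## y ## e) ({v. a ?w v} ## (\<lambda>_. A)) \<theta> \<longleftrightarrow> sat M (z ## y ## e) (Y ## (\<lambda>_. A)) \<theta>"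
    proof (rule query_boundD[OF q arith_axioms])
      fix X v assume v: "v \<prec> ?q"
      have "a ?w v \<longleftrightarrow> v \<in> Y" using d[OF v] aY bY wI I_down_lt[OF qI v] by blast
      then show "v \<in> ({v. a ?w v} ## (\<lambda>_. A)) X \<longleftrightarrow> v \<in> (Y ## (\<lambda>_. A)) X" by (cases X) auto
    qed
    moreover have "sat N (z ## y ## e) (Y ## (\<lambda>_. A \<inter> I)) \<theta> \<longleftrightarrow> sat M (z ## y ## e) (Y ## (\<lambda>_. A)) \<theta>"
      by (rule sat_N_bounded[OF b _ zye]) (auto split: nat.split)
    ultimately show ?thesis using sat by simp
  qed
  then show ?thesis using y by blast
qed

end

theorem theorem4p2:
  fixes \<Psi> :: fm
  assumes "Pi0 3 \<Psi>"
    and "sentence (ExS (AllS \<Psi>))"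
    and "consistent (RCA0 \<union> BSigma 2 \<union> {ExS (AllS \<Psi>)})"
  shows "\<not> (\<forall>\<chi> \<in> ISigma 2. RCA0 \<union> BSigma 2 \<union> {ExS (AllS \<Psi>)} \<turnstile> \<chi>)"
proof
  let ?T = "RCA0 \<union> BSigma 2 \<union> {ExS (AllS \<Psi>)}"
  assume prov: "\<forall>\<chi> \<in> ISigma 2. ?T \<turnstile> \<chi>"
  have nb: "nbound \<Psi> = 0" and sb: "sbound \<Psi> \<le> 2" using assms(2) by (auto simp: sentence_def)
  \<comment> \<open>\<open>\<Psi>\<close> has no free number variable and only the set variables 0,
    for the universal set, and 1, for the witness, so the environments may be exchanged
    elsewhere.\<close>
  have cong: "sat M e E \<Psi> \<longleftrightarrow> sat M e' E' \<Psi>" if "E 0 = E' 0" "E 1 = E' 1" for M :: "nat mdl" and e e' E E'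
  proof (rule sat_cong)
    fix X assume "X \<in> fvs \<Psi>"
    then have "X = 0 \<or> X = 1" using fvs_sbound sb by fastforce
    then show "E X = E' X" using that by auto
  qed (use nb fvn_nbound in fastforce)
  have "succ_axioms \<subseteq> ?T"
  proof -
    let ?a = "Neg (Eq (Add (Var 0) One) Zero)" and ?b = "Imp (Eq (Add (Var 0) One) (Add (Var 1) One)) (Eq (Var 0) (Var 1))"
    have "univ_closure ?a \<in> basic_axioms" "univ_closure ?b \<in> basic_axioms"
      unfolding basic_axioms_def by (rule imageI, simp)+
    then show ?thesis unfolding succ_axioms_def by (simp add: univ_closure_def RCA0_def numeral_2_eq_2)
  qed
  from model_existence[OF assms(3) this] obtain M0 :: "nat mdl" and e0 E0
    where M0: "mdl.dom M0 = UNIV" "range E0 \<subseteq> sets M0" "\<forall>\<phi>\<in>?T. sat M0 e0 E0 \<phi>"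
    by (elim exE conjE)
  have base0: "base M0" by (rule base_of_axioms[OF M0(1,2)]) (use M0(3) in blast)
  then interpret M0: base M0 .
  have "sat M0 e0 E0 (ExS (AllS \<Psi>))" using M0(3) by blast
  then obtain A0 where A0: "A0 \<in> sets M0" "\<And>Y. Y \<in> sets M0 \<Longrightarrow> sat M0 e0 (Y ## A0 ## E0) \<Psi>" by auto
  have \<Psi>0: "sat M0 e (Y ## (\<lambda>_. A0)) \<Psi>" if "Y \<in> sets M0" for Y e
    using A0(2)[OF that] cong[of "Y ## A0 ## E0" "Y ## (\<lambda>_. A0)" M0 e0 e] by simp
  obtain M P A c d where cut:
    "arith M {P, A}" "\<forall>n. lss M (nmu M n) (c 0)" "\<forall>n. lss M (c n) (c (Suc n))" "\<forall>n. lss M (c n) (d :: nat)"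
    "\<forall>n m. lss M (nmu M n) m \<longrightarrow> prm M m (c (Suc n)) \<in> P"
    "\<forall>n s. lss M (c n) s \<longrightarrow> prm M (nmu M n) s \<notin> P"
    "\<forall>\<theta> n e. bounded \<theta> \<longrightarrow> (\<forall>X\<in>sets M0. \<forall>e. \<exists>y. \<forall>z. sat M0 (z ## y ## e) (X ## (\<lambda>_. A0)) \<theta>) \<longrightarrow>
      (\<forall>i. lss M (e i) (add M (c n) (one M))) \<longrightarrow>
      (\<exists>y. lss M y (c (Suc n)) \<and> (\<forall>z. sat M (z ## y ## e) (P ## (\<lambda>_. A)) \<theta>))"
    using ex_seq_model[OF base0 A0(1)] by (elim exE conjE)
  interpret cut M P A M0 A0 c d
    by (intro cut.intro cut_axioms.intro) (use cut base0 A0(1) in simp_all)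
  from Pi0_3_normal[OF assms(1)] obtain \<theta> k where \<theta>: "nfP3 TYPE(nat) k \<Psi> \<theta>" by blast
  have T0: "\<exists>y. \<forall>z. sat M0 (z ## y ## e) (Y ## (\<lambda>_. A0)) \<theta>" if Y: "Y \<in> sets M0" for Y e
  proof -
    have "range (Y ## (\<lambda>_. A0)) \<subseteq> sets M0" using Y A0(1) by auto
    \<comment> \<open>\<open>e\<close> is an extension of its own tail by \<open>k\<close> entries,
      and \<open>\<Psi>\<close> holds in every number environment.\<close>
    from nfD(2)[OF \<theta> M0.coll_model[OF refl] _ this, of "\<lambda>n. e (n + k)"] \<Psi>0[OF Y]
    show ?thesis by auto
  qed
  have Pi3: "\<exists>y\<in>I. \<forall>z\<in>I. sat N (z ## y ## e) (Y ## (\<lambda>_. A \<inter> I)) \<theta>" if "Y \<in> S" "range e \<subseteq> I" for Y e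
    by (rule N_Pi3[OF nfD(1)[OF \<theta>] _ that]) (rule T0)
  let ?e = "\<lambda>_::nat. zer M" and ?E = "\<lambda>_::nat. A \<inter> I"
  have e: "range ?e \<subseteq> I" and E: "range ?E \<subseteq> S" using zero_I S_inter by auto
  have "sat N ?e (Y ## ?E) \<Psi>" if "Y \<in> S" for Y
  proof -
    have "range (Y ## ?E) \<subseteq> sets N" using that E by simp
    from nfD(2)[OF \<theta> coll_model_N _ this, of ?e] Pi3[OF that] e show ?thesis by simp
  qed
  then have "sat N ?e ?E (ExS (AllS \<Psi>))"
    using S_inter(2) cong[of "_ ## ?E" "_ ## (A \<inter> I) ## ?E" N ?e ?e] by auto
  then have T: "\<forall>\<phi>\<in>?T. sat N ?e ?E \<phi>" using N_axioms[OF _ e E] by blast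
  have "univ_closure (ind_inst bdd_row) \<in> ISigma 2" unfolding ISigma_def using Sigma0_bdd_row by blast
  then have "?T \<turnstile> univ_closure (ind_inst bdd_row)" using prov by blast
  from soundness[OF this wfm_N _ _ T] show False using N_not_ind[OF e E] e E by simp
qed

end
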